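(* Let $S$ be a spray on a smooth manifold $M$ with canonical connection $\Gamma_S$, let $\nabla$ be a lift of $\Gamma_S$ with torsion ${\rm T}$ and let $D^w$ denote the associated operators. Let $\mathcal{O}\subseteq M$ be open, $W\in\mathfrak{X}(\mathcal{O})$ nowhere null, and $\lambda:I\to M$ a regular curve. (1) If ${\rm T}(S,Y)=0$ for all $Y$, then the map $D^W_W\,\cdot:\mathfrak{X}(\mathcal{O})\to\mathfrak{X}(\mathcal{O})$ does not depend on the choice of $\nabla$ (among lifts of $\Gamma_S$ whose torsion has this property), but only on $S$; equivalently, under the same condition, the map $D^{\dot\lambda}/dt:\mathfrak{X}(\lambda)\to\mathfrak{X}(\lambda)$ is intrinsic to $S$. (2) If ${\rm T}(X,Y)=0$ for all $X,Y$, then any lift may be used in place of the horizontal one in the definitions of $D^w_uV$ and $D^wV/dt$: that is, $D^w_uV=i_w^{-1}\nabla_XV^{\mathfrak v}$ for any $X\in T_w(TM\setminus 0)$ with ${\rm d}\pi(X)=u$, and $\frac{D^wV}{dt}=i_w^{-1}\bigl(\frac{\nabla V^{\mathfrak v}}{dt}\bigr)(t_0)$ where $V^{\mathfrak v}$ is the vertical lift of $V\in\mathfrak{X}(\lambda)$ along any curve $\overline\lambda$ in $TM\setminus 0$ with $\pi\circ\overline\lambda=\lambda$ and $\overline\lambda(t_0)=w$.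
   Context: Let $\pi:TM\setminus 0\to M$ be the tangent bundle with the zero section removed, $\mathscr{V}TM=\ker({\rm d}\pi)\subset T(TM\setminus 0)$ the vertical bundle, regarded as a vector bundle over $TM\setminus 0$. For $w\in TM\setminus 0$, $i_w:T_{\pi(w)}M\to\mathscr{V}_wTM$, $i_w(u)=\frac{d}{dt}|_{t=0}(w+tu)$. The canonical vector field is $C(w)=i_w(w)$, and $\mathscr{J}(X)=i_w({\rm d}\pi(X))$ for $X\in T_w(TM\setminus 0)$. $\mathfrak{X}(\lambda)$ denotes the smooth vector fields along a curve $\lambda$ in $M$. A spray is a smooth vector field $S$ on $TM\setminus 0$ with $\mathscr{J}(S)=C$ and $[C,S]=S$. Its canonical connection is $\Gamma_S=-[S,\mathscr{J}]$, i.e. $\Gamma_S(Y)=\mathscr{J}[S,Y]-[S,\mathscr{J}(Y)]$; it satisfies $\Gamma_S^2={\bf I}$ and $\ker(\Gamma_S+{\bf I})=\mathscr{V}TM$. With $\mathscr{H}TM=\ker(\Gamma_S-{\bf I})$ (horizontal vectors) one has $T(TM\setminus 0)=\mathscr{H}TM\oplus\mathscr{V}TM$, with projections denoted $\mathscr{H},\mathscr{V}$; $S$ is horizontal. $u^{\mathfrak h}$ denotes the horizontal lift at $w$ of $u\in T_{\pi(w)}M$. A linear connection $\nabla$ on the vector bundle $\mathscr{V}TM\to TM\setminus 0$ is a lift of $\Gamma_S$ if $\nabla_XC=\mathscr{V}X$ for all $X\in T(TM\setminus 0)$. Its torsion is ${\rm T}(X,Y)=\nabla_X\mathscr{J}(Y)-\nabla_Y\mathscr{J}(X)-\mathscr{J}[X,Y]$,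 $X,Y\in\mathfrak{X}(TM\setminus 0)$. The vertical lift of a vector field $V$ on $\mathcal{O}$ is $V^{\mathfrak v}(z)=i_z(V(\pi(z)))$; if $V$ is a vector field along $\lambda$ and $\overline\lambda$ is a lift of $\lambda$ to $TM\setminus 0$, the vertical lift of $V$ along $\overline\lambda$ is $t\mapsto i_{\overline\lambda(t)}V(t)$. For $w\in T_xM\setminus 0$, $u\in T_xM$, and $V$ a vector field near $x$, $D^w_uV:=i_w^{-1}\nabla_{u^{\mathfrak h}}V^{\mathfrak v}$. If $\lambda(t_0)=\pi(w)$ and $V\in\mathfrak{X}(\lambda)$, $\frac{D^wV}{dt}:=i_w^{-1}\bigl(\frac{\nabla V^{\mathfrak v}}{dt}\bigr)(t_0)$, with $V^{\mathfrak v}$ the vertical lift of $V$ along the horizontal lift of $\lambda$ through $w$ at $t=t_0$. For nowhere null $W$ on $\mathcal{O}$ (resp. along $\lambda$), $(D^W_UV)(x)=D^{W(x)}_{U(x)}V$ (resp. $\frac{D^WV}{dt}(t_0)=\frac{D^{W(t_0)}V}{dt}$). *)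

theory Defs
  imports "HOL-Analysis.Analysis" "HOL-Library.Function_Algebras"
begin

text \<open>
  Pointwise real vector space structure on functions; the additive part is in
  \<open>Function_Algebras\<close>.
\<close>

instantiation "fun" :: (type, real_vector) real_vector
begin

definition scaleR_fun :: "real \<Rightarrow> ('a \<Rightarrow> 'b) \<Rightarrow> 'a \<Rightarrow> 'b"
  where "scaleR_fun a f = (\<lambda>x. a *\<^sub>R f x)"

instance
  by standard (auto simp: scaleR_fun_def fun_eq_iff scaleR_right_distrib scaleR_left_distrib)

end


section \<open>Smoothness in normed spaces\<close>

text \<open>
  Derivatives are taken within the set, so that the notion also covers curves on intervals that
  contain end points. It is only used for open sets and for relatively open subsets of
  nondegenerate intervals, where derivatives within the set are unique.
\<close>

primrec Ck_on :: "nat \<Rightarrow> 'a::real_normed_vector set \<Rightarrow> ('a \<Rightarrow> 'b::real_normed_vector) \<Rightarrow> bool"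
  where
    "Ck_on 0 U f \<longleftrightarrow> continuous_on U f"
  | "Ck_on (Suc k) U f \<longleftrightarrow> f differentiable_on U \<and>
       (\<forall>v. Ck_on k U (\<lambda>x. frechet_derivative f (at x within U) v))"

definition smooth_on :: "'a::real_normed_vector set \<Rightarrow> ('a \<Rightarrow> 'b::real_normed_vector) \<Rightarrow> bool"
  where "smooth_on U f \<longleftrightarrow> (\<forall>k. Ck_on k U f)"


section \<open>Smooth manifolds\<close>

text \<open>
  A chart is a pair of a domain and a coordinate map. A manifold is given by an atlas; its points
  are the union of the chart domains and its topology is the one induced by the charts. The
  dimension is that of the model space \<open>'e\<close>.
\<close>

type_synonym ('p, 'e) chart = "'p set \<times> ('p \<Rightarrow> 'e)"

abbreviation cinv :: "('p, 'e) chart \<Rightarrow> 'e \<Rightarrow> 'p"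
  where "cinv c \<equiv> inv_into (fst c) (snd c)"

definition points :: "('p, 'e) chart set \<Rightarrow> 'p set"
  where "points A = (\<Union>c\<in>A. fst c)"

definition manifold_topology :: "('p, 'e::euclidean_space) chart set \<Rightarrow> 'p topology"
  where "manifold_topology A =
    topology (\<lambda>U. U \<subseteq> points A \<and> (\<forall>c\<in>A. open (snd c ` (U \<inter> fst c))))"

lemma openin_manifold_topology:
  fixes A :: "('p, 'e::euclidean_space) chart set"
  assumes inj: "\<forall>c\<in>A. inj_on (snd c) (fst c)"
  shows "openin (manifold_topology A) U \<longleftrightarrow>
     U \<subseteq> points A \<and> (\<forall>c\<in>A. open (snd c ` (U \<inter> fst c)))"
proof -
  let ?P = "\<lambda>U. U \<subseteq> points A \<and> (\<forall>c\<in>A. open (snd c ` (U \<inter> fst c)))"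
  have "istopology ?P"
    unfolding istopology_def
  proof (intro conjI allI impI)
    fix U V assume U: "?P U" and V: "?P V"
    have "open (snd c ` (U \<inter> V \<inter> fst c))" if "c \<in> A" for c
    proof -
      have "snd c ` (U \<inter> V \<inter> fst c) = snd c ` (U \<inter> fst c) \<inter> snd c ` (V \<inter> fst c)"
        using inj that by (auto simp: inj_on_def)
      then show ?thesis using U V that by auto
    qed
    with U V show "U \<inter> V \<subseteq> points A" "\<forall>c\<in>A. open (snd c ` (U \<inter> V \<inter> fst c))" by auto
  next
    fix \<K> assume K: "\<forall>K\<in>\<K>. ?P K"
    have "open (snd c ` (\<Union>\<K> \<inter> fst c))" if "c \<in> A" for c
    proof -
      have "snd c ` (\<Union>\<K> \<inter> fst c) = (\<Union>K\<in>\<K>. snd c ` (K \<inter> fst c))" by auto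
      then show ?thesis using K that by auto
    qed
    with K show "\<Union>\<K> \<subseteq> points A" "\<forall>c\<in>A. open (snd c ` (\<Union>\<K> \<inter> fst c))" by auto
  qed
  then show ?thesis by (simp add: manifold_topology_def topology_inverse')
qed

definition smooth_atlas :: "('p, 'e::euclidean_space) chart set \<Rightarrow> bool"
  where "smooth_atlas A \<longleftrightarrow>
    (\<forall>c\<in>A. inj_on (snd c) (fst c)) \<and>
    (\<forall>c\<in>A. \<forall>d\<in>A. open (snd c ` (fst c \<inter> fst d)) \<and>
                smooth_on (snd c ` (fst c \<inter> fst d)) (snd d \<circ> cinv c))"

definition smooth_manifold :: "('p, 'e::euclidean_space) chart set \<Rightarrow> bool"
  where "smooth_manifold A \<longleftrightarrow> smooth_atlas A \<and>
    Hausdorff_space (manifold_topology A) \<and> second_countable (manifold_topology A)"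

definition smooth_fun :: "('p, 'e::euclidean_space) chart set \<Rightarrow> ('p \<Rightarrow> real) \<Rightarrow> bool"
  where "smooth_fun A f \<longleftrightarrow> (\<forall>c\<in>A. smooth_on (snd c ` fst c) (f \<circ> cinv c))"

text \<open>
  A tangent vector at \<open>p\<close> is the family of its components in all charts around \<open>p\<close>, related by the
  derivatives of the coordinate changes, and extended by 0 to the remaining index values.
\<close>

definition tangent_space :: "('p, 'e::euclidean_space) chart set \<Rightarrow> 'p \<Rightarrow> (('p, 'e) chart \<Rightarrow> 'e) set"
  where "tangent_space A p = {\<xi>.
    (\<forall>c. c \<notin> A \<or> p \<notin> fst c \<longrightarrow> \<xi> c = 0) \<and>
    (\<forall>c\<in>A. \<forall>d\<in>A. p \<in> fst c \<and> p \<in> fst d \<longrightarrow>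
       \<xi> d = frechet_derivative (snd d \<circ> cinv c) (at (snd c p)) (\<xi> c))}"

definition chart_at :: "('p, 'e) chart set \<Rightarrow> 'p \<Rightarrow> ('p, 'e) chart"
  where "chart_at A p = (SOME c. c \<in> A \<and> p \<in> fst c)"

definition differential ::
    "('p, 'e::euclidean_space) chart set \<Rightarrow> ('q, 'f::euclidean_space) chart set \<Rightarrow>
     ('p \<Rightarrow> 'q) \<Rightarrow> 'p \<Rightarrow> (('p, 'e) chart \<Rightarrow> 'e) \<Rightarrow> (('q, 'f) chart \<Rightarrow> 'f)"
  where "differential A B F p \<xi> = (\<lambda>d.
    if d \<in> B \<and> F p \<in> fst d
    then (let c = chart_at A p in
            frechet_derivative (snd d \<circ> F \<circ> cinv c) (at (snd c p)) (\<xi> c))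
    else 0)"

definition dir_deriv ::
    "('p, 'e::euclidean_space) chart set \<Rightarrow> ('p \<Rightarrow> ('p, 'e) chart \<Rightarrow> 'e) \<Rightarrow> ('p \<Rightarrow> real) \<Rightarrow> 'p \<Rightarrow> real"
  where "dir_deriv A X f p =
    (let c = chart_at A p in frechet_derivative (f \<circ> cinv c) (at (snd c p)) (X p c))"

definition velocity ::
    "('p, 'e::euclidean_space) chart set \<Rightarrow> real set \<Rightarrow> (real \<Rightarrow> 'p) \<Rightarrow> real \<Rightarrow> ('p, 'e) chart \<Rightarrow> 'e"
  where "velocity A I \<gamma> t = (\<lambda>c.
    if c \<in> A \<and> \<gamma> t \<in> fst c then vector_derivative (snd c \<circ> \<gamma>) (at t within I) else 0)"

text \<open>
  Vector fields on an open set, extended by 0 so that equality of fields is equality of functions.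
\<close>

definition fields ::
    "('p, 'e::euclidean_space) chart set \<Rightarrow> 'p set \<Rightarrow> ('p \<Rightarrow> ('p, 'e) chart \<Rightarrow> 'e) set"
  where "fields A U = {X.
    (\<forall>p\<in>U. X p \<in> tangent_space A p) \<and> (\<forall>p. p \<notin> U \<longrightarrow> X p = 0) \<and>
    (\<forall>c\<in>A. smooth_on (snd c ` (fst c \<inter> U)) (\<lambda>x. X (cinv c x) c))}"

text \<open>The Lie bracket, with the convention \<open>[X, Y] f = X (Y f) - Y (X f)\<close>, in each chart.\<close>

definition lie_bracket ::
    "('p, 'e::euclidean_space) chart set \<Rightarrow> ('p \<Rightarrow> ('p, 'e) chart \<Rightarrow> 'e) \<Rightarrow>
     ('p \<Rightarrow> ('p, 'e) chart \<Rightarrow> 'e) \<Rightarrow> 'p \<Rightarrow> ('p, 'e) chart \<Rightarrow> 'e"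
  where "lie_bracket A X Y p = (\<lambda>c.
    if c \<in> A \<and> p \<in> fst c
    then frechet_derivative (\<lambda>x. Y (cinv c x) c) (at (snd c p)) (X p c)
       - frechet_derivative (\<lambda>x. X (cinv c x) c) (at (snd c p)) (Y p c)
    else 0)"

definition smooth_curve ::
    "('p, 'e::euclidean_space) chart set \<Rightarrow> real set \<Rightarrow> (real \<Rightarrow> 'p) \<Rightarrow> bool"
  where "smooth_curve A I \<gamma> \<longleftrightarrow> (\<forall>t\<in>I. \<gamma> t \<in> points A) \<and>
    (\<forall>c\<in>A. openin (top_of_set I) {t\<in>I. \<gamma> t \<in> fst c} \<and>
            smooth_on {t\<in>I. \<gamma> t \<in> fst c} (snd c \<circ> \<gamma>))"

definition regular_curve ::
    "('p, 'e::euclidean_space) chart set \<Rightarrow> real set \<Rightarrow> (real \<Rightarrow> 'p) \<Rightarrow> bool"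
  where "regular_curve A I \<gamma> \<longleftrightarrow> is_interval I \<and> interior I \<noteq> {} \<and> smooth_curve A I \<gamma> \<and>
    (\<forall>t\<in>I. velocity A I \<gamma> t \<noteq> 0)"

definition fields_along ::
    "('p, 'e::euclidean_space) chart set \<Rightarrow> real set \<Rightarrow> (real \<Rightarrow> 'p) \<Rightarrow>
     (real \<Rightarrow> ('p, 'e) chart \<Rightarrow> 'e) set"
  where "fields_along A I \<gamma> = {V.
    (\<forall>t\<in>I. V t \<in> tangent_space A (\<gamma> t)) \<and>
    (\<forall>c\<in>A. smooth_on {t\<in>I. \<gamma> t \<in> fst c} (\<lambda>t. V t c))}"


section \<open>The slit tangent bundle\<close>

text \<open>
  Its points are the pairs \<open>(p, v)\<close> with \<open>v\<close> a nonzero tangent vector at \<open>p\<close>, and the bundle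
  projection is \<open>fst\<close>. A chart \<open>c\<close> of the base induces the chart \<open>(p, v) \<mapsto> (c p, v\<^sub>c)\<close>.
\<close>

type_synonym ('p, 'e) tvec = "'p \<times> (('p, 'e) chart \<Rightarrow> 'e)"

text \<open>Tangent vectors to the slit tangent bundle.\<close>

type_synonym ('p, 'e) ttvec = "(('p, 'e) tvec, 'e \<times> 'e) chart \<Rightarrow> 'e \<times> 'e"

definition slit_chart ::
    "('p, 'e::euclidean_space) chart set \<Rightarrow> ('p, 'e) chart \<Rightarrow> (('p, 'e) tvec, 'e \<times> 'e) chart"
  where "slit_chart A c =
    ({(p, v). p \<in> fst c \<and> v \<in> tangent_space A p \<and> v \<noteq> 0}, \<lambda>(p, v). (snd c p, v c))"

definition slit :: "('p, 'e::euclidean_space) chart set \<Rightarrow> (('p, 'e) tvec, 'e \<times> 'e) chart set"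
  where "slit A = slit_chart A ` A"

abbreviation slit_fields ::
    "('p, 'e::euclidean_space) chart set \<Rightarrow> (('p, 'e) tvec \<Rightarrow> ('p, 'e) ttvec) set"
  where "slit_fields A \<equiv> fields (slit A) (points (slit A))"

definition dproj ::
    "('p, 'e::euclidean_space) chart set \<Rightarrow> ('p, 'e) tvec \<Rightarrow> ('p, 'e) ttvec \<Rightarrow> ('p, 'e) chart \<Rightarrow> 'e"
  where "dproj A = differential (slit A) A fst"

definition vertical :: "('p, 'e::euclidean_space) chart set \<Rightarrow> ('p, 'e) tvec \<Rightarrow> ('p, 'e) ttvec set"
  where "vertical A w = {\<xi> \<in> tangent_space (slit A) w. dproj A w \<xi> = 0}"

text \<open>
  Smooth sections of the vertical bundle, as a subbundle of the tangent bundle.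
\<close>

definition vsections ::
    "('p, 'e::euclidean_space) chart set \<Rightarrow> (('p, 'e) tvec \<Rightarrow> ('p, 'e) ttvec) set"
  where "vsections A = {\<sigma> \<in> slit_fields A. \<forall>w\<in>points (slit A). \<sigma> w \<in> vertical A w}"

text \<open>The isomorphisms \<open>i\<^sub>w\<close> of the tangent spaces of the base with the vertical spaces.\<close>

definition vlift_at ::
    "('p, 'e::euclidean_space) chart set \<Rightarrow> ('p, 'e) tvec \<Rightarrow> (('p, 'e) chart \<Rightarrow> 'e) \<Rightarrow> ('p, 'e) ttvec"
  where "vlift_at A w u = velocity (slit A) UNIV (\<lambda>t. (fst w, snd w + t *\<^sub>R u)) 0"

definition vlift_inv ::
    "('p, 'e::euclidean_space) chart set \<Rightarrow> ('p, 'e) tvec \<Rightarrow> ('p, 'e) ttvec \<Rightarrow> ('p, 'e) chart \<Rightarrow> 'e"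
  where "vlift_inv A w = inv_into (tangent_space A (fst w)) (vlift_at A w)"

definition vlift ::
    "('p, 'e::euclidean_space) chart set \<Rightarrow> ('p \<Rightarrow> ('p, 'e) chart \<Rightarrow> 'e) \<Rightarrow>
     ('p, 'e) tvec \<Rightarrow> ('p, 'e) ttvec"
  where "vlift A V z = vlift_at A z (V (fst z))"

definition vlift_along ::
    "('p, 'e::euclidean_space) chart set \<Rightarrow> (real \<Rightarrow> ('p, 'e) tvec) \<Rightarrow>
     (real \<Rightarrow> ('p, 'e) chart \<Rightarrow> 'e) \<Rightarrow> real \<Rightarrow> ('p, 'e) ttvec"
  where "vlift_along A \<mu> V t = vlift_at A (\<mu> t) (V t)"

definition canonical_field ::
    "('p, 'e::euclidean_space) chart set \<Rightarrow> ('p, 'e) tvec \<Rightarrow> ('p, 'e) ttvec"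
  where "canonical_field A w = vlift_at A w (snd w)"

definition vert_endo ::
    "('p, 'e::euclidean_space) chart set \<Rightarrow> (('p, 'e) tvec \<Rightarrow> ('p, 'e) ttvec) \<Rightarrow>
     ('p, 'e) tvec \<Rightarrow> ('p, 'e) ttvec"
  where "vert_endo A X w = vlift_at A w (dproj A w (X w))"


section \<open>Sprays and the canonical connection\<close>

definition spray ::
    "('p, 'e::euclidean_space) chart set \<Rightarrow> (('p, 'e) tvec \<Rightarrow> ('p, 'e) ttvec) \<Rightarrow> bool"
  where "spray A S \<longleftrightarrow> S \<in> slit_fields A \<and> vert_endo A S = canonical_field A \<and>
    lie_bracket (slit A) (canonical_field A) S = S"

definition canonical_connection ::
    "('p, 'e::euclidean_space) chart set \<Rightarrow> (('p, 'e) tvec \<Rightarrow> ('p, 'e) ttvec) \<Rightarrow>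
     (('p, 'e) tvec \<Rightarrow> ('p, 'e) ttvec) \<Rightarrow> ('p, 'e) tvec \<Rightarrow> ('p, 'e) ttvec"
  where "canonical_connection A S Y =
    vert_endo A (lie_bracket (slit A) S Y) - lie_bracket (slit A) S (vert_endo A Y)"

text \<open>
  The kernel of \<open>\<Gamma>\<^sub>S - I\<close> at \<open>w\<close>; since \<open>\<Gamma>\<^sub>S\<close> is given on fields, a tangent vector is
  extended to a field.
\<close>

definition horizontal ::
    "('p, 'e::euclidean_space) chart set \<Rightarrow> (('p, 'e) tvec \<Rightarrow> ('p, 'e) ttvec) \<Rightarrow>
     ('p, 'e) tvec \<Rightarrow> ('p, 'e) ttvec set"
  where "horizontal A S w = {X w |X. X \<in> slit_fields A \<and> canonical_connection A S X w = X w}"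

definition vproj ::
    "('p, 'e::euclidean_space) chart set \<Rightarrow> (('p, 'e) tvec \<Rightarrow> ('p, 'e) ttvec) \<Rightarrow>
     ('p, 'e) tvec \<Rightarrow> ('p, 'e) ttvec \<Rightarrow> ('p, 'e) ttvec"
  where "vproj A S w \<xi> = (THE \<eta>. \<eta> \<in> vertical A w \<and> \<xi> - \<eta> \<in> horizontal A S w)"

definition hlift ::
    "('p, 'e::euclidean_space) chart set \<Rightarrow> (('p, 'e) tvec \<Rightarrow> ('p, 'e) ttvec) \<Rightarrow>
     ('p, 'e) tvec \<Rightarrow> (('p, 'e) chart \<Rightarrow> 'e) \<Rightarrow> ('p, 'e) ttvec"
  where "hlift A S w u = (THE \<xi>. \<xi> \<in> horizontal A S w \<and> dproj A w \<xi> = u)"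

text \<open>
  \<open>\<mu>\<close> is a lift of \<open>\<gamma> : I \<rightarrow> M\<close> through \<open>w\<close> at \<open>t\<^sub>0\<close>, defined on an interval
  \<open>J\<close> that is a neighbourhood of \<open>t\<^sub>0\<close> in \<open>I\<close>.
\<close>

definition lift_through ::
    "('p, 'e::euclidean_space) chart set \<Rightarrow> real set \<Rightarrow> (real \<Rightarrow> 'p) \<Rightarrow> real \<Rightarrow> ('p, 'e) tvec \<Rightarrow>
     real set \<Rightarrow> (real \<Rightarrow> ('p, 'e) tvec) \<Rightarrow> bool"
  where "lift_through A I \<gamma> t\<^sub>0 w J \<mu> \<longleftrightarrow>
    openin (top_of_set I) J \<and> is_interval J \<and> t\<^sub>0 \<in> J \<and> smooth_curve (slit A) J \<mu> \<and>
    (\<forall>t\<in>J. fst (\<mu> t) = \<gamma> t) \<and> \<mu> t\<^sub>0 = w"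

definition horizontal_lift_through ::
    "('p, 'e::euclidean_space) chart set \<Rightarrow> (('p, 'e) tvec \<Rightarrow> ('p, 'e) ttvec) \<Rightarrow> real set \<Rightarrow>
     (real \<Rightarrow> 'p) \<Rightarrow> real \<Rightarrow> ('p, 'e) tvec \<Rightarrow> real set \<Rightarrow> (real \<Rightarrow> ('p, 'e) tvec) \<Rightarrow> bool"
  where "horizontal_lift_through A S I \<gamma> t\<^sub>0 w J \<mu> \<longleftrightarrow>
    lift_through A I \<gamma> t\<^sub>0 w J \<mu> \<and> (\<forall>t\<in>J. velocity (slit A) J \<mu> t \<in> horizontal A S (\<mu> t))"


section \<open>Linear connections on the vertical bundle\<close>

type_synonym ('p, 'e) vconn =
  "(('p, 'e) tvec \<Rightarrow> ('p, 'e) ttvec) \<Rightarrow> (('p, 'e) tvec \<Rightarrow> ('p, 'e) ttvec) \<Rightarrow>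
   ('p, 'e) tvec \<Rightarrow> ('p, 'e) ttvec"

definition linear_connection ::
    "('p, 'e::euclidean_space) chart set \<Rightarrow> ('p, 'e) vconn \<Rightarrow> bool"
  where "linear_connection A N \<longleftrightarrow>
    (\<forall>X\<in>slit_fields A. \<forall>\<sigma>\<in>vsections A. N X \<sigma> \<in> vsections A) \<and>
    (\<forall>X\<in>slit_fields A. \<forall>Y\<in>slit_fields A. \<forall>\<sigma>\<in>vsections A. N (X + Y) \<sigma> = N X \<sigma> + N Y \<sigma>) \<and>
    (\<forall>f X. \<forall>\<sigma>\<in>vsections A. smooth_fun (slit A) f \<and> X \<in> slit_fields A \<longrightarrow>
       N (\<lambda>w. f w *\<^sub>R X w) \<sigma> = (\<lambda>w. f w *\<^sub>R N X \<sigma> w)) \<and>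
    (\<forall>X\<in>slit_fields A. \<forall>\<sigma>\<in>vsections A. \<forall>\<tau>\<in>vsections A. N X (\<sigma> + \<tau>) = N X \<sigma> + N X \<tau>) \<and>
    (\<forall>f X. \<forall>\<sigma>\<in>vsections A. smooth_fun (slit A) f \<and> X \<in> slit_fields A \<longrightarrow>
       N X (\<lambda>w. f w *\<^sub>R \<sigma> w) =
         (\<lambda>w. dir_deriv (slit A) X f w *\<^sub>R \<sigma> w + f w *\<^sub>R N X \<sigma> w))"

definition torsion ::
    "('p, 'e::euclidean_space) chart set \<Rightarrow> ('p, 'e) vconn \<Rightarrow> (('p, 'e) tvec \<Rightarrow> ('p, 'e) ttvec) \<Rightarrow>
     (('p, 'e) tvec \<Rightarrow> ('p, 'e) ttvec) \<Rightarrow> ('p, 'e) tvec \<Rightarrow> ('p, 'e) ttvec"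
  where "torsion A N X Y =
    N X (vert_endo A Y) - N Y (vert_endo A X) - vert_endo A (lie_bracket (slit A) X Y)"

definition lift_of_canonical_connection ::
    "('p, 'e::euclidean_space) chart set \<Rightarrow> (('p, 'e) tvec \<Rightarrow> ('p, 'e) ttvec) \<Rightarrow>
     ('p, 'e) vconn \<Rightarrow> bool"
  where "lift_of_canonical_connection A S N \<longleftrightarrow> linear_connection A N \<and>
    (\<forall>X\<in>slit_fields A. \<forall>w\<in>points (slit A). N X (canonical_field A) w = vproj A S w (X w))"

text \<open>
  The derivative of a section \<open>s\<close> defined near \<open>w\<close> in the direction of a single tangent vector
  \<open>\<xi>\<close> at \<open>w\<close>: as usual, extend \<open>\<xi>\<close> to a field \<open>X\<close> and the germ of \<open>s\<close> at \<open>w\<close> to a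
  global section \<open>\<sigma>\<close>.
\<close>

definition cov_deriv_at ::
    "('p, 'e::euclidean_space) chart set \<Rightarrow> ('p, 'e) vconn \<Rightarrow> ('p, 'e) tvec \<Rightarrow> ('p, 'e) ttvec \<Rightarrow>
     (('p, 'e) tvec \<Rightarrow> ('p, 'e) ttvec) \<Rightarrow> ('p, 'e) ttvec"
  where "cov_deriv_at A N w \<xi> s = (THE \<eta>. \<exists>X\<in>slit_fields A. \<exists>\<sigma>\<in>vsections A. \<exists>U.
    X w = \<xi> \<and> openin (manifold_topology (slit A)) U \<and> w \<in> U \<and> (\<forall>z\<in>U. \<sigma> z = s z) \<and>
    \<eta> = N X \<sigma> w)"

text \<open>
  The induced covariant derivative along a curve \<open>\<mu>\<close> on \<open>J\<close> is determined by linearity, the Leibniz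
  rule, and \<open>\<nabla>(\<sigma> \<circ> \<mu>)/dt = \<nabla>\<^bsub>\<mu>'\<^esub> \<sigma>\<close>. Near a given parameter every section along
  \<open>\<mu>\<close> is a finite sum of terms \<open>f (\<sigma> \<circ> \<mu>)\<close>.
\<close>

definition cov_deriv_along ::
    "('p, 'e::euclidean_space) chart set \<Rightarrow> ('p, 'e) vconn \<Rightarrow> real set \<Rightarrow>
     (real \<Rightarrow> ('p, 'e) tvec) \<Rightarrow> (real \<Rightarrow> ('p, 'e) ttvec) \<Rightarrow> real \<Rightarrow> ('p, 'e) ttvec"
  where "cov_deriv_along A N J \<mu> s t\<^sub>0 = (THE \<eta>. \<exists>K (n::nat) f \<sigma>.
    openin (top_of_set J) K \<and> t\<^sub>0 \<in> K \<and>
    (\<forall>a<n. smooth_on K (f a) \<and> \<sigma> a \<in> vsections A) \<and>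
    (\<forall>t\<in>K. s t = (\<Sum>a<n. f a t *\<^sub>R \<sigma> a (\<mu> t))) \<and>
    \<eta> = (\<Sum>a<n. vector_derivative (f a) (at t\<^sub>0 within J) *\<^sub>R \<sigma> a (\<mu> t\<^sub>0) +
                f a t\<^sub>0 *\<^sub>R cov_deriv_at A N (\<mu> t\<^sub>0) (velocity (slit A) J \<mu> t\<^sub>0) (\<sigma> a)))"


section \<open>The operators on the base\<close>

definition D_at ::
    "('p, 'e::euclidean_space) chart set \<Rightarrow> (('p, 'e) tvec \<Rightarrow> ('p, 'e) ttvec) \<Rightarrow> ('p, 'e) vconn \<Rightarrow>
     ('p, 'e) tvec \<Rightarrow> (('p, 'e) chart \<Rightarrow> 'e) \<Rightarrow> ('p \<Rightarrow> ('p, 'e) chart \<Rightarrow> 'e) \<Rightarrow> ('p, 'e) chart \<Rightarrow> 'e"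
  where "D_at A S N w u V = vlift_inv A w (cov_deriv_at A N w (hlift A S w u) (vlift A V))"

definition D_along_at ::
    "('p, 'e::euclidean_space) chart set \<Rightarrow> (('p, 'e) tvec \<Rightarrow> ('p, 'e) ttvec) \<Rightarrow> ('p, 'e) vconn \<Rightarrow>
     real set \<Rightarrow> (real \<Rightarrow> 'p) \<Rightarrow> ('p, 'e) tvec \<Rightarrow> (real \<Rightarrow> ('p, 'e) chart \<Rightarrow> 'e) \<Rightarrow> real \<Rightarrow>
     ('p, 'e) chart \<Rightarrow> 'e"
  where "D_along_at A S N I \<gamma> w V t\<^sub>0 = (THE v. \<exists>J \<mu>.
    horizontal_lift_through A S I \<gamma> t\<^sub>0 w J \<mu> \<and>
    v = vlift_inv A w (cov_deriv_along A N J \<mu> (vlift_along A \<mu> V) t\<^sub>0))"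

definition D_field ::
    "('p, 'e::euclidean_space) chart set \<Rightarrow> (('p, 'e) tvec \<Rightarrow> ('p, 'e) ttvec) \<Rightarrow> ('p, 'e) vconn \<Rightarrow>
     ('p \<Rightarrow> ('p, 'e) chart \<Rightarrow> 'e) \<Rightarrow> ('p \<Rightarrow> ('p, 'e) chart \<Rightarrow> 'e) \<Rightarrow> ('p \<Rightarrow> ('p, 'e) chart \<Rightarrow> 'e) \<Rightarrow>
     'p \<Rightarrow> ('p, 'e) chart \<Rightarrow> 'e"
  where "D_field A S N W U V x = D_at A S N (x, W x) (U x) V"

definition D_along ::
    "('p, 'e::euclidean_space) chart set \<Rightarrow> (('p, 'e) tvec \<Rightarrow> ('p, 'e) ttvec) \<Rightarrow> ('p, 'e) vconn \<Rightarrow>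
     real set \<Rightarrow> (real \<Rightarrow> 'p) \<Rightarrow> (real \<Rightarrow> ('p, 'e) chart \<Rightarrow> 'e) \<Rightarrow>
     (real \<Rightarrow> ('p, 'e) chart \<Rightarrow> 'e) \<Rightarrow> real \<Rightarrow> ('p, 'e) chart \<Rightarrow> 'e"
  where "D_along A S N I \<gamma> W V t = D_along_at A S N I \<gamma> (\<gamma> t, W t) V t"

end

theory Submission
  imports Defs
begin

text \<open>
  (1) Since \<open>J S = C\<close>, the equation \<open>T(S, Y) = 0\<close> reads \<open>\<nabla>\<^sub>S (J Y) = \<nabla>\<^sub>Y C + J [S, Y] = V Y + J [S, Y]\<close>, and
  every vertical field is locally of the form \<open>J Y\<close>; so \<open>\<nabla>\<^sub>S\<close> is determined by \<open>S\<close>. The horizontal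
  lift of \<open>w\<close> at \<open>w\<close> is \<open>S w\<close>, hence \<open>\<nabla>\<^sub>S\<close> is all that enters the operators along \<open>W\<close> and along the
  velocity of a curve.

  (2) Two lifts of \<open>u\<close> at \<open>w\<close> differ by a vertical vector \<open>Z w\<close>. If \<open>Z\<close> is vertical and \<open>J Y = V\<^sup>v\<close>, then
  \<open>J Z = 0\<close>, and \<open>T(Z, Y) = 0\<close> gives \<open>\<nabla>\<^sub>Z V\<^sup>v = J [Z, Y] = 0\<close>, because \<open>Y\<close> projects to \<open>V\<close>. Along a curve,
  \<open>V\<^sup>v\<close> is expanded in vertical lifts of a coordinate frame, whose coefficients do not depend on the
  lift of the curve. Horizontal lifts exist locally by the Picard-Lindeloef theorem.
\<close>

text \<open>Fields, sections and connections are global objects: \<open>N\<close> acts on fields of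
  the whole slit bundle, and its values at a vector, on a germ or along a curve are selected by
  \<open>THE\<close>. Every pointwise argument therefore passes through global extensions made with
  bump functions, and the Hausdorff axiom is what makes extension by zero smooth. The two parts
  treat the descriptions differently. In (1) two connections are compared in the same direction, and
  the predicates under \<open>THE\<close> that define the covariant derivatives are shown to
  coincide. In (2) one connection is compared in different directions, so the descriptions have to
  be evaluated: they must be satisfiable and determine their value. For the derivative along a
  curve, satisfiability is the existence of horizontal lifts, hence the differential equation. The
  torsion contains \<open>J [X, Y]\<close>, and \<open>vert_endo\<close> reads the bracket in a
  chart picked by \<open>chart_at\<close>. Computing it in another chart requires the bracket to
  transform as a tangent vector, which rests on the symmetry of second derivatives.\<close>

section \<open>Calculus of smooth maps\<close>

text \<open>The condition under which derivatives within a set are unique.\<close>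

definition thick :: "'a::euclidean_space set \<Rightarrow> bool"
  where "thick U \<longleftrightarrow> (\<forall>x\<in>U. \<forall>i\<in>Basis. \<forall>e>0. \<exists>d. 0 < \<bar>d\<bar> \<and> \<bar>d\<bar> < e \<and> x + d *\<^sub>R i \<in> U)"

lemma thick_Int_open:
  assumes "thick U" "open T"
  shows "thick (U \<inter> T)"
  unfolding thick_def
proof (intro ballI allI impI)
  fix x i :: 'a and e :: real
  assume x: "x \<in> U \<inter> T" and i: "i \<in> Basis" and e: "e > 0"
  obtain r where r: "r > 0" "ball x r \<subseteq> T"
    using x assms(2) openE by blast
  then obtain d where d: "0 < \<bar>d\<bar>" "\<bar>d\<bar> < min e r" "x + d *\<^sub>R i \<in> U"
    using assms(1) x i e unfolding thick_def by (metis IntD1 min_less_iff_conj)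
  then have "x + d *\<^sub>R i \<in> ball x r"
    using i by (simp add: dist_norm)
  then show "\<exists>d. 0 < \<bar>d\<bar> \<and> \<bar>d\<bar> < e \<and> x + d *\<^sub>R i \<in> U \<inter> T"
    using d r by auto
qed

lemma thick_UNIV: "thick (UNIV :: 'a::euclidean_space set)"
  unfolding thick_def
proof (intro ballI allI impI)
  fix x i :: 'a and e :: real assume "e > 0"
  then show "\<exists>d. 0 < \<bar>d\<bar> \<and> \<bar>d\<bar> < e \<and> x + d *\<^sub>R i \<in> UNIV"
    by (intro exI[of _ "e / 2"]) auto
qed

lemma thick_open: "open U \<Longrightarrow> thick U"
  using thick_Int_open[OF thick_UNIV] by simp

lemma thick_openin:
  assumes "thick U" "openin (top_of_set U) K"
  shows "thick K"
  using assms(2) thick_Int_open[OF assms(1)] unfolding openin_open by blast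

lemma thick_interval:
  fixes I :: "real set"
  assumes "is_interval I" "interior I \<noteq> {}"
  shows "thick I"
  unfolding thick_def
proof (intro ballI allI impI)
  fix x i e :: real
  assume x: "x \<in> I" and i: "i \<in> Basis" and e: "e > 0"
  obtain z where z: "z \<in> I" "z \<noteq> x"
  proof -
    obtain y where "y \<in> interior I" using assms(2) by blast
    then obtain r where r: "r > 0" "ball y r \<subseteq> I"
      using mem_interior by blast
    then have "y \<in> I" "y + r / 2 \<in> I"
      by (auto simp: dist_real_def subset_iff)
    then show thesis using that r by (metis add_cancel_right_right half_gt_zero less_irrefl)
  qed
  \<comment> \<open>The point moves from \<open>x\<close> towards \<open>z\<close>:
    \<open>s < 1\<close> keeps it on the segment, hence in \<open>I\<close>, and the second bound
    keeps the displacement below \<open>e\<close>.\<close>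
  define s where "s = min (1/2) (e / (2 * \<bar>z - x\<bar>))"
  have s: "0 < s" "s < 1" "s * \<bar>z - x\<bar> < e"
  proof -
    show "0 < s" "s < 1" using e z by (auto simp: s_def)
    have "s * \<bar>z - x\<bar> \<le> (e / (2 * \<bar>z - x\<bar>)) * \<bar>z - x\<bar>"
      by (intro mult_right_mono) (auto simp: s_def)
    also have "\<dots> < e" using z e by (simp add: field_simps)
    finally show "s * \<bar>z - x\<bar> < e" .
  qed
  have "x + s * (z - x) \<in> I"
  proof -
    have "convex I" using assms(1) by (simp add: is_interval_convex_1)
    then have "(1 - s) *\<^sub>R x + s *\<^sub>R z \<in> I"
      using x z s by (intro convexD) auto
    then show ?thesis by (simp add: algebra_simps)
  qed
  then show "\<exists>d. 0 < \<bar>d\<bar> \<and> \<bar>d\<bar> < e \<and> x + d *\<^sub>R i \<in> I"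
    using i s z by (intro exI[of _ "s * (z - x)"]) (auto simp: abs_mult)
qed

lemma frechet_derivative_thick:
  assumes "thick U" "x \<in> U" "(f has_derivative f') (at x within U)"
  shows "frechet_derivative f (at x within U) = f'"
proof (rule frechet_derivative_unique_within[OF _ assms(3)])
  show "(f has_derivative frechet_derivative f (at x within U)) (at x within U)"
    using assms(3) frechet_derivative_works unfolding differentiable_def by blast
qed (use assms in \<open>auto simp: thick_def\<close>)

lemma at_within_Int_open: "open T \<Longrightarrow> x \<in> T \<Longrightarrow> at x within (U \<inter> T) = at x within U"
  by (rule at_within_nhd[of _ T]) blast+

lemma frechet_derivative_cong_within:
  assumes "x \<in> U" "\<And>y. y \<in> U \<Longrightarrow> f y = g y"
  shows "frechet_derivative f (at x within U) = frechet_derivative g (at x within U)"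
proof -
  have "(f has_derivative D) (at x within U) \<longleftrightarrow> (g has_derivative D) (at x within U)" for D
    using assms has_derivative_transform[of x U f g D] has_derivative_transform[of x U g f D] by auto
  then show ?thesis by (simp add: frechet_derivative_def)
qed

lemma frechet_derivative_cong_at:
  assumes "open U" "x \<in> U" "\<And>y. y \<in> U \<Longrightarrow> f y = g y"
  shows "frechet_derivative f (at x) = frechet_derivative g (at x)"
  using frechet_derivative_cong_within[OF assms(2,3)] unfolding at_within_open[OF assms(2,1)] .

section \<open>Maps of class C^k on thick sets\<close>

lemma Ck_on_cong:
  assumes "\<And>x. x \<in> U \<Longrightarrow> f x = g x"
  shows "Ck_on k U f \<longleftrightarrow> Ck_on k U g"
  using assms
proof (induction k arbitrary: f g)
  case 0
  then show ?case by (simp cong: continuous_on_cong)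
next
  case (Suc k)
  have "f differentiable_on U \<longleftrightarrow> g differentiable_on U"
    using Suc.prems differentiable_transform_within[of f _ U 1 g] differentiable_transform_within[of g _ U 1 f]
    unfolding differentiable_on_def by (metis zero_less_one)
  moreover have "Ck_on k U (\<lambda>x. frechet_derivative f (at x within U) v) \<longleftrightarrow>
      Ck_on k U (\<lambda>x. frechet_derivative g (at x within U) v)" for v
    by (rule Suc.IH) (simp add: frechet_derivative_cong_within[OF _ Suc.prems])
  ultimately show ?case by simp
qed

text \<open>Intersecting with an open set leaves the filter \<open>at x within U\<close> unchanged
  at the remaining points, hence also all derivatives in \<open>Ck_on\<close>. For arbitrary subsets
  the derivatives may change, so restriction is stated in this form only.\<close>

lemma Ck_on_Int_open:
  assumes "open T" "Ck_on k U f"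
  shows "Ck_on k (U \<inter> T) f"
  using assms(2)
proof (induction k arbitrary: f)
  case 0
  then show ?case by (auto intro: continuous_on_subset)
next
  case (Suc k)
  then have "f differentiable_on U \<inter> T"
    by (auto intro: differentiable_on_subset)
  moreover have "Ck_on k (U \<inter> T) (\<lambda>x. frechet_derivative f (at x within U) v)" for v
    using Suc by simp
  then have "Ck_on k (U \<inter> T) (\<lambda>x. frechet_derivative f (at x within U \<inter> T) v)" for v
    by (rule Ck_on_cong[THEN iffD1, rotated]) (simp add: at_within_Int_open assms(1))
  ultimately show ?case by simp
qed

lemma Ck_on_local:
  assumes "\<And>x. x \<in> U \<Longrightarrow> \<exists>T. open T \<and> x \<in> T \<and> Ck_on k (U \<inter> T) f"
  shows "Ck_on k U f"
  using assms
proof (induction k arbitrary: f)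
  case 0
  then show ?case
    unfolding Ck_on.simps continuous_on_eq_continuous_within
    by (metis IntI at_within_Int_open)
next
  case (Suc k)
  have "f differentiable (at x within U)" if "x \<in> U" for x
    using Suc.prems[OF that] that unfolding Ck_on.simps differentiable_on_def
    by (metis IntI at_within_Int_open)
  moreover have "Ck_on k U (\<lambda>x. frechet_derivative f (at x within U) v)" for v
  proof (rule Suc.IH)
    fix x assume "x \<in> U"
    then obtain T where T: "open T" "x \<in> T" "Ck_on (Suc k) (U \<inter> T) f"
      using Suc.prems by blast
    then have "Ck_on k (U \<inter> T) (\<lambda>x. frechet_derivative f (at x within U \<inter> T) v)" by simp
    then have "Ck_on k (U \<inter> T) (\<lambda>x. frechet_derivative f (at x within U) v)"
      by (rule Ck_on_cong[THEN iffD1, rotated]) (simp add: at_within_Int_open T)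
    then show "\<exists>T. open T \<and> x \<in> T \<and> Ck_on k (U \<inter> T) (\<lambda>x. frechet_derivative f (at x within U) v)"
      using T by blast
  qed
  ultimately show ?case by (simp add: differentiable_on_def)
qed

text \<open>Uniqueness of derivatives on a thick set lets any known derivative stand for the chosen
  \<open>frechet_derivative\<close>. The closure properties that follow are inductions on
  \<open>k\<close> through this rule.\<close>

lemma Ck_on_SucI:
  assumes "thick U" "\<And>x. x \<in> U \<Longrightarrow> (f has_derivative f' x) (at x within U)"
    "\<And>v. Ck_on k U (\<lambda>x. f' x v)"
  shows "Ck_on (Suc k) U f"
proof -
  have "f differentiable_on U"
    using assms(2) differentiable_def differentiable_on_def by blast
  moreover have "Ck_on k U (\<lambda>x. frechet_derivative f (at x within U) v)" for v
    using assms(3) by (rule Ck_on_cong[THEN iffD1, rotated])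
      (simp add: frechet_derivative_thick[OF assms(1) _ assms(2)])
  ultimately show ?thesis by simp
qed

lemma Ck_on_has_derivative:
  "Ck_on (Suc k) U f \<Longrightarrow> x \<in> U \<Longrightarrow> (f has_derivative frechet_derivative f (at x within U)) (at x within U)"
  using frechet_derivative_works unfolding Ck_on.simps differentiable_on_def by blast

lemma Ck_on_Suc_imp: "Ck_on (Suc k) U f \<Longrightarrow> Ck_on k U f"
proof (induction k arbitrary: f)
  case (Suc k)
  have "f differentiable_on U" "\<And>v. Ck_on (Suc k) U (\<lambda>x. frechet_derivative f (at x within U) v)"
    using Suc.prems unfolding Ck_on.simps(2)[of "Suc k"] by blast+
  then show ?case using Suc.IH by simp
qed (simp add: differentiable_imp_continuous_on)

lemma Ck_on_const:
  assumes "thick U" shows "Ck_on k U (\<lambda>x. c)"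
proof (induction k arbitrary: c)
  case (Suc k)
  show ?case by (rule Ck_on_SucI[OF assms has_derivative_const Suc])
qed simp

lemma Ck_on_add:
  assumes "thick U" "Ck_on k U f" "Ck_on k U g"
  shows "Ck_on k U (\<lambda>x. f x + g x)"
  using assms(2,3)
proof (induction k arbitrary: f g)
  case 0
  then show ?case by (simp add: continuous_on_add)
next
  case (Suc k)
  show ?case
    by (rule Ck_on_SucI[OF assms(1) has_derivative_add[OF Ck_on_has_derivative[OF Suc.prems(1)]
          Ck_on_has_derivative[OF Suc.prems(2)]]])
      (use Suc in auto)
qed

lemma Ck_on_linear:
  assumes "bounded_linear L" "thick U" "Ck_on k U f"
  shows "Ck_on k U (\<lambda>x. L (f x))"
  using assms(3)
proof (induction k arbitrary: f)
  case 0
  then show ?case by (simp add: assms(1) bounded_linear.continuous_on)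
next
  case (Suc k)
  show ?case
    by (rule Ck_on_SucI[OF assms(2) bounded_linear.has_derivative[OF assms(1)
          Ck_on_has_derivative[OF Suc.prems]]])
      (use Suc in auto)
qed

lemma Ck_on_bilinear:
  assumes "bounded_bilinear B" "thick U" "Ck_on k U f" "Ck_on k U g"
  shows "Ck_on k U (\<lambda>x. B (f x) (g x))"
  using assms(3,4)
proof (induction k arbitrary: f g)
  case 0
  then show ?case by (simp add: assms(1) bounded_bilinear.continuous_on)
next
  case (Suc k)
  show ?case
  proof (rule Ck_on_SucI[OF assms(2) bounded_bilinear.FDERIV[OF assms(1)
          Ck_on_has_derivative[OF Suc.prems(1)] Ck_on_has_derivative[OF Suc.prems(2)]]])
    show "Ck_on k U (\<lambda>x. B (f x) (frechet_derivative g (at x within U) v) +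
        B (frechet_derivative f (at x within U) v) (g x))" for v
      by (intro Ck_on_add[OF assms(2)] Suc.IH)
        (use Suc.prems Ck_on_Suc_imp[OF Suc.prems(1)] Ck_on_Suc_imp[OF Suc.prems(2)] in auto)
  qed
qed

lemma Ck_on_id:
  assumes "thick U" shows "Ck_on k U (\<lambda>x. x)"
proof (cases k)
  case (Suc j)
  show ?thesis unfolding Suc
    by (rule Ck_on_SucI[OF assms has_derivative_ident Ck_on_const[OF assms]])
qed simp

lemma Ck_on_Pair:
  assumes "thick U" "Ck_on k U f" "Ck_on k U g"
  shows "Ck_on k U (\<lambda>x. (f x, g x))"
proof -
  have "Ck_on k U (\<lambda>x. (f x, 0) + (0, g x))"
    by (intro Ck_on_add assms Ck_on_linear[of "\<lambda>a. (a, 0)"] Ck_on_linear[of "\<lambda>a. (0, a)"])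
      (auto intro!: bounded_linear_intros bounded_linear_Pair bounded_linear_ident bounded_linear_zero)
  then show ?thesis by simp
qed

lemma Ck_on_sum:
  assumes "thick U" "\<And>i. i \<in> A \<Longrightarrow> Ck_on k U (f i)"
  shows "Ck_on k U (\<lambda>x. \<Sum>i\<in>A. f i x)"
  using assms(2)
proof (induction A rule: infinite_finite_induct)
  case (insert i A)
  then show ?case by (simp add: Ck_on_add[OF assms(1)])
qed (simp_all add: Ck_on_const[OF assms(1)])

text \<open>The derivative of \<open>g \<circ> f\<close> is expanded in a basis, so that the induction hypothesis applies to
  the partial derivatives of \<open>g\<close>.\<close>

lemma Ck_on_compose:
  fixes f :: "'a::euclidean_space \<Rightarrow> 'b::euclidean_space" and g :: "'b \<Rightarrow> 'c::real_normed_vector"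
  assumes "thick U" "open V" "f ` U \<subseteq> V" "Ck_on k U f" "Ck_on k V g"
  shows "Ck_on k U (\<lambda>x. g (f x))"
  using assms(4,5)
proof (induction k arbitrary: g)
  case 0
  then show ?case using assms(3) continuous_on_compose2[of V g U f] by auto
next
  case (Suc k)
  let ?Df = "\<lambda>x. frechet_derivative f (at x within U)"
  let ?Dg = "\<lambda>y. frechet_derivative g (at y within V)"
  have Dg: "(g has_derivative ?Dg (f x)) (at (f x))" if "x \<in> U" for x
    using Ck_on_has_derivative[OF Suc.prems(2), of "f x"] that assms(2,3) at_within_open[of "f x" V] by auto
  show ?case
  proof (rule Ck_on_SucI[OF assms(1)])
    fix x assume x: "x \<in> U"
    show "((\<lambda>x. g (f x)) has_derivative (\<lambda>v. ?Dg (f x) (?Df x v))) (at x within U)"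
      using Dg[OF x] Ck_on_has_derivative[OF Suc.prems(1) x] by (rule has_derivative_compose[rotated])
  next
    fix v
    have *: "?Dg (f x) (?Df x v) = (\<Sum>b\<in>Basis. (?Df x v \<bullet> b) *\<^sub>R ?Dg (f x) b)" if "x \<in> U" for x
    proof -
      have "bounded_linear (?Dg (f x))"
        using Dg[OF that] by (rule has_derivative_bounded_linear)
      then show ?thesis
        by (subst euclidean_representation[of "?Df x v", symmetric])
          (simp only: linear_sum bounded_linear.linear linear_cmul o_def)
    qed
    have "Ck_on k U (\<lambda>x. \<Sum>b\<in>Basis. (?Df x v \<bullet> b) *\<^sub>R ?Dg (f x) b)"
    proof (intro Ck_on_sum assms Ck_on_bilinear[OF bounded_bilinear_scaleR])
      show "Ck_on k U (\<lambda>x. ?Df x v \<bullet> b)" for b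
        by (rule Ck_on_linear[OF _ assms(1)]) (use Suc.prems bounded_linear_inner_left in auto)
      show "Ck_on k U (\<lambda>x. ?Dg (f x) b)" for b
        by (rule Suc.IH) (use Suc.prems Ck_on_Suc_imp in auto)
    qed
    then show "Ck_on k U (\<lambda>x. ?Dg (f x) (?Df x v))"
      by (rule Ck_on_cong[THEN iffD1, rotated]) (simp add: *)
  qed
qed

text \<open>The derivative is a product of copies of the inverse itself, so the induction
  closes.\<close>

lemma Ck_on_inverse: "Ck_on k (- {0}) (inverse :: real \<Rightarrow> real)"
proof (induction k)
  case 0
  then show ?case by (auto intro!: continuous_intros)
next
  case (Suc k)
  have t: "thick (- {0::real})" by (intro thick_open) auto
  show ?case
  proof (rule Ck_on_SucI[OF t])
    show "(inverse has_derivative (\<lambda>h. - (inverse x * h * inverse x))) (at x within - {0})"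
      if "x \<in> - {0}" for x :: real
      using that has_derivative_inverse'[of x "- {0}"] by simp
    show "Ck_on k (- {0}) (\<lambda>x. - (inverse x * v * inverse x))" for v :: real
      by (intro Ck_on_linear[OF bounded_linear_minus[OF bounded_linear_ident]] t
          Ck_on_bilinear[OF bounded_bilinear_mult] Suc Ck_on_const)
  qed
qed

text \<open>Base point and direction vary together here. Expanding \<open>v x\<close> in a basis
  separates them: the partial derivatives of \<open>f\<close> are composed with \<open>a\<close>, at
  the cost of one order of differentiability. Coordinate changes of tangent vectors and the equation
  for horizontal lifts have this form.\<close>

lemma Ck_on_frechet_derivative:
  fixes a v :: "'a::euclidean_space \<Rightarrow> 'b::euclidean_space" and f :: "'b \<Rightarrow> 'c::real_normed_vector"
  assumes "thick U" "open V" "a ` U \<subseteq> V" "Ck_on k U a" "Ck_on k U v" "Ck_on (Suc k) V f"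
  shows "Ck_on k U (\<lambda>x. frechet_derivative f (at (a x)) (v x))"
proof -
  have *: "frechet_derivative f (at (a x)) (v x) =
      (\<Sum>b\<in>Basis. (v x \<bullet> b) *\<^sub>R frechet_derivative f (at (a x) within V) b)" if "x \<in> U" for x
  proof -
    have "a x \<in> V" using that assms(3) by auto
    then have "(f has_derivative frechet_derivative f (at (a x))) (at (a x))"
      using Ck_on_has_derivative[OF assms(6)] at_within_open[of "a x" V] assms(2) by metis
    then have "bounded_linear (frechet_derivative f (at (a x)))"
      by (rule has_derivative_bounded_linear)
    then show ?thesis
      unfolding at_within_open[OF \<open>a x \<in> V\<close> assms(2)]
      by (subst euclidean_representation[of "v x", symmetric])
        (simp only: linear_sum bounded_linear.linear linear_cmul o_def)
  qed
  have "Ck_on k U (\<lambda>x. \<Sum>b\<in>Basis. (v x \<bullet> b) *\<^sub>R frechet_derivative f (at (a x) within V) b)"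
  proof (intro Ck_on_sum assms Ck_on_bilinear[OF bounded_bilinear_scaleR])
    show "Ck_on k U (\<lambda>x. v x \<bullet> b)" for b
      by (rule Ck_on_linear[OF bounded_linear_inner_left assms(1,5)])
    show "Ck_on k U (\<lambda>x. frechet_derivative f (at (a x) within V) b)" for b
      by (rule Ck_on_compose[OF assms(1,2,3,4)]) (use assms(6) in simp)
  qed
  then show ?thesis
    by (rule Ck_on_cong[THEN iffD1, rotated]) (simp add: *)
qed

section \<open>Smooth maps\<close>

lemma smooth_on_cong: "(\<And>x. x \<in> U \<Longrightarrow> f x = g x) \<Longrightarrow> smooth_on U f \<longleftrightarrow> smooth_on U g"
  by (simp add: smooth_on_def Ck_on_cong[of U f g])

lemma smooth_on_Int_open: "open T \<Longrightarrow> smooth_on U f \<Longrightarrow> smooth_on (U \<inter> T) f"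
  unfolding smooth_on_def using Ck_on_Int_open by blast

lemma smooth_on_openin:
  assumes "smooth_on U f" "openin (top_of_set U) K"
  shows "smooth_on K f"
  using assms smooth_on_Int_open unfolding openin_open by blast

lemma smooth_on_open_subset:
  assumes "smooth_on U f" "open T" "T \<subseteq> U"
  shows "smooth_on T f"
proof -
  have "U \<inter> T = T" using assms(3) by auto
  then show ?thesis using smooth_on_Int_open[OF assms(2,1)] by simp
qed

lemma smooth_on_local:
  assumes "\<And>x. x \<in> U \<Longrightarrow> \<exists>T. open T \<and> x \<in> T \<and> smooth_on (U \<inter> T) f"
  shows "smooth_on U f"
  unfolding smooth_on_def
proof
  fix k show "Ck_on k U f"
    using assms unfolding smooth_on_def by (intro Ck_on_local) blast
qed

lemma smooth_on_const: "thick U \<Longrightarrow> smooth_on U (\<lambda>x. c)"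
  by (simp add: smooth_on_def Ck_on_const)

lemma smooth_on_id: "thick U \<Longrightarrow> smooth_on U (\<lambda>x. x)"
  by (simp add: smooth_on_def Ck_on_id)

lemma smooth_on_add:
  "thick U \<Longrightarrow> smooth_on U f \<Longrightarrow> smooth_on U g \<Longrightarrow> smooth_on U (\<lambda>x. f x + g x)"
  by (simp add: smooth_on_def Ck_on_add)

lemma smooth_on_linear:
  "bounded_linear L \<Longrightarrow> thick U \<Longrightarrow> smooth_on U f \<Longrightarrow> smooth_on U (\<lambda>x. L (f x))"
  by (simp add: smooth_on_def Ck_on_linear)

lemma smooth_on_bilinear:
  "bounded_bilinear B \<Longrightarrow> thick U \<Longrightarrow> smooth_on U f \<Longrightarrow> smooth_on U g \<Longrightarrow> smooth_on U (\<lambda>x. B (f x) (g x))"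
  by (simp add: smooth_on_def Ck_on_bilinear)

lemmas smooth_on_scaleR = smooth_on_bilinear[OF bounded_bilinear_scaleR]
lemmas smooth_on_inner_left = smooth_on_linear[OF bounded_linear_inner_left]
lemmas smooth_on_fst = smooth_on_linear[OF bounded_linear_fst]
lemmas smooth_on_snd = smooth_on_linear[OF bounded_linear_snd]

lemma smooth_on_Pair:
  "thick U \<Longrightarrow> smooth_on U f \<Longrightarrow> smooth_on U g \<Longrightarrow> smooth_on U (\<lambda>x. (f x, g x))"
  by (simp add: smooth_on_def Ck_on_Pair)

lemma smooth_on_compose:
  fixes f :: "'a::euclidean_space \<Rightarrow> 'b::euclidean_space" and g :: "'b \<Rightarrow> 'c::real_normed_vector"
  assumes "smooth_on V g" "open V" "thick U" "smooth_on U f" "f ` U \<subseteq> V"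
  shows "smooth_on U (\<lambda>x. g (f x))"
  unfolding smooth_on_def
proof
  fix k show "Ck_on k U (\<lambda>x. g (f x))"
    by (rule Ck_on_compose[OF assms(3,2,5)]) (use assms(1,4) in \<open>simp_all add: smooth_on_def\<close>)
qed

lemma smooth_on_frechet_derivative:
  fixes a v :: "'a::euclidean_space \<Rightarrow> 'b::euclidean_space" and f :: "'b \<Rightarrow> 'c::real_normed_vector"
  assumes "smooth_on V f" "open V" "thick U" "smooth_on U a" "smooth_on U v" "a ` U \<subseteq> V"
  shows "smooth_on U (\<lambda>x. frechet_derivative f (at (a x)) (v x))"
  unfolding smooth_on_def
proof
  fix k show "Ck_on k U (\<lambda>x. frechet_derivative f (at (a x)) (v x))"
    by (rule Ck_on_frechet_derivative[OF assms(3,2,6)])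
      (use assms(1,4,5) in \<open>simp_all add: smooth_on_def del: Ck_on.simps\<close>)
qed

lemma smooth_on_continuous: "smooth_on U f \<Longrightarrow> continuous_on U f"
  unfolding smooth_on_def by (drule spec[of _ 0]) simp

lemma smooth_on_has_derivative_within:
  "smooth_on U f \<Longrightarrow> x \<in> U \<Longrightarrow> (f has_derivative frechet_derivative f (at x within U)) (at x within U)"
  unfolding smooth_on_def by (rule Ck_on_has_derivative) (rule spec)

lemma smooth_on_has_derivative:
  assumes "smooth_on U f" "open U" "x \<in> U"
  shows "(f has_derivative frechet_derivative f (at x)) (at x)"
  using smooth_on_has_derivative_within[OF assms(1,3)] unfolding at_within_open[OF assms(3,2)] .

lemma smooth_on_linear_derivative:
  assumes "smooth_on U f" "open U" "x \<in> U"
  shows "linear (frechet_derivative f (at x))"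
  using smooth_on_has_derivative[OF assms] has_derivative_linear by blast

lemma smooth_on_has_vector_derivative:
  fixes f :: "real \<Rightarrow> 'b::real_normed_vector"
  assumes "smooth_on U f" "x \<in> U"
  shows "(f has_vector_derivative vector_derivative f (at x within U)) (at x within U)"
  using smooth_on_has_derivative_within[OF assms] vector_derivative_works differentiableI by blast

lemma vector_derivative_thick:
  assumes "thick U" "x \<in> U" "(f has_vector_derivative f') (at x within U)"
  shows "vector_derivative f (at x within U) = f'"
proof -
  have d: "(f has_derivative (\<lambda>h. h *\<^sub>R f')) (at x within U)"
    using assms(3) by (simp add: has_vector_derivative_def)
  then have "(f has_vector_derivative vector_derivative f (at x within U)) (at x within U)"
    using vector_derivative_works differentiableI by blast
  then have "(f has_derivative (\<lambda>h. h *\<^sub>R vector_derivative f (at x within U))) (at x within U)"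
    by (simp add: has_vector_derivative_def)
  then have "(\<lambda>h. h *\<^sub>R vector_derivative f (at x within U)) = (\<lambda>h. h *\<^sub>R f')"
    using frechet_derivative_thick[OF assms(1,2)] d by metis
  then show ?thesis by (metis scaleR_one)
qed

lemma smooth_on_vector_derivative:
  fixes f :: "real \<Rightarrow> 'b::real_normed_vector"
  assumes "thick U" "smooth_on U f"
  shows "smooth_on U (\<lambda>x. vector_derivative f (at x within U))"
proof -
  have "smooth_on U (\<lambda>x. frechet_derivative f (at x within U) 1)"
    using assms(2) unfolding smooth_on_def by (metis Ck_on.simps(2))
  moreover have "frechet_derivative f (at x within U) 1 = vector_derivative f (at x within U)"
    if "x \<in> U" for x
    using frechet_derivative_thick[OF assms(1) that] smooth_on_has_vector_derivative[OF assms(2) that]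
    unfolding has_vector_derivative_def by fastforce
  ultimately show ?thesis
    using smooth_on_cong[of U "\<lambda>x. frechet_derivative f (at x within U) 1"
        "\<lambda>x. vector_derivative f (at x within U)"] by simp
qed

lemma at_within_openin:
  assumes "openin (top_of_set I) J" "t \<in> J"
  shows "at t within J = at t within I"
  using assms at_within_Int_open unfolding openin_open by blast

section \<open>Symmetry of second derivatives\<close>

text \<open>For every small \<open>h\<close> the second difference quotient over the
  parallelogram with sides \<open>h u\<close> and \<open>h v\<close> is, by the mean value theorem applied twice in either
  order, a value of each of the two mixed derivatives.\<close>

lemma mixed_derivative_mean_value:
  fixes f :: "'a::euclidean_space \<Rightarrow> real"
  assumes f: "smooth_on V f" "open V" and h: "h > 0"
    and V: "\<And>s t. 0 \<le> s \<Longrightarrow> s \<le> h \<Longrightarrow> 0 \<le> t \<Longrightarrow> t \<le> h \<Longrightarrow> x + s *\<^sub>R u + t *\<^sub>R v \<in> V"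
  obtains s t where "0 < s" "s < h" "0 < t" "t < h"
    "f (x + h *\<^sub>R u + h *\<^sub>R v) - f (x + h *\<^sub>R u) - f (x + h *\<^sub>R v) + f x =
       h * (h * frechet_derivative (\<lambda>y. frechet_derivative f (at y) u) (at (x + s *\<^sub>R u + t *\<^sub>R v)) v)"
proof -
  let ?D = "\<lambda>y. frechet_derivative f (at y) u"
  have D: "smooth_on V ?D"
    using smooth_on_frechet_derivative[OF f(1,2), of V "\<lambda>y. y" "\<lambda>y. u"] f(2)
    by (simp add: thick_open smooth_on_const smooth_on_id)
  \<comment> \<open>The increment of \<open>\<phi>\<close> over \<open>[0, h]\<close> is the second
    difference. The vacuous \<open>0 *\<^sub>R v\<close> brings both terms into the form
    differentiated in \<open>lin\<close>.\<close>
  define \<phi> where "\<phi> s = f (x + s *\<^sub>R u + h *\<^sub>R v) - f (x + s *\<^sub>R u + 0 *\<^sub>R v)" for s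
  have lin: "((\<lambda>s. f (x + s *\<^sub>R u + t *\<^sub>R v)) has_real_derivative ?D (x + s *\<^sub>R u + t *\<^sub>R v)) (at s)"
    if "0 \<le> s" "s \<le> h" "0 \<le> t" "t \<le> h" for s t
  proof -
    have "((\<lambda>s. f (x + s *\<^sub>R u + t *\<^sub>R v)) has_derivative
        (\<lambda>r. frechet_derivative f (at (x + s *\<^sub>R u + t *\<^sub>R v)) (r *\<^sub>R u))) (at s)"
      by (rule has_derivative_compose[of "\<lambda>s. x + s *\<^sub>R u + t *\<^sub>R v" _ s UNIV,
            OF _ smooth_on_has_derivative[OF f V[OF that]]])
        (auto intro!: derivative_eq_intros)
    then show ?thesis
      unfolding has_field_derivative_def
      by (simp add: linear_cmul[OF smooth_on_linear_derivative[OF f V[OF that]]] mult_commute_abs)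
  qed
  have lin2: "((\<lambda>t. ?D (x + s *\<^sub>R u + t *\<^sub>R v)) has_real_derivative
      frechet_derivative ?D (at (x + s *\<^sub>R u + t *\<^sub>R v)) v) (at t)"
    if "0 \<le> s" "s \<le> h" "0 \<le> t" "t \<le> h" for s t
  proof -
    have "((\<lambda>t. ?D (x + s *\<^sub>R u + t *\<^sub>R v)) has_derivative
        (\<lambda>r. frechet_derivative ?D (at (x + s *\<^sub>R u + t *\<^sub>R v)) (r *\<^sub>R v))) (at t)"
      by (rule has_derivative_compose[of "\<lambda>t. x + s *\<^sub>R u + t *\<^sub>R v" _ t UNIV,
            OF _ smooth_on_has_derivative[OF D f(2) V[OF that]]])
        (auto intro!: derivative_eq_intros)
    then show ?thesis
      unfolding has_field_derivative_def
      by (simp add: linear_cmul[OF smooth_on_linear_derivative[OF D f(2) V[OF that]]] mult_commute_abs)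
  qed
  have "\<exists>s. 0 < s \<and> s < h \<and> \<phi> h - \<phi> 0 =
      (h - 0) * (?D (x + s *\<^sub>R u + h *\<^sub>R v) - ?D (x + s *\<^sub>R u + 0 *\<^sub>R v))"
    unfolding \<phi>_def by (intro MVT2 h DERIV_diff lin) (use h in auto)
  then obtain s where s: "0 < s" "s < h"
    "\<phi> h - \<phi> 0 = h * (?D (x + s *\<^sub>R u + h *\<^sub>R v) - ?D (x + s *\<^sub>R u + 0 *\<^sub>R v))"
    by auto
  have "\<exists>t. 0 < t \<and> t < h \<and> ?D (x + s *\<^sub>R u + h *\<^sub>R v) - ?D (x + s *\<^sub>R u + 0 *\<^sub>R v) =
      (h - 0) * frechet_derivative ?D (at (x + s *\<^sub>R u + t *\<^sub>R v)) v"
    by (intro MVT2 h lin2) (use s in auto)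
  then obtain t where "0 < t" "t < h" "?D (x + s *\<^sub>R u + h *\<^sub>R v) - ?D (x + s *\<^sub>R u + 0 *\<^sub>R v) =
      h * frechet_derivative ?D (at (x + s *\<^sub>R u + t *\<^sub>R v)) v"
    by auto
  with s show thesis by (intro that[of s t]) (auto simp: \<phi>_def)
qed

text \<open>Suppose the two mixed derivatives at \<open>x\<close> are \<open>2 * e\<close> apart. By
  continuity each stays within \<open>e\<close> of its value at \<open>x\<close> on a small
  parallelogram, while the mean value form of the second difference, read in both orders, makes a
  value of one equal to a value of the other.\<close>

lemma mixed_derivatives_eq_real:
  fixes f :: "'a::euclidean_space \<Rightarrow> real"
  assumes f: "smooth_on V f" "open V" "x \<in> V"
  shows "frechet_derivative (\<lambda>y. frechet_derivative f (at y) u) (at x) v =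
    frechet_derivative (\<lambda>y. frechet_derivative f (at y) v) (at x) u"
proof (rule ccontr)
  define P where "P u v y = frechet_derivative (\<lambda>y. frechet_derivative f (at y) u) (at y) v" for u v y
  assume "\<not> ?thesis"
  then have ne: "P u v x \<noteq> P v u x" by (simp add: P_def)
  have "smooth_on V (P u v)" for u v
    unfolding P_def
    by (rule smooth_on_frechet_derivative[OF smooth_on_frechet_derivative[OF f(1,2)] f(2)])
      (auto simp: f(2) thick_open smooth_on_const smooth_on_id)
  then have cont: "continuous (at x) (P u v)" for u v
    using smooth_on_continuous continuous_on_eq_continuous_at f by blast
  define e where "e = \<bar>P u v x - P v u x\<bar> / 2"
  have e: "e > 0" using ne by (simp add: e_def)
  have near: "\<exists>d>0. \<forall>y. dist y x < d \<longrightarrow> \<bar>P u v y - P u v x\<bar> < e" for u v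
    using cont[of u v] e unfolding continuous_at_eps_delta dist_real_def by blast
  obtain d1 where d1: "d1 > 0" "\<And>y. dist y x < d1 \<Longrightarrow> \<bar>P u v y - P u v x\<bar> < e" using near by blast
  obtain d2 where d2: "d2 > 0" "\<And>y. dist y x < d2 \<Longrightarrow> \<bar>P v u y - P v u x\<bar> < e" using near by blast
  obtain r where r: "r > 0" "ball x r \<subseteq> V" using f openE by blast
  \<comment> \<open>The parallelogram has diameter controlled by
    \<open>h * (norm u + norm v)\<close>; this \<open>h\<close> keeps it inside \<open>V\<close> and
    inside both continuity neighbourhoods. The summand 1 keeps the denominator positive when
    \<open>u\<close> and \<open>v\<close> vanish.\<close>
  define h where "h = min r (min d1 d2) / (2 * (norm u + norm v + 1))"
  have h: "h > 0" using r d1 d2 unfolding h_def by (simp add: add_nonneg_pos)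
  have small: "dist (x + s *\<^sub>R u' + t *\<^sub>R v') x < min r (min d1 d2)"
    if "0 \<le> s" "s \<le> h" "0 \<le> t" "t \<le> h" "norm u' + norm v' = norm u + norm v" for s t u' v'
  proof -
    have "dist (x + s *\<^sub>R u' + t *\<^sub>R v') x \<le> s * norm u' + t * norm v'"
      using norm_triangle_ineq[of "s *\<^sub>R u'" "t *\<^sub>R v'"] that by (simp add: dist_norm)
    also have "\<dots> \<le> h * norm u' + h * norm v'"
      using that by (intro add_mono mult_right_mono) auto
    also have "\<dots> = h * (norm u + norm v)" using that(5) by (metis distrib_left)
    also have "\<dots> < h * (2 * (norm u + norm v + 1))"
      using h by (intro mult_strict_left_mono) (auto simp: add_nonneg_pos intro: add_strict_increasing2)
    also have "\<dots> = min r (min d1 d2)"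
      unfolding h_def using norm_ge_zero[of u] norm_ge_zero[of v] by (simp add: field_simps add_nonneg_eq_0_iff)
    finally show ?thesis .
  qed
  obtain s t where st: "0 < s" "s < h" "0 < t" "t < h"
    "f (x + h *\<^sub>R u + h *\<^sub>R v) - f (x + h *\<^sub>R u) - f (x + h *\<^sub>R v) + f x =
       h * (h * P u v (x + s *\<^sub>R u + t *\<^sub>R v))"
  proof (rule mixed_derivative_mean_value[OF f(1,2) h, of x u v])
    show "x + s *\<^sub>R u + t *\<^sub>R v \<in> V" if "0 \<le> s" "s \<le> h" "0 \<le> t" "t \<le> h" for s t
      using small[OF that] r by (auto simp: dist_commute)
  qed (auto simp: P_def)
  obtain s' t' where st': "0 < s'" "s' < h" "0 < t'" "t' < h"
    "f (x + h *\<^sub>R v + h *\<^sub>R u) - f (x + h *\<^sub>R v) - f (x + h *\<^sub>R u) + f x =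
       h * (h * P v u (x + s' *\<^sub>R v + t' *\<^sub>R u))"
  proof (rule mixed_derivative_mean_value[OF f(1,2) h, of x v u])
    show "x + s *\<^sub>R v + t *\<^sub>R u \<in> V" if "0 \<le> s" "s \<le> h" "0 \<le> t" "t \<le> h" for s t
      using small[OF that, of v u] r by (auto simp: dist_commute)
  qed (auto simp: P_def)
  have "h * (h * P u v (x + s *\<^sub>R u + t *\<^sub>R v)) = h * (h * P v u (x + s' *\<^sub>R v + t' *\<^sub>R u))"
    unfolding st(5)[symmetric] st'(5)[symmetric] by (simp add: add.assoc add.commute[of "h *\<^sub>R u"])
  then have "P u v (x + s *\<^sub>R u + t *\<^sub>R v) = P v u (x + s' *\<^sub>R v + t' *\<^sub>R u)"
    using h by simp
  moreover have "\<bar>P u v (x + s *\<^sub>R u + t *\<^sub>R v) - P u v x\<bar> < e"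
    using small[of s t u v] st d1(2) by simp
  moreover have "\<bar>P v u (x + s' *\<^sub>R v + t' *\<^sub>R u) - P v u x\<bar> < e"
    using small[of s' t' v u] st' d2(2) by simp
  moreover have False if "p = q" "\<bar>p - a\<bar> < \<bar>a - b\<bar> / 2" "\<bar>q - b\<bar> < \<bar>a - b\<bar> / 2" for p q a b :: real
  proof -
    have "\<bar>a - b\<bar> \<le> \<bar>p - a\<bar> + \<bar>q - b\<bar>" using that(1) by linarith
    also have "\<dots> < \<bar>a - b\<bar> / 2 + \<bar>a - b\<bar> / 2" by (rule add_strict_mono[OF that(2,3)])
    finally show False by simp
  qed
  ultimately show False unfolding e_def by blast
qed

lemma mixed_derivatives_eq:
  fixes f :: "'a::euclidean_space \<Rightarrow> 'b::euclidean_space"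
  assumes f: "smooth_on V f" "open V" "x \<in> V"
  shows "frechet_derivative (\<lambda>y. frechet_derivative f (at y) u) (at x) v =
    frechet_derivative (\<lambda>y. frechet_derivative f (at y) v) (at x) u"
proof (rule euclidean_eqI)
  fix b :: 'b assume "b \<in> Basis"
  have s: "smooth_on V (\<lambda>y. f y \<bullet> b)"
    using f by (intro smooth_on_inner_left thick_open)
  have 1: "frechet_derivative (\<lambda>y. g y \<bullet> b) (at y) u = frechet_derivative g (at y) u \<bullet> b"
    if "smooth_on V g" "y \<in> V" for g y u
    using frechet_derivative_at[OF bounded_linear.has_derivative[OF bounded_linear_inner_left
          smooth_on_has_derivative[OF that(1) f(2) that(2)]], of b] by metis
  have 2: "frechet_derivative (\<lambda>y. frechet_derivative (\<lambda>y. f y \<bullet> b) (at y) u) (at x) v =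
      frechet_derivative (\<lambda>y. frechet_derivative f (at y) u) (at x) v \<bullet> b" for u v
  proof -
    have "frechet_derivative (\<lambda>y. frechet_derivative (\<lambda>y. f y \<bullet> b) (at y) u) (at x) =
        frechet_derivative (\<lambda>y. frechet_derivative f (at y) u \<bullet> b) (at x)"
      by (rule frechet_derivative_cong_at[OF f(2,3)]) (rule 1[OF f(1)])
    moreover have "smooth_on V (\<lambda>y. frechet_derivative f (at y) u)"
      by (rule smooth_on_frechet_derivative[OF f(1,2)])
        (auto simp: f(2) thick_open smooth_on_const smooth_on_id)
    ultimately show ?thesis using 1[OF _ f(3)] by simp
  qed
  show "frechet_derivative (\<lambda>y. frechet_derivative f (at y) u) (at x) v \<bullet> b =
    frechet_derivative (\<lambda>y. frechet_derivative f (at y) v) (at x) u \<bullet> b"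
    using mixed_derivatives_eq_real[OF s f(2,3), of u v] unfolding 2 .
qed

section \<open>Bump functions\<close>

text \<open>Up to linear combinations, the family \<open>flat\<close> is closed under differentiation.\<close>

definition flat :: "nat \<Rightarrow> real \<Rightarrow> real"
  where "flat n x = (if x \<le> 0 then 0 else inverse x ^ n * exp (- inverse x))"

lemma flat_tendsto_0: "(flat n \<longlongrightarrow> 0) (at 0)"
proof (rule filterlim_split_at)
  show "(flat n \<longlongrightarrow> 0) (at_left 0)"
    by (rule tendsto_eventually) (auto simp: flat_def eventually_at_filter)
  have "((\<lambda>x. inverse x ^ n / exp (inverse x)) \<longlongrightarrow> (0::real)) (at_right 0)"
    using tendsto_power_div_exp_0 filterlim_inverse_at_top_right by (rule filterlim_compose)
  then show "(flat n \<longlongrightarrow> 0) (at_right 0)"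
    by (rule Lim_transform_eventually) (auto simp: flat_def eventually_at_filter exp_minus divide_inverse)
qed

lemma flat_has_derivative:
  "(flat n has_real_derivative flat (Suc (Suc n)) x - n * flat (Suc n) x) (at x)"
proof -
  consider "x < 0" | "x = 0" | "x > 0" by linarith
  then show ?thesis
  proof cases
    case 1
    have "((\<lambda>x. 0) has_real_derivative 0) (at x)" by simp
    then have "(flat n has_real_derivative 0) (at x)"
      by (rule has_field_derivative_transform_within_open[of _ _ _ "{..<0}"]) (use 1 in \<open>auto simp: flat_def\<close>)
    then show ?thesis using 1 by (simp add: flat_def)
  next
    case 2
    \<comment> \<open>The difference quotient of \<open>flat n\<close> at 0 is
      \<open>flat (Suc n)\<close>, whose limit is already known.\<close>
    have "((\<lambda>h. (flat n (0 + h) - flat n 0) / h) \<longlongrightarrow> 0) (at 0)"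
      by (rule Lim_transform_eventually[OF flat_tendsto_0[of "Suc n"]])
        (auto simp: flat_def eventually_at_filter field_simps)
    then show ?thesis using 2 by (simp add: flat_def DERIV_def)
  next
    case 3
    have "((\<lambda>x. inverse x ^ n * exp (- inverse x)) has_real_derivative
        flat (Suc (Suc n)) x - n * flat (Suc n) x) (at x)"
    proof -
      have "((\<lambda>x. inverse x ^ n) has_real_derivative - n * inverse x ^ Suc n) (at x)"
      proof (cases n)
        case (Suc m)
        have "((\<lambda>x. inverse x ^ Suc m) has_real_derivative
            Suc m * (- (inverse x * 1 * inverse x) * inverse x ^ m)) (at x)"
          using DERIV_power[OF DERIV_inverse'[OF DERIV_ident], of x "Suc m" UNIV] 3 by simp
        moreover have "Suc m * (- (inverse x * 1 * inverse x) * inverse x ^ m) = - Suc m * inverse x ^ Suc (Suc m)"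
          by (simp add: algebra_simps)
        ultimately show ?thesis unfolding Suc by metis
      qed simp
      moreover have "((\<lambda>x. exp (- inverse x)) has_real_derivative inverse x ^ 2 * exp (- inverse x)) (at x)"
        using 3 by (auto intro!: derivative_eq_intros simp: power2_eq_square)
      ultimately have "((\<lambda>x. inverse x ^ n * exp (- inverse x)) has_real_derivative
          - n * inverse x ^ Suc n * exp (- inverse x) + inverse x ^ 2 * exp (- inverse x) * inverse x ^ n) (at x)"
        by (rule DERIV_mult)
      then show ?thesis using 3 by (simp add: flat_def power2_eq_square algebra_simps)
    qed
    then show ?thesis
      by (rule has_field_derivative_transform_within_open[of _ _ _ "{0<..}"]) (use 3 in \<open>auto simp: flat_def\<close>)
  qed
qed

lemma smooth_flat: "smooth_on UNIV (flat n)"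
proof -
  have "Ck_on k UNIV (flat n)" for k
  proof (induction k arbitrary: n)
    case 0
    then show ?case
      using flat_has_derivative by (auto intro!: continuous_at_imp_continuous_on DERIV_isCont)
  next
    case (Suc k)
    show ?case
    proof (rule Ck_on_SucI[OF thick_UNIV])
      show "(flat n has_derivative (*) (flat (Suc (Suc n)) x - n * flat (Suc n) x)) (at x within UNIV)" for x
        using flat_has_derivative unfolding has_field_derivative_def by simp
      have "Ck_on k UNIV (\<lambda>x. (flat (Suc (Suc n)) x + (- real n) * flat (Suc n) x) * v)" for v
        by (intro Ck_on_bilinear[OF bounded_bilinear_mult] Ck_on_add Ck_on_const Suc thick_UNIV)
      then show "Ck_on k UNIV (\<lambda>x. (flat (Suc (Suc n)) x - n * flat (Suc n) x) * v)" for v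
        by simp
    qed
  qed
  then show ?thesis by (simp add: smooth_on_def)
qed

text \<open>The bump is \<open>a / (a + b)\<close>, where \<open>a\<close> is positive exactly for
  \<open>dist x0 x < r\<close> and \<open>b\<close> exactly for squared distance above
  \<open>r\<^sup>2 / 2\<close>. These two regions cover the space, so the denominator never
  vanishes, and \<open>(r / 2)\<^sup>2\<close> is below \<open>r\<^sup>2 / 2\<close>, so
  \<open>b\<close> is zero on the half ball. Squared distances are used because they are smooth at
  the centre as well.\<close>

lemma smooth_bump:
  fixes x0 :: "'a::euclidean_space"
  assumes "r > 0"
  obtains \<psi> :: "'a \<Rightarrow> real" where "smooth_on UNIV \<psi>" "\<And>x. x \<in> ball x0 (r / 2) \<Longrightarrow> \<psi> x = 1"
    "\<And>x. x \<notin> ball x0 r \<Longrightarrow> \<psi> x = 0"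
proof -
  define q where "q x = (x - x0) \<bullet> (x - x0)" for x
  define a where "a x = flat 0 (r\<^sup>2 - q x)" for x
  define b where "b x = flat 0 (q x - r\<^sup>2 / 2)" for x
  have q: "q x = (dist x0 x)\<^sup>2" for x
    by (metis q_def dist_commute dist_norm power2_norm_eq_inner)
  have ab: "a x + b x > 0" for x
  proof -
    have "0 < r\<^sup>2" using assms by simp
    then have "r\<^sup>2 - q x > 0 \<or> q x - r\<^sup>2 / 2 > 0" by linarith
    then show ?thesis unfolding a_def b_def flat_def by (auto simp: add_pos_nonneg add_nonneg_pos)
  qed
  have sq: "smooth_on UNIV q"
  proof -
    have "smooth_on UNIV (\<lambda>x. x + (- x0))"
      by (intro smooth_on_add smooth_on_id smooth_on_const thick_UNIV)
    then show ?thesis unfolding q_def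
      by (intro smooth_on_bilinear[OF bounded_bilinear_inner] thick_UNIV) simp_all
  qed
  have sa: "smooth_on UNIV a"
  proof -
    have "smooth_on UNIV (\<lambda>x. r\<^sup>2 + (- q x))"
      by (intro smooth_on_add smooth_on_const thick_UNIV sq
          smooth_on_linear[OF bounded_linear_minus[OF bounded_linear_ident]])
    then have "smooth_on UNIV (\<lambda>x. flat 0 (r\<^sup>2 + (- q x)))"
      by (rule smooth_on_compose[OF smooth_flat open_UNIV thick_UNIV]) auto
    then show ?thesis by (simp add: a_def[abs_def])
  qed
  have sb: "smooth_on UNIV b"
  proof -
    have "smooth_on UNIV (\<lambda>x. q x + (- (r\<^sup>2 / 2)))"
      by (intro smooth_on_add smooth_on_const thick_UNIV sq)
    then have "smooth_on UNIV (\<lambda>x. flat 0 (q x + (- (r\<^sup>2 / 2))))"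
      by (rule smooth_on_compose[OF smooth_flat open_UNIV thick_UNIV]) auto
    then show ?thesis by (simp add: b_def[abs_def])
  qed
  have "smooth_on UNIV (\<lambda>x. inverse (a x + b x))"
  proof (rule smooth_on_compose[of "- {0}" inverse UNIV "\<lambda>x. a x + b x"])
    show "smooth_on (- {0}) (inverse :: real \<Rightarrow> real)" using Ck_on_inverse by (simp add: smooth_on_def)
    show "smooth_on UNIV (\<lambda>x. a x + b x)" by (intro smooth_on_add thick_UNIV sa sb)
    show "range (\<lambda>x. a x + b x) \<subseteq> - {0}" using ab by (auto simp: less_le)
  qed (auto simp: thick_UNIV)
  then have "smooth_on UNIV (\<lambda>x. a x * inverse (a x + b x))"
    by (intro smooth_on_bilinear[OF bounded_bilinear_mult] thick_UNIV sa)
  then show thesis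
  proof (rule that)
    fix x assume "x \<in> ball x0 (r / 2)"
    then have "(dist x0 x)\<^sup>2 \<le> (r / 2)\<^sup>2" by (intro power_mono) auto
    also have "\<dots> \<le> r\<^sup>2 / 2" by (simp add: power_divide)
    finally have "b x = 0" by (simp add: b_def flat_def q)
    then show "a x * inverse (a x + b x) = 1" using ab[of x] by simp
  next
    fix x assume "x \<notin> ball x0 r"
    then have "r\<^sup>2 \<le> (dist x0 x)\<^sup>2" using assms by (intro power_mono) auto
    then show "a x * inverse (a x + b x) = 0" by (simp add: a_def flat_def q)
  qed
qed

section \<open>Atlases\<close>

locale atlas =
  fixes A :: "('p, 'e::euclidean_space) chart set"
  assumes smooth_atlas: "smooth_atlas A"
begin

abbreviation top :: "'p topology"
  where "top \<equiv> manifold_topology A"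

abbreviation transition :: "('p, 'e) chart \<Rightarrow> ('p, 'e) chart \<Rightarrow> 'p \<Rightarrow> 'e \<Rightarrow> 'e"
  where "transition c d p \<equiv> frechet_derivative (snd d \<circ> cinv c) (at (snd c p))"

lemma inj_on_chart: "c \<in> A \<Longrightarrow> inj_on (snd c) (fst c)"
  using smooth_atlas by (simp add: smooth_atlas_def)

lemma open_overlap: "c \<in> A \<Longrightarrow> d \<in> A \<Longrightarrow> open (snd c ` (fst c \<inter> fst d))"
  using smooth_atlas by (simp add: smooth_atlas_def)

lemma open_chart_image: "c \<in> A \<Longrightarrow> open (snd c ` fst c)"
  using open_overlap[of c c] by simp

lemma smooth_transition:
  "c \<in> A \<Longrightarrow> d \<in> A \<Longrightarrow> smooth_on (snd c ` (fst c \<inter> fst d)) (snd d \<circ> cinv c)"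
  using smooth_atlas by (simp add: smooth_atlas_def)

lemma cinv_chart: "c \<in> A \<Longrightarrow> p \<in> fst c \<Longrightarrow> cinv c (snd c p) = p"
  by (simp add: inj_on_chart)

lemma chart_cinv: "x \<in> snd c ` fst c \<Longrightarrow> snd c (cinv c x) = x"
  by (rule f_inv_into_f)

lemma cinv_in_chart: "x \<in> snd c ` fst c \<Longrightarrow> cinv c x \<in> fst c"
  by (rule inv_into_into)

lemma cinv_in:
  assumes "c \<in> A" "x \<in> snd c ` (fst c \<inter> U)" shows "cinv c x \<in> fst c" "cinv c x \<in> U"
  using assms cinv_chart by auto

lemma transition_has_derivative:
  assumes "c \<in> A" "d \<in> A" "p \<in> fst c" "p \<in> fst d"
  shows "((snd d \<circ> cinv c) has_derivative transition c d p) (at (snd c p))"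
  by (rule smooth_on_has_derivative[OF smooth_transition open_overlap]) (use assms in auto)

lemma linear_transition:
  "c \<in> A \<Longrightarrow> d \<in> A \<Longrightarrow> p \<in> fst c \<Longrightarrow> p \<in> fst d \<Longrightarrow> linear (transition c d p)"
  using transition_has_derivative has_derivative_linear by blast

lemma transition_self:
  assumes "c \<in> A" "p \<in> fst c"
  shows "transition c c p = (\<lambda>v. v)"
proof -
  have "transition c c p = frechet_derivative (\<lambda>x. x) (at (snd c p))"
    by (rule frechet_derivative_cong_at[OF open_chart_image[OF assms(1)]])
      (use assms cinv_chart in auto)
  then show ?thesis by simp
qed

lemma open_overlap3:
  assumes "c \<in> A" "d \<in> A" "e \<in> A"
  shows "open (snd c ` (fst c \<inter> fst d \<inter> fst e))"
proof -
  have "snd c ` (fst c \<inter> fst d \<inter> fst e) = snd c ` (fst c \<inter> fst d) \<inter> snd c ` (fst c \<inter> fst e)"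
    using inj_on_chart[OF assms(1)] by (auto simp: inj_on_def)
  then show ?thesis using open_overlap[OF assms(1,2)] open_overlap[OF assms(1,3)] by auto
qed

lemma transition_chain:
  assumes "c \<in> A" "d \<in> A" "e \<in> A" "p \<in> fst c" "p \<in> fst d" "p \<in> fst e"
  shows "transition c e p v = transition d e p (transition c d p v)"
proof -
  have "((\<lambda>x. (snd e \<circ> cinv d) ((snd d \<circ> cinv c) x)) has_derivative
      (\<lambda>v. transition d e p (transition c d p v))) (at (snd c p))"
    using has_derivative_compose[OF transition_has_derivative[of c d p], of "snd e \<circ> cinv d"]
      transition_has_derivative[of d e p] cinv_chart[of c p] assms by simp
  then have "((snd e \<circ> cinv c) has_derivative (\<lambda>v. transition d e p (transition c d p v))) (at (snd c p))"
    by (rule has_derivative_transform_within_open[OF _ open_overlap3[OF assms(1-3)]])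
      (use assms cinv_chart[of c] cinv_chart[of d] in auto)
  then show ?thesis using frechet_derivative_at by metis
qed

lemma openin_iff:
  "openin top U \<longleftrightarrow> U \<subseteq> points A \<and> (\<forall>c\<in>A. open (snd c ` (U \<inter> fst c)))"
  by (rule openin_manifold_topology) (simp add: inj_on_chart)

lemma openin_chart: "c \<in> A \<Longrightarrow> openin top (fst c)"
  unfolding openin_iff using open_overlap by (auto simp: points_def Int_commute)

lemma topspace_top: "topspace top = points A"
proof
  show "points A \<subseteq> topspace top"
    using openin_chart openin_subset unfolding points_def by blast
  show "topspace top \<subseteq> points A"
    using openin_topspace[of top] unfolding openin_iff by blast
qed

lemma continuous_on_chart_change:
  "c \<in> A \<Longrightarrow> d \<in> A \<Longrightarrow> continuous_on (snd c ` (fst c \<inter> fst d)) (snd d \<circ> cinv c)"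
  using smooth_on_continuous smooth_transition by blast

lemma openin_chart_preimage:
  assumes c: "c \<in> A" and T: "open T"
  shows "openin top {p \<in> fst c. snd c p \<in> T}"
  unfolding openin_iff
proof (intro conjI ballI)
  show "{p \<in> fst c. snd c p \<in> T} \<subseteq> points A" using c by (auto simp: points_def)
  fix d assume d: "d \<in> A"
  have "snd d ` ({p \<in> fst c. snd c p \<in> T} \<inter> fst d) =
      snd d ` (fst d \<inter> fst c) \<inter> (snd c \<circ> cinv d) -` T"
    using cinv_chart[OF d] by (auto simp: image_iff)
  then show "open (snd d ` ({p \<in> fst c. snd c p \<in> T} \<inter> fst d))"
    using continuous_open_preimage[OF continuous_on_chart_change[OF d c] open_overlap[OF d c] T] by simp
qed

text \<open>This transports compact sets of coordinates to compact sets of points.\<close>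

lemma continuous_map_cinv:
  assumes c: "c \<in> A"
  shows "continuous_map (top_of_set (snd c ` fst c)) top (cinv c)"
  unfolding continuous_map_def
proof (intro conjI allI impI)
  show "cinv c \<in> topspace (top_of_set (snd c ` fst c)) \<rightarrow> topspace top"
    using c cinv_chart[OF c] by (auto simp: topspace_top points_def)
  fix U assume "openin top U"
  then have U: "open (snd c ` (U \<inter> fst c))" using c openin_iff by auto
  have "{x \<in> topspace (top_of_set (snd c ` fst c)). cinv c x \<in> U} = snd c ` (U \<inter> fst c)"
    using cinv_chart[OF c] by auto
  then show "openin (top_of_set (snd c ` fst c)) {x \<in> topspace (top_of_set (snd c ` fst c)). cinv c x \<in> U}"
    using U open_chart_image[OF c] by (auto intro: open_openin_trans)
qed

lemma smooth_on_chart_local: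
  assumes d: "d \<in> A" and U: "U \<subseteq> points A"
    and loc: "\<And>q. q \<in> fst d \<Longrightarrow> q \<in> U \<Longrightarrow>
      \<exists>T. openin top T \<and> q \<in> T \<and> T \<subseteq> U \<and> smooth_on (snd d ` (T \<inter> fst d)) F"
  shows "smooth_on (snd d ` (fst d \<inter> U)) F"
proof (rule smooth_on_local)
  fix x assume "x \<in> snd d ` (fst d \<inter> U)"
  then obtain q where q: "q \<in> fst d" "q \<in> U" "x = snd d q" by auto
  then obtain T where T: "openin top T" "q \<in> T" "T \<subseteq> U" "smooth_on (snd d ` (T \<inter> fst d)) F"
    using loc by metis
  have "snd d ` (fst d \<inter> U) \<inter> snd d ` (T \<inter> fst d) = snd d ` (T \<inter> fst d)"
    using T by auto
  then show "\<exists>T. open T \<and> x \<in> T \<and> smooth_on (snd d ` (fst d \<inter> U) \<inter> T) F"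
    using T q d openin_iff by (intro exI[of _ "snd d ` (T \<inter> fst d)"]) auto
qed

subsection \<open>Tangent vectors and fields\<close>

lemma tangent_transition:
  "\<xi> \<in> tangent_space A p \<Longrightarrow> c \<in> A \<Longrightarrow> d \<in> A \<Longrightarrow> p \<in> fst c \<Longrightarrow> p \<in> fst d \<Longrightarrow>
    \<xi> d = transition c d p (\<xi> c)"
  unfolding tangent_space_def by blast

lemma tangent_outside: "\<xi> \<in> tangent_space A p \<Longrightarrow> d \<notin> A \<or> p \<notin> fst d \<Longrightarrow> \<xi> d = 0"
  unfolding tangent_space_def by blast

lemma tangent_eqI:
  assumes "\<xi> \<in> tangent_space A p" "\<eta> \<in> tangent_space A p" "c \<in> A" "p \<in> fst c" "\<xi> c = \<eta> c"
  shows "\<xi> = \<eta>"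
proof
  fix d
  show "\<xi> d = \<eta> d"
  proof (cases "d \<in> A \<and> p \<in> fst d")
    case True
    then show ?thesis using assms tangent_transition[of _ p c d] by metis
  next
    case False
    then show ?thesis using assms tangent_outside[of _ p d] by metis
  qed
qed

text \<open>Since transitions compose on triple overlaps, compatibility with a single chart implies
  it for all pairs of charts.\<close>

lemma tangent_spaceI:
  assumes "c \<in> A" "p \<in> fst c" "\<And>d. d \<in> A \<Longrightarrow> p \<in> fst d \<Longrightarrow> \<xi> d = transition c d p (\<xi> c)"
    "\<And>d. d \<notin> A \<or> p \<notin> fst d \<Longrightarrow> \<xi> d = 0"
  shows "\<xi> \<in> tangent_space A p"
  unfolding tangent_space_def
proof (intro CollectI conjI ballI allI impI)
  fix d e assume "d \<in> A" "e \<in> A" "p \<in> fst d \<and> p \<in> fst e"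
  then show "\<xi> e = transition d e p (\<xi> d)"
    using assms(1,2) assms(3)[of d] assms(3)[of e] transition_chain[of c d e p "\<xi> c"] by simp
qed (use assms in auto)

text \<open>The tangent vector at \<open>p\<close> whose component in the chart \<open>c\<close> is
  \<open>v\<close>, that is, the inverse of evaluation at \<open>c\<close> on the tangent
  space.\<close>

definition tvec :: "('p, 'e) chart \<Rightarrow> 'p \<Rightarrow> 'e \<Rightarrow> ('p, 'e) chart \<Rightarrow> 'e"
  where "tvec c p v = (\<lambda>d. if d \<in> A \<and> p \<in> fst d then transition c d p v else 0)"

lemma tvec_chart: "c \<in> A \<Longrightarrow> p \<in> fst c \<Longrightarrow> tvec c p v c = v"
  by (simp add: tvec_def transition_self)

lemma tvec_tangent:
  assumes "c \<in> A" "p \<in> fst c"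
  shows "tvec c p v \<in> tangent_space A p"
  by (rule tangent_spaceI[OF assms], unfold tvec_chart[OF assms]) (auto simp: tvec_def)

lemma tvec_tangent_space:
  "\<xi> \<in> tangent_space A p \<Longrightarrow> c \<in> A \<Longrightarrow> p \<in> fst c \<Longrightarrow> tvec c p (\<xi> c) = \<xi>"
  by (rule tangent_eqI[OF tvec_tangent]) (auto simp: tvec_chart)

lemma tangent_spaceI':
  assumes "\<And>d. d \<notin> A \<or> p \<notin> fst d \<Longrightarrow> \<xi> d = 0"
    "\<And>c d. c \<in> A \<Longrightarrow> d \<in> A \<Longrightarrow> p \<in> fst c \<Longrightarrow> p \<in> fst d \<Longrightarrow> \<xi> d = transition c d p (\<xi> c)"
  shows "\<xi> \<in> tangent_space A p"
  using assms unfolding tangent_space_def by blast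

lemma subspace_tangent_space: "subspace (tangent_space A p)"
proof (rule subspaceI)
  show "0 \<in> tangent_space A p"
    by (rule tangent_spaceI') (simp_all add: linear_0[OF linear_transition])
next
  fix \<xi> \<eta> assume \<xi>: "\<xi> \<in> tangent_space A p" and \<eta>: "\<eta> \<in> tangent_space A p"
  show "\<xi> + \<eta> \<in> tangent_space A p"
  proof (rule tangent_spaceI')
    fix c d assume *: "c \<in> A" "d \<in> A" "p \<in> fst c" "p \<in> fst d"
    have "\<xi> d + \<eta> d = transition c d p (\<xi> c + \<eta> c)"
      unfolding linear_add[OF linear_transition[OF *]]
      using tangent_transition[OF \<xi> *] tangent_transition[OF \<eta> *] by metis
    then show "(\<xi> + \<eta>) d = transition c d p ((\<xi> + \<eta>) c)" by simp
  qed (simp add: tangent_outside[OF \<xi>] tangent_outside[OF \<eta>])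
next
  fix r \<xi> assume \<xi>: "\<xi> \<in> tangent_space A p"
  show "r *\<^sub>R \<xi> \<in> tangent_space A p"
  proof (rule tangent_spaceI')
    fix c d assume *: "c \<in> A" "d \<in> A" "p \<in> fst c" "p \<in> fst d"
    have "r *\<^sub>R \<xi> d = transition c d p (r *\<^sub>R \<xi> c)"
      unfolding linear_cmul[OF linear_transition[OF *]] using tangent_transition[OF \<xi> *] by metis
    then show "(r *\<^sub>R \<xi>) d = transition c d p ((r *\<^sub>R \<xi>) c)" by (simp add: scaleR_fun_def)
  qed (simp add: scaleR_fun_def tangent_outside[OF \<xi>])
qed

lemma chart_at:
  assumes "p \<in> points A" shows "chart_at A p \<in> A" "p \<in> fst (chart_at A p)"
proof -
  have "\<exists>c. c \<in> A \<and> p \<in> fst c" using assms by (auto simp: points_def)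
  from someI_ex[OF this] show "chart_at A p \<in> A" "p \<in> fst (chart_at A p)"
    unfolding chart_at_def by blast+
qed

abbreviation gfields :: "('p \<Rightarrow> ('p, 'e) chart \<Rightarrow> 'e) set"
  where "gfields \<equiv> fields A (points A)"

lemma field_tangent: "X \<in> fields A U \<Longrightarrow> p \<in> U \<Longrightarrow> X p \<in> tangent_space A p"
  by (simp add: fields_def)

lemma gfields_iff: "X \<in> gfields \<longleftrightarrow> (\<forall>p\<in>points A. X p \<in> tangent_space A p) \<and>
    (\<forall>p. p \<notin> points A \<longrightarrow> X p = 0) \<and> (\<forall>c\<in>A. smooth_on (snd c ` fst c) (\<lambda>x. X (cinv c x) c))"
proof -
  have "fst c \<inter> points A = fst c" if "c \<in> A" for c using that by (auto simp: points_def)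
  then show ?thesis unfolding fields_def by auto
qed

lemma gfields_smooth: "X \<in> gfields \<Longrightarrow> c \<in> A \<Longrightarrow> smooth_on (snd c ` fst c) (\<lambda>x. X (cinv c x) c)"
  by (simp add: gfields_iff)

lemma thick_chart_image: "c \<in> A \<Longrightarrow> thick (snd c ` fst c)"
  by (simp add: thick_open open_chart_image)

lemma gfields_add:
  assumes "X \<in> gfields" "Y \<in> gfields" shows "X + Y \<in> gfields"
  using assms subspace_add[OF subspace_tangent_space] unfolding gfields_iff
  by (simp add: smooth_on_add thick_chart_image)

lemma gfields_scale:
  assumes "smooth_fun A f" "X \<in> gfields" shows "(\<lambda>p. f p *\<^sub>R X p) \<in> gfields"
  unfolding gfields_iff
proof (intro conjI ballI allI impI)
  fix c assume c: "c \<in> A"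
  have "smooth_on (snd c ` fst c) (\<lambda>x. (f \<circ> cinv c) x *\<^sub>R X (cinv c x) c)"
    using assms c by (intro smooth_on_scaleR thick_chart_image gfields_smooth) (auto simp: smooth_fun_def o_def)
  then show "smooth_on (snd c ` fst c) (\<lambda>x. (f (cinv c x) *\<^sub>R X (cinv c x)) c)"
    by (simp add: scaleR_fun_def)
qed (use assms subspace_scale[OF subspace_tangent_space] in \<open>simp_all add: gfields_iff\<close>)

lemma gfields_zero: "0 \<in> gfields"
  unfolding gfields_iff
  by (auto simp: subspace_0[OF subspace_tangent_space] intro!: smooth_on_const thick_chart_image)

lemma smooth_fun_mult:
  assumes "smooth_fun A f" "smooth_fun A g" shows "smooth_fun A (\<lambda>p. f p * g p)"
  using assms unfolding smooth_fun_def o_def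
  by (auto intro!: smooth_on_bilinear[OF bounded_bilinear_mult] thick_chart_image)

lemma tvec_zero: "c \<in> A \<Longrightarrow> p \<in> fst c \<Longrightarrow> tvec c p 0 = 0"
  using tvec_tangent_space[OF subspace_0[OF subspace_tangent_space]] by simp

text \<open>A compact \<open>K\<close> inside the coordinate region \<open>T\<close> is what allows
  products with \<open>\<beta>\<close> to be continued by zero beyond the chart. That
  \<open>\<beta>\<close> equals 1 near a given point is supplied separately by
  \<open>cutoff_exists\<close>.\<close>

definition cutoff :: "('p, 'e) chart \<Rightarrow> 'e set \<Rightarrow> ('p \<Rightarrow> real) \<Rightarrow> bool"
  where "cutoff c T \<beta> \<longleftrightarrow> smooth_fun A \<beta> \<and>
    (\<exists>K. compact K \<and> K \<subseteq> T \<and> (\<forall>q. \<beta> q \<noteq> 0 \<longrightarrow> q \<in> fst c \<and> snd c q \<in> K))"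

text \<open>Coordinate data \<open>g\<close> become a global field. With constant \<open>g\<close>
  these are the coordinate fields of \<open>c\<close> wherever \<open>\<beta>\<close> is 1.\<close>

definition ext_field :: "('p, 'e) chart \<Rightarrow> ('p \<Rightarrow> real) \<Rightarrow> ('e \<Rightarrow> 'e) \<Rightarrow> 'p \<Rightarrow> ('p, 'e) chart \<Rightarrow> 'e"
  where "ext_field c \<beta> g q = (if q \<in> fst c then tvec c q (\<beta> q *\<^sub>R g (snd c q)) else 0)"

definition ext_fun :: "('p, 'e) chart \<Rightarrow> ('p \<Rightarrow> real) \<Rightarrow> ('e \<Rightarrow> real) \<Rightarrow> 'p \<Rightarrow> real"
  where "ext_fun c \<beta> g q = (if q \<in> fst c then \<beta> q * g (snd c q) else 0)"

lemma ext_field_chart: "c \<in> A \<Longrightarrow> q \<in> fst c \<Longrightarrow> ext_field c \<beta> g q c = \<beta> q *\<^sub>R g (snd c q)"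
  by (simp add: ext_field_def tvec_chart)

end

section \<open>Global extension of local data\<close>

locale hausdorff_atlas = atlas A for A :: "('p, 'e::euclidean_space) chart set" +
  assumes Hausdorff: "Hausdorff_space (manifold_topology A)"
begin

text \<open>In a Hausdorff space the image of the compact set \<open>K\<close> is closed, so its
  complement is an open neighbourhood of \<open>q\<close>. In a non-Hausdorff manifold a set compact
  in one chart can fail to be closed, and extension by zero can fail to be continuous.\<close>

lemma outside_compact:
  assumes c: "c \<in> A" and K: "compact K" "K \<subseteq> snd c ` fst c"
    and q: "q \<in> points A" "\<not> (q \<in> fst c \<and> snd c q \<in> K)"
  obtains T where "openin top T" "q \<in> T" "\<And>z. z \<in> T \<Longrightarrow> \<not> (z \<in> fst c \<and> snd c z \<in> K)"
proof -
  have "compactin (top_of_set (snd c ` fst c)) K"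
    using K by (simp add: compactin_subtopology)
  then have "compactin top (cinv c ` K)"
    using image_compactin continuous_map_cinv[OF c] by blast
  then have "closedin top (cinv c ` K)"
    using Hausdorff by (rule compactin_imp_closedin[rotated])
  then have "openin top (points A - cinv c ` K)"
    by (metis closedin_def topspace_top)
  moreover have "z \<in> cinv c ` K \<longleftrightarrow> z \<in> fst c \<and> snd c z \<in> K" for z
    using K(2) cinv_chart[OF c] chart_cinv[of _ c] by (auto simp: image_iff subset_iff) metis+
  ultimately show thesis using q by (intro that[of "points A - cinv c ` K"]) auto
qed

text \<open>Two open sets cover the manifold: the part of the chart over \<open>T\<close>, where
  smoothness is assumed, and the complement of the compact set, where \<open>F\<close> is zero.
  Smoothness is then glued from these.\<close>

lemma smooth_on_compact_support:
  fixes F :: "'p \<Rightarrow> 'f::real_normed_vector"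
  assumes c: "c \<in> A" and d: "d \<in> A" and T: "open T" "T \<subseteq> snd c ` fst c" and K: "compact K" "K \<subseteq> T"
    and F: "smooth_on (snd d ` ({q \<in> fst c. snd c q \<in> T} \<inter> fst d)) (\<lambda>x. F (cinv d x))"
    and 0: "\<And>q. \<not> (q \<in> fst c \<and> snd c q \<in> K) \<Longrightarrow> F q = 0"
  shows "smooth_on (snd d ` fst d) (\<lambda>x. F (cinv d x))"
proof -
  have "smooth_on (snd d ` (fst d \<inter> points A)) (\<lambda>x. F (cinv d x))"
  proof (rule smooth_on_chart_local[OF d order_refl])
    fix q assume q: "q \<in> fst d" "q \<in> points A"
    show "\<exists>T. openin top T \<and> q \<in> T \<and> T \<subseteq> points A \<and> smooth_on (snd d ` (T \<inter> fst d)) (\<lambda>x. F (cinv d x))"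
    proof (cases "q \<in> fst c \<and> snd c q \<in> T")
      case True
      then show ?thesis
        using openin_chart_preimage[OF c T(1)] F openin_iff
        by (intro exI[of _ "{q \<in> fst c. snd c q \<in> T}"]) simp
    next
      case False
      then obtain R where R: "openin top R" "q \<in> R" "\<And>z. z \<in> R \<Longrightarrow> \<not> (z \<in> fst c \<and> snd c z \<in> K)"
        using outside_compact[OF c K(1), of q] K T q by (metis subset_iff subset_trans)
      have "smooth_on (snd d ` (R \<inter> fst d)) (\<lambda>x. F (cinv d x)) \<longleftrightarrow> smooth_on (snd d ` (R \<inter> fst d)) (\<lambda>x. 0 :: 'f)"
        by (rule smooth_on_cong) (use R(3) 0 cinv_chart[OF d] in auto)
      moreover have "open (snd d ` (R \<inter> fst d))" using R(1) d openin_iff by auto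
      ultimately show ?thesis using R openin_iff
        by (intro exI[of _ R]) (simp add: smooth_on_const thick_open)
    qed
  qed
  moreover have "fst d \<inter> points A = fst d" using d by (auto simp: points_def)
  ultimately show ?thesis by simp
qed

lemma cutoff_exists:
  assumes c: "c \<in> A" and p: "p \<in> fst c" and U: "openin top U" "p \<in> U"
  obtains \<beta> U' where "cutoff c (snd c ` (U \<inter> fst c)) \<beta>" "openin top U'" "p \<in> U'" "U' \<subseteq> U \<inter> fst c"
    "\<forall>q\<in>U'. \<beta> q = 1"
proof -
  let ?T = "snd c ` (U \<inter> fst c)"
  have T: "open ?T" "?T \<subseteq> snd c ` fst c" using U c openin_iff by auto
  \<comment> \<open>The closed ball becomes the compact set \<open>K\<close> in
    \<open>cutoff\<close>; the bump lives on the open ball of the same radius.\<close>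
  obtain r where r: "r > 0" "cball (snd c p) r \<subseteq> ?T"
    using T(1) p U(2) open_contains_cball by blast
  obtain \<psi> :: "'e \<Rightarrow> real" where \<psi>: "smooth_on UNIV \<psi>" "\<And>x. x \<in> ball (snd c p) (r / 2) \<Longrightarrow> \<psi> x = 1"
    "\<And>x. x \<notin> ball (snd c p) r \<Longrightarrow> \<psi> x = 0"
    using smooth_bump[OF r(1)] by blast
  define \<beta> where "\<beta> q = (if q \<in> fst c then \<psi> (snd c q) else 0)" for q
  define U' where "U' = {q \<in> fst c. snd c q \<in> ball (snd c p) (r / 2)}"
  have "smooth_on (snd d ` fst d) (\<lambda>x. \<beta> (cinv d x))" if d: "d \<in> A" for d
  proof (rule smooth_on_compact_support[OF c d T compact_cball r(2)])
    let ?O = "{q \<in> fst c. snd c q \<in> ?T} \<inter> fst d"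
    have O: "open (snd d ` ?O)"
      using openin_chart_preimage[OF c T(1)] d openin_iff by simp
    have "smooth_on (snd d ` ?O) (snd c \<circ> cinv d)"
      by (rule smooth_on_open_subset[OF smooth_transition[OF d c] O]) auto
    then have "smooth_on (snd d ` ?O) (\<lambda>x. \<psi> ((snd c \<circ> cinv d) x))"
      by (rule smooth_on_compose[OF \<psi>(1) open_UNIV thick_open[OF O]]) simp
    then show "smooth_on (snd d ` ?O) (\<lambda>x. \<beta> (cinv d x))"
      by (rule smooth_on_cong[THEN iffD1, rotated]) (use cinv_chart[OF d] in \<open>auto simp: \<beta>_def\<close>)
  next
    fix q assume "\<not> (q \<in> fst c \<and> snd c q \<in> cball (snd c p) r)"
    then show "\<beta> q = 0" using \<psi>(3)[of "snd c q"] by (auto simp: \<beta>_def)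
  qed
  then have \<beta>s: "smooth_fun A \<beta>" by (simp add: smooth_fun_def o_def)
  have "q \<in> fst c \<and> snd c q \<in> cball (snd c p) r" if "\<beta> q \<noteq> 0" for q
  proof -
    have q: "q \<in> fst c" and "\<psi> (snd c q) \<noteq> 0" using that by (auto simp: \<beta>_def split: if_splits)
    then have "snd c q \<in> ball (snd c p) r" using \<psi>(3) by blast
    with q show ?thesis by simp
  qed
  then have "\<forall>q. \<beta> q \<noteq> 0 \<longrightarrow> q \<in> fst c \<and> snd c q \<in> cball (snd c p) r"
    by (intro allI impI)
  then have "cutoff c ?T \<beta>"
    unfolding cutoff_def using \<beta>s r(2) compact_cball[of "snd c p" r]
    by (intro conjI exI[of _ "cball (snd c p) r"])
  moreover have "openin top U'" unfolding U'_def by (rule openin_chart_preimage[OF c]) simp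
  moreover have "p \<in> U'" using p r by (simp add: U'_def)
  moreover have "U' \<subseteq> U \<inter> fst c"
  proof
    fix q assume q: "q \<in> U'"
    then have "snd c q \<in> ?T" using r by (auto simp: U'_def)
    then show "q \<in> U \<inter> fst c" using q inj_onD[OF inj_on_chart[OF c], of q] by (auto simp: U'_def)
  qed

  moreover have "\<forall>q\<in>U'. \<beta> q = 1" using \<psi>(2) by (simp add: U'_def \<beta>_def)
  ultimately show thesis by (rule that)
qed

lemma cutoff_overlap:
  assumes c: "c \<in> A" and d: "d \<in> A" and T: "open T" "T \<subseteq> snd c ` fst c" and \<beta>: "cutoff c T \<beta>" and g: "smooth_on T g"
  defines "R \<equiv> snd d ` ({q \<in> fst c. snd c q \<in> T} \<inter> fst d)"
  shows "open R" "smooth_on R (snd c \<circ> cinv d)" "smooth_on R (\<lambda>x. g ((snd c \<circ> cinv d) x))"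
    "smooth_on R (\<lambda>x. \<beta> (cinv d x))"
proof -
  show O: "open R"
    using openin_chart_preimage[OF c T(1)] d openin_iff by (simp add: R_def)
  show a: "smooth_on R (snd c \<circ> cinv d)"
    by (rule smooth_on_open_subset[OF smooth_transition[OF d c] O]) (auto simp: R_def)
  show "smooth_on R (\<lambda>x. g ((snd c \<circ> cinv d) x))"
    by (rule smooth_on_compose[OF g T(1) thick_open[OF O] a]) (use cinv_chart[OF d] in \<open>auto simp: R_def\<close>)
  have "smooth_fun A \<beta>" using \<beta> unfolding cutoff_def by blast
  then have "smooth_on (snd d ` fst d) (\<lambda>x. \<beta> (cinv d x))" using d by (simp add: smooth_fun_def o_def)
  then show "smooth_on R (\<lambda>x. \<beta> (cinv d x))"
    by (rule smooth_on_open_subset[OF _ O]) (auto simp: R_def)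
qed

text \<open>Outside \<open>T\<close> the factor \<open>\<beta>\<close> is zero, so smoothness of
  \<open>g\<close> on \<open>T\<close> suffices. This admits coefficients that are defined only over
  an open part of the chart.\<close>

lemma ext_field_gfields:
  assumes c: "c \<in> A" and T: "open T" "T \<subseteq> snd c ` fst c" and \<beta>: "cutoff c T \<beta>" and g: "smooth_on T g"
  shows "ext_field c \<beta> g \<in> gfields"
  unfolding gfields_iff
proof (intro conjI ballI allI impI)
  fix p
  show "ext_field c \<beta> g p \<in> tangent_space A p"
    using tvec_tangent[OF c] subspace_0[OF subspace_tangent_space] by (simp add: ext_field_def)
  show "ext_field c \<beta> g p = 0" if "p \<notin> points A"
    using that c by (auto simp: ext_field_def points_def)
next
  fix d assume d: "d \<in> A"
  obtain K where K: "compact K" "K \<subseteq> T" "\<And>q. \<beta> q \<noteq> 0 \<Longrightarrow> q \<in> fst c \<and> snd c q \<in> K"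
    using \<beta> unfolding cutoff_def by blast
  show "smooth_on (snd d ` fst d) (\<lambda>x. ext_field c \<beta> g (cinv d x) d)"
  proof (rule smooth_on_compact_support[OF c d T K(1,2)])
    let ?O = "{q \<in> fst c. snd c q \<in> T} \<inter> fst d"
    note O = cutoff_overlap[OF c d T \<beta> g]
    have "smooth_on (snd d ` ?O) (\<lambda>x. frechet_derivative (snd d \<circ> cinv c) (at ((snd c \<circ> cinv d) x))
        (\<beta> (cinv d x) *\<^sub>R g ((snd c \<circ> cinv d) x)))"
      by (rule smooth_on_frechet_derivative[OF smooth_transition[OF c d] open_overlap[OF c d] thick_open[OF O(1)]
            O(2) smooth_on_scaleR[OF thick_open[OF O(1)] O(4,3)]])
        (use cinv_chart[OF d] in auto)
    then show "smooth_on (snd d ` ?O) (\<lambda>x. ext_field c \<beta> g (cinv d x) d)"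
      by (rule smooth_on_cong[THEN iffD1, rotated])
        (use cinv_chart[OF d] d in \<open>auto simp: ext_field_def tvec_def\<close>)
  next
    fix q assume "\<not> (q \<in> fst c \<and> snd c q \<in> K)"
    then have "\<beta> q = 0" using K(3) by blast
    then show "ext_field c \<beta> g q d = 0" using tvec_zero[OF c] by (simp add: ext_field_def)
  qed
qed

lemma ext_fun_smooth:
  assumes c: "c \<in> A" and T: "open T" "T \<subseteq> snd c ` fst c" and \<beta>: "cutoff c T \<beta>" and g: "smooth_on T g"
  shows "smooth_fun A (ext_fun c \<beta> g)"
  unfolding smooth_fun_def o_def
proof
  fix d assume d: "d \<in> A"
  obtain K where K: "compact K" "K \<subseteq> T" "\<And>q. \<beta> q \<noteq> 0 \<Longrightarrow> q \<in> fst c \<and> snd c q \<in> K"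
    using \<beta> unfolding cutoff_def by blast
  show "smooth_on (snd d ` fst d) (\<lambda>x. ext_fun c \<beta> g (cinv d x))"
  proof (rule smooth_on_compact_support[OF c d T K(1,2)])
    let ?O = "{q \<in> fst c. snd c q \<in> T} \<inter> fst d"
    note O = cutoff_overlap[OF c d T \<beta> g]
    have "smooth_on (snd d ` ?O) (\<lambda>x. \<beta> (cinv d x) * g ((snd c \<circ> cinv d) x))"
      by (rule smooth_on_bilinear[OF bounded_bilinear_mult thick_open[OF O(1)] O(4,3)])
    then show "smooth_on (snd d ` ?O) (\<lambda>x. ext_fun c \<beta> g (cinv d x))"
      by (rule smooth_on_cong[THEN iffD1, rotated]) (use cinv_chart[OF d] in \<open>auto simp: ext_fun_def\<close>)
  next
    fix q assume "\<not> (q \<in> fst c \<and> snd c q \<in> K)"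
    then show "ext_fun c \<beta> g q = 0" using K(3) by (auto simp: ext_fun_def)
  qed
qed

end

lemma linear_basis_expansion:
  fixes f :: "'a::euclidean_space \<Rightarrow> 'b::real_vector"
  assumes "linear f"
  shows "f v = (\<Sum>b\<in>Basis. (v \<bullet> b) *\<^sub>R f b)"
proof -
  have "f v = f (\<Sum>b\<in>Basis. (v \<bullet> b) *\<^sub>R b)" by (simp add: euclidean_representation)
  then show ?thesis using assms by (simp add: linear_sum linear_cmul)
qed

section \<open>Lie brackets as tangent vectors\<close>

context atlas begin

lemma field_has_derivative:
  assumes "X \<in> gfields" "c \<in> A" "p \<in> fst c"
  shows "((\<lambda>x. X (cinv c x) c) has_derivative frechet_derivative (\<lambda>x. X (cinv c x) c) (at (snd c p))) (at (snd c p))"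
  by (rule smooth_on_has_derivative[OF gfields_smooth open_chart_image]) (use assms in auto)

text \<open>The derivative of the transformation law of \<open>X\<close>; the second derivative of the coordinate
  change is expanded in a basis.\<close>

lemma field_derivative_transition:
  assumes X: "X \<in> gfields" and c: "c \<in> A" "p \<in> fst c" and d: "d \<in> A" "p \<in> fst d"
  shows "frechet_derivative (\<lambda>x. X (cinv d x) d) (at (snd d p)) (transition c d p v) =
     (\<Sum>b\<in>Basis. (X p c \<bullet> b) *\<^sub>R
        frechet_derivative (\<lambda>x. frechet_derivative (snd d \<circ> cinv c) (at x) b) (at (snd c p)) v) +
     transition c d p (frechet_derivative (\<lambda>x. X (cinv c x) c) (at (snd c p)) v)"
proof -
  let ?\<tau> = "snd d \<circ> cinv c" and ?O = "snd c ` (fst c \<inter> fst d)"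
  let ?x = "snd c p"
  let ?Xc = "\<lambda>x. X (cinv c x) c"
  have O: "open ?O" "?x \<in> ?O" using open_overlap c d by auto
  have D\<tau>: "((\<lambda>x. frechet_derivative ?\<tau> (at x) b) has_derivative
      frechet_derivative (\<lambda>x. frechet_derivative ?\<tau> (at x) b) (at ?x)) (at ?x)" for b
    by (rule smooth_on_has_derivative[OF smooth_on_frechet_derivative[OF smooth_transition[OF c(1) d(1)]]])
      (use O in \<open>auto simp: thick_open smooth_on_const smooth_on_id\<close>)
  have Xp: "?Xc ?x = X p c" using cinv_chart c by simp
  have 0: "((\<lambda>x. \<Sum>b\<in>Basis. (?Xc x \<bullet> b) *\<^sub>R frechet_derivative ?\<tau> (at x) b) has_derivative
      (\<lambda>v. \<Sum>b\<in>Basis. (?Xc ?x \<bullet> b) *\<^sub>R frechet_derivative (\<lambda>x. frechet_derivative ?\<tau> (at x) b) (at ?x) v +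
        (frechet_derivative ?Xc (at ?x) v \<bullet> b) *\<^sub>R frechet_derivative ?\<tau> (at ?x) b)) (at ?x)"
    by (intro has_derivative_sum has_derivative_scaleR D\<tau> has_derivative_inner_left
        field_has_derivative[OF X c])
  have law: "(\<Sum>b\<in>Basis. (?Xc x \<bullet> b) *\<^sub>R frechet_derivative ?\<tau> (at x) b) = X (cinv d (?\<tau> x)) d"
    if x: "x \<in> ?O" for x
  proof -
    obtain q where q: "q \<in> fst c" "q \<in> fst d" "x = snd c q" using x by auto
    have l: "linear (transition c d q)" using linear_transition c d q by simp
    have "q \<in> points A" using c q by (auto simp: points_def)
    then have "X q d = transition c d q (X q c)"
      using tangent_transition[of "X q" q c d] field_tangent[OF X] c d q by simp
    also have "\<dots> = (\<Sum>b\<in>Basis. (X q c \<bullet> b) *\<^sub>R transition c d q b)"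
      by (rule linear_basis_expansion[OF l])
    finally show ?thesis using q cinv_chart[OF c(1)] cinv_chart[OF d(1)] by simp
  qed
  have 1: "((\<lambda>x. X (cinv d (?\<tau> x)) d) has_derivative
      (\<lambda>v. \<Sum>b\<in>Basis. (?Xc ?x \<bullet> b) *\<^sub>R frechet_derivative (\<lambda>x. frechet_derivative ?\<tau> (at x) b) (at ?x) v +
        (frechet_derivative ?Xc (at ?x) v \<bullet> b) *\<^sub>R frechet_derivative ?\<tau> (at ?x) b)) (at ?x)"
    by (rule has_derivative_transform_within_open[OF 0 O law])
  have "((\<lambda>x. X (cinv d (?\<tau> x)) d) has_derivative
      (\<lambda>v. frechet_derivative (\<lambda>x. X (cinv d x) d) (at (snd d p)) (transition c d p v))) (at ?x)"
    using has_derivative_compose[OF transition_has_derivative[OF c(1) d(1) c(2) d(2)],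
        of "\<lambda>x. X (cinv d x) d"] field_has_derivative[OF X d] cinv_chart[OF c] by simp
  from fun_cong[OF has_derivative_unique[OF this 1], of v]
  have "frechet_derivative (\<lambda>x. X (cinv d x) d) (at (snd d p)) (transition c d p v) =
      (\<Sum>b\<in>Basis. (?Xc ?x \<bullet> b) *\<^sub>R frechet_derivative (\<lambda>x. frechet_derivative ?\<tau> (at x) b) (at ?x) v +
        (frechet_derivative ?Xc (at ?x) v \<bullet> b) *\<^sub>R frechet_derivative ?\<tau> (at ?x) b)"
    .
  moreover have "(\<Sum>b\<in>Basis. (frechet_derivative ?Xc (at ?x) v \<bullet> b) *\<^sub>R frechet_derivative ?\<tau> (at ?x) b) =
      transition c d p (frechet_derivative ?Xc (at ?x) v)"
  proof -
    have l: "linear (transition c d p)" using linear_transition c d by simp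
    show ?thesis
      by (rule linear_basis_expansion[OF l, symmetric])
  qed
  ultimately show ?thesis by (simp add: sum.distrib Xp)
qed

lemma lie_bracket_chart:
  "c \<in> A \<Longrightarrow> p \<in> fst c \<Longrightarrow> lie_bracket A X Y p c =
    frechet_derivative (\<lambda>x. Y (cinv c x) c) (at (snd c p)) (X p c) -
    frechet_derivative (\<lambda>x. X (cinv c x) c) (at (snd c p)) (Y p c)"
  by (simp add: lie_bracket_def)

text \<open>Each of the two derivative terms picks up the second derivative of the coordinate
  change, contracted with \<open>X\<close> and \<open>Y\<close>; by symmetry these contributions
  cancel. Brackets can then be passed to \<open>vert_endo\<close> and computed in any chart.\<close>

lemma lie_bracket_tangent:
  assumes X: "X \<in> gfields" and Y: "Y \<in> gfields"
  shows "lie_bracket A X Y p \<in> tangent_space A p"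
proof (rule tangent_spaceI')
  fix c d assume c: "c \<in> A" and d: "d \<in> A" and pc: "p \<in> fst c" and pd: "p \<in> fst d"
  have p: "p \<in> points A" using c pc by (auto simp: points_def)
  have l: "linear (transition c d p)" using linear_transition c d pc pd by simp
  let ?H = "\<lambda>b v. frechet_derivative (\<lambda>x. frechet_derivative (snd d \<circ> cinv c) (at x) b) (at (snd c p)) v"
  have H: "?H b v = ?H v b" for b v
    by (rule mixed_derivatives_eq[OF smooth_transition[OF c d] open_overlap[OF c d]]) (use pc pd in auto)
  have lH: "linear (?H b)" for b
    by (rule smooth_on_linear_derivative[OF smooth_on_frechet_derivative[OF smooth_transition[OF c d]]])
      (use open_overlap[OF c d] pc pd in \<open>auto simp: thick_open smooth_on_const smooth_on_id\<close>)
  have sumH: "(\<Sum>b\<in>Basis. (u \<bullet> b) *\<^sub>R ?H b v) = ?H v u" for u v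
  proof -
    have "(\<Sum>b\<in>Basis. (u \<bullet> b) *\<^sub>R ?H b v) = (\<Sum>b\<in>Basis. (u \<bullet> b) *\<^sub>R ?H v b)" using H by simp
    also have "\<dots> = ?H v u"
      by (rule linear_basis_expansion[OF lH, symmetric])
    finally show ?thesis .
  qed
  have Xd: "X p d = transition c d p (X p c)" "Y p d = transition c d p (Y p c)"
    using tangent_transition field_tangent X Y c d pc pd p by metis+
  show "lie_bracket A X Y p d = transition c d p (lie_bracket A X Y p c)"
    unfolding lie_bracket_chart[OF c pc] lie_bracket_chart[OF d pd] Xd
      field_derivative_transition[OF X c pc d pd] field_derivative_transition[OF Y c pc d pd]
      sumH linear_diff[OF l]
    using H[of "X p c" "Y p c"] by simp
qed (auto simp: lie_bracket_def)

subsection \<open>Curves\<close>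

lemma curve_in_chart:
  assumes "smooth_curve A I \<gamma>" "c \<in> A"
  shows "openin (top_of_set I) {t \<in> I. \<gamma> t \<in> fst c}" "smooth_on {t \<in> I. \<gamma> t \<in> fst c} (snd c \<circ> \<gamma>)"
  using assms by (auto simp: smooth_curve_def)

text \<open>\<open>smooth_curve\<close> asks for open preimages of chart domains only. Inside such a
  preimage the coordinate expression of the curve is continuous, which yields the same for every
  open set.\<close>

lemma curve_openin_preimage:
  assumes \<gamma>: "smooth_curve A I \<gamma>" and U: "openin top U"
  shows "openin (top_of_set I) {t \<in> I. \<gamma> t \<in> U}"
proof (subst openin_subopen, intro ballI)
  fix t assume t: "t \<in> {t \<in> I. \<gamma> t \<in> U}"
  then have "\<gamma> t \<in> points A" using U openin_iff by auto
  then obtain c where c: "c \<in> A" "\<gamma> t \<in> fst c" by (auto simp: points_def)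
  let ?J = "{t \<in> I. \<gamma> t \<in> fst c}"
  have "openin (top_of_set ?J) (?J \<inter> (snd c \<circ> \<gamma>) -` (snd c ` (U \<inter> fst c)))"
    using smooth_on_continuous[OF curve_in_chart(2)[OF \<gamma> c(1)]] U c openin_iff
    by (intro continuous_openin_preimage_gen) auto
  then have "openin (top_of_set I) (?J \<inter> (snd c \<circ> \<gamma>) -` (snd c ` (U \<inter> fst c)))"
    using curve_in_chart(1)[OF \<gamma> c(1)] openin_trans by blast
  moreover have "?J \<inter> (snd c \<circ> \<gamma>) -` (snd c ` (U \<inter> fst c)) \<subseteq> {t \<in> I. \<gamma> t \<in> U}"
    by (auto dest: inj_onD[OF inj_on_chart[OF c(1)]])
  moreover have "t \<in> ?J \<inter> (snd c \<circ> \<gamma>) -` (snd c ` (U \<inter> fst c))" using t c by auto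
  ultimately show "\<exists>T. openin (top_of_set I) T \<and> t \<in> T \<and> T \<subseteq> {t \<in> I. \<gamma> t \<in> U}" by blast
qed

lemma velocity_chart:
  "c \<in> A \<Longrightarrow> \<gamma> t \<in> fst c \<Longrightarrow> velocity A I \<gamma> t c = vector_derivative (snd c \<circ> \<gamma>) (at t within I)"
  by (simp add: velocity_def)

lemma chart_curve_has_vector_derivative:
  assumes \<gamma>: "smooth_curve A I \<gamma>" and t: "t \<in> I" and c: "c \<in> A" "\<gamma> t \<in> fst c"
  shows "((snd c \<circ> \<gamma>) has_vector_derivative velocity A I \<gamma> t c) (at t within I)"
proof -
  let ?J = "{t \<in> I. \<gamma> t \<in> fst c}"
  have "at t within ?J = at t within I"
    using at_within_openin[OF curve_in_chart(1)[OF \<gamma> c(1)], of t] t c by simp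
  then show ?thesis
    using smooth_on_has_vector_derivative[OF curve_in_chart(2)[OF \<gamma> c(1)], of t] t c
    by (simp add: velocity_chart[of c \<gamma> t, OF c])
qed

lemma smooth_compose_curve_has_vector_derivative:
  fixes f :: "'e \<Rightarrow> 'f::real_normed_vector"
  assumes \<gamma>: "smooth_curve A I \<gamma>" and t: "t \<in> I" and c: "c \<in> A" "\<gamma> t \<in> fst c"
    and f: "(f has_derivative f') (at (snd c (\<gamma> t)))"
  shows "((\<lambda>s. f (snd c (\<gamma> s))) has_vector_derivative f' (velocity A I \<gamma> t c)) (at t within I)"
proof -
  have "((\<lambda>s. f ((snd c \<circ> \<gamma>) s)) has_derivative (\<lambda>h. f' (h *\<^sub>R velocity A I \<gamma> t c))) (at t within I)"
    using has_derivative_compose[of "snd c \<circ> \<gamma>" _ t I f f'] f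
      chart_curve_has_vector_derivative[OF \<gamma> t c]
    unfolding has_vector_derivative_def by simp
  then show ?thesis
    using linear_cmul[OF has_derivative_linear[OF f]] by (simp add: has_vector_derivative_def)
qed

lemma velocity_tangent:
  assumes \<gamma>: "smooth_curve A I \<gamma>" and I: "thick I" and t: "t \<in> I"
  shows "velocity A I \<gamma> t \<in> tangent_space A (\<gamma> t)"
proof (rule tangent_spaceI')
  fix c d assume c: "c \<in> A" and d: "d \<in> A" and pc: "\<gamma> t \<in> fst c" and pd: "\<gamma> t \<in> fst d"
  have "((\<lambda>s. (snd d \<circ> cinv c) (snd c (\<gamma> s))) has_vector_derivative
      transition c d (\<gamma> t) (velocity A I \<gamma> t c)) (at t within I)"
    by (rule smooth_compose_curve_has_vector_derivative[OF \<gamma> t c pc transition_has_derivative[OF c d pc pd]])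
  moreover have "at t within {t \<in> I. \<gamma> t \<in> fst c} = at t within I"
    using at_within_openin[OF curve_in_chart(1)[OF \<gamma> c]] t pc by simp
  ultimately have "((snd d \<circ> \<gamma>) has_vector_derivative transition c d (\<gamma> t) (velocity A I \<gamma> t c))
      (at t within {t \<in> I. \<gamma> t \<in> fst c})"
    using has_vector_derivative_transform[of t "{t \<in> I. \<gamma> t \<in> fst c}" "snd d \<circ> \<gamma>"
        "\<lambda>s. (snd d \<circ> cinv c) (snd c (\<gamma> s))"] t pc cinv_chart[OF c] by simp
  then have "((snd d \<circ> \<gamma>) has_vector_derivative transition c d (\<gamma> t) (velocity A I \<gamma> t c)) (at t within I)"
    using \<open>at t within {t \<in> I. \<gamma> t \<in> fst c} = at t within I\<close> by simp
  then show "velocity A I \<gamma> t d = transition c d (\<gamma> t) (velocity A I \<gamma> t c)"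
    unfolding velocity_chart[of d \<gamma> t, OF d pd] by (rule vector_derivative_thick[OF I t])
qed (auto simp: velocity_def)

end

lemma (in hausdorff_atlas) extend_tangent:
  assumes c: "c \<in> A" "p \<in> fst c" and \<xi>: "\<xi> \<in> tangent_space A p"
  obtains \<beta> where "cutoff c (snd c ` fst c) \<beta>" "ext_field c \<beta> (\<lambda>z. \<xi> c) p = \<xi>" "ext_field c \<beta> (\<lambda>z. \<xi> c) \<in> gfields"
proof -
  obtain \<beta> U' where \<beta>: "cutoff c (snd c ` (fst c \<inter> fst c)) \<beta>" "openin top U'" "p \<in> U'"
    "U' \<subseteq> fst c \<inter> fst c" "\<forall>q\<in>U'. \<beta> q = 1"
    by (rule cutoff_exists[OF c openin_chart[OF c(1)] c(2)])
  have "ext_field c \<beta> (\<lambda>z. \<xi> c) p = \<xi>"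
    using tvec_tangent_space[OF \<xi> c] \<beta>(3,5) c by (simp add: ext_field_def)
  moreover have "ext_field c \<beta> (\<lambda>z. \<xi> c) \<in> gfields"
    by (rule ext_field_gfields[OF c(1) open_chart_image[OF c(1)] order_refl])
      (use \<beta>(1) c in \<open>simp_all add: smooth_on_const thick_chart_image\<close>)
  ultimately show thesis using that \<beta>(1) by simp
qed

section \<open>The slit tangent bundle\<close>

lemma in_slit_chart: "w \<in> fst (slit_chart A c) \<longleftrightarrow>
    fst w \<in> fst c \<and> snd w \<in> tangent_space A (fst w) \<and> snd w \<noteq> 0"
  by (auto simp: slit_chart_def)

lemma snd_slit_chart: "snd (slit_chart A c) w = (snd c (fst w), snd w c)"
  by (simp add: slit_chart_def case_prod_beta)

lemma slit_chart_in_slit: "c \<in> A \<Longrightarrow> slit_chart A c \<in> slit A"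
  by (simp add: slit_def)

context atlas begin

lemma tangent_chart_nonzero:
  assumes "v \<in> tangent_space A p" "v \<noteq> 0" "c \<in> A" "p \<in> fst c"
  shows "v c \<noteq> 0"
  using tangent_eqI[OF assms(1) subspace_0[OF subspace_tangent_space] assms(3,4)] assms(2)
  unfolding zero_fun_apply by blast

lemma in_slit_points: "w \<in> points (slit A) \<longleftrightarrow>
    fst w \<in> points A \<and> snd w \<in> tangent_space A (fst w) \<and> snd w \<noteq> 0"
  by (auto simp: points_def slit_def in_slit_chart)

lemma in_slit_chart_iff: "w \<in> points (slit A) \<Longrightarrow> w \<in> fst (slit_chart A c) \<longleftrightarrow> fst w \<in> fst c"
  by (simp add: in_slit_points in_slit_chart)

lemma slit_chart_points: "c \<in> A \<Longrightarrow> w \<in> fst (slit_chart A c) \<Longrightarrow> w \<in> points (slit A)"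
  by (auto simp: points_def slit_def)

lemma inj_on_slit_chart:
  assumes "c \<in> A" shows "inj_on (snd (slit_chart A c)) (fst (slit_chart A c))"
proof (rule inj_onI)
  fix w w' assume w: "w \<in> fst (slit_chart A c)" and w': "w' \<in> fst (slit_chart A c)"
    and eq: "snd (slit_chart A c) w = snd (slit_chart A c) w'"
  have 1: "fst w = fst w'"
    using w w' eq inj_onD[OF inj_on_chart[OF assms]] by (simp add: in_slit_chart snd_slit_chart)
  have "snd w = snd w'"
    by (rule tangent_eqI[of _ "fst w" _ c]) (use w w' eq 1 assms in \<open>simp_all add: in_slit_chart snd_slit_chart\<close>)
  with 1 show "w = w'" by (simp add: prod_eq_iff)
qed

text \<open>An explicit formula for the inverse of the induced chart \<open>slit_chart A c\<close>,
  correct when \<open>y\<close> is nonzero.\<close>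

definition slit_point :: "('p, 'e) chart \<Rightarrow> 'e \<Rightarrow> 'e \<Rightarrow> ('p, 'e) tvec"
  where "slit_point c x y = (cinv c x, tvec c (cinv c x) y)"

lemma slit_point:
  assumes "c \<in> A" "x \<in> snd c ` fst c" "y \<noteq> 0"
  shows "slit_point c x y \<in> fst (slit_chart A c)" "snd (slit_chart A c) (slit_point c x y) = (x, y)"
proof -
  have c: "cinv c x \<in> fst c" by (rule cinv_in_chart[OF assms(2)])
  have "tvec c (cinv c x) y c = y" using tvec_chart[OF assms(1) c] .
  then have "tvec c (cinv c x) y \<noteq> 0" using assms by auto
  then show "slit_point c x y \<in> fst (slit_chart A c)"
    using c tvec_tangent[OF assms(1) c] by (simp add: in_slit_chart slit_point_def)
  show "snd (slit_chart A c) (slit_point c x y) = (x, y)"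
    using chart_cinv[OF assms(2)] tvec_chart[OF assms(1) c] by (simp add: snd_slit_chart slit_point_def)
qed

lemma cinv_slit_chart:
  assumes "c \<in> A" "x \<in> snd c ` fst c" "y \<noteq> 0"
  shows "cinv (slit_chart A c) (x, y) = slit_point c x y"
  by (rule inv_into_f_eq[OF inj_on_slit_chart[OF assms(1)] slit_point[OF assms]])

lemma slit_chart_image:
  assumes c: "c \<in> A"
  shows "snd (slit_chart A c) ` ({w. fst w \<in> U} \<inter> fst (slit_chart A c)) = snd c ` (U \<inter> fst c) \<times> (- {0 :: 'e})"
proof (intro equalityI subsetI)
  fix z assume "z \<in> snd (slit_chart A c) ` ({w. fst w \<in> U} \<inter> fst (slit_chart A c))"
  then obtain w where w: "w \<in> fst (slit_chart A c)" "fst w \<in> U" "z = snd (slit_chart A c) w" by auto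
  then show "z \<in> snd c ` (U \<inter> fst c) \<times> (- {0 :: 'e})"
    using tangent_chart_nonzero[of "snd w" "fst w" c] c by (auto simp: snd_slit_chart in_slit_chart)
next
  fix z assume "z \<in> snd c ` (U \<inter> fst c) \<times> (- {0 :: 'e})"
  then obtain p y where p: "p \<in> U" "p \<in> fst c" "y \<noteq> 0" "z = (snd c p, y)" by auto
  then have "slit_point c (snd c p) y \<in> fst (slit_chart A c)"
    "snd (slit_chart A c) (slit_point c (snd c p) y) = z"
    using slit_point[OF c, of "snd c p" y] by auto
  moreover have "fst (slit_point c (snd c p) y) \<in> U"
    using p cinv_chart[OF c] by (simp add: slit_point_def)
  ultimately show "z \<in> snd (slit_chart A c) ` ({w. fst w \<in> U} \<inter> fst (slit_chart A c))" by force
qed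

lemma slit_chart_overlap_image:
  assumes "c \<in> A"
  shows "snd (slit_chart A c) ` (fst (slit_chart A c) \<inter> fst (slit_chart A d)) =
    snd c ` (fst c \<inter> fst d) \<times> (- {0 :: 'e})"
proof -
  have "fst (slit_chart A c) \<inter> fst (slit_chart A d) = {w. fst w \<in> fst d} \<inter> fst (slit_chart A c)"
    by (auto simp: slit_chart_def)
  then show ?thesis using slit_chart_image[OF assms, of "fst d"] by (simp add: Int_commute)
qed

lemma slit_chart_range:
  assumes "c \<in> A"
  shows "snd (slit_chart A c) ` fst (slit_chart A c) = snd c ` fst c \<times> (- {0 :: 'e})"
  using slit_chart_overlap_image[OF assms, of c] by simp

lemma slit_transition:
  assumes c: "c \<in> A" and d: "d \<in> A" and z: "fst z \<in> snd c ` (fst c \<inter> fst d)" "snd z \<noteq> 0"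
  shows "(snd (slit_chart A d) \<circ> cinv (slit_chart A c)) z =
    ((snd d \<circ> cinv c) (fst z), frechet_derivative (snd d \<circ> cinv c) (at (fst z)) (snd z))"
proof -
  have x: "fst z \<in> snd c ` fst c" using z by auto
  have "cinv (slit_chart A c) z = slit_point c (fst z) (snd z)"
    using cinv_slit_chart[OF c x z(2)] by simp
  then show ?thesis
    using cinv_in[OF c z(1)] d chart_cinv[OF x] by (simp add: snd_slit_chart slit_point_def tvec_def)
qed

text \<open>A coordinate change of the bundle consists of the coordinate change of the base and its
  derivative applied to the fibre variable. The latter is smooth jointly in point and vector by
  \<open>smooth_on_frechet_derivative\<close>.\<close>

lemma smooth_slit_atlas: "smooth_atlas (slit A)"
  unfolding smooth_atlas_def slit_def ball_simps(9)
proof (intro conjI ballI)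
  fix c d assume c: "c \<in> A" and d: "d \<in> A"
  let ?O = "snd c ` (fst c \<inter> fst d)"
  have O: "open ?O" using c d by (rule open_overlap)
  have zero: "open (- {0} :: 'e set)" by auto
  then have OO: "open (?O \<times> (- {0 :: 'e}))" using O by (intro open_Times)
  then show "open (snd (slit_chart A c) ` (fst (slit_chart A c) \<inter> fst (slit_chart A d)))"
    unfolding slit_chart_overlap_image[OF c] .
  have 1: "smooth_on (?O \<times> (- {0::'e})) fst" "smooth_on (?O \<times> (- {0::'e})) snd"
    using OO smooth_on_fst[OF thick_open[OF OO] smooth_on_id[OF thick_open[OF OO]]]
      smooth_on_snd[OF thick_open[OF OO] smooth_on_id[OF thick_open[OF OO]]] by simp_all
  have "smooth_on (?O \<times> (- {0 :: 'e})) (\<lambda>z. ((snd d \<circ> cinv c) (fst z),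
      frechet_derivative (snd d \<circ> cinv c) (at (fst z)) (snd z)))"
  proof (rule smooth_on_Pair[OF thick_open[OF OO]])
    show "smooth_on (?O \<times> (- {0::'e})) (\<lambda>z. (snd d \<circ> cinv c) (fst z))"
      by (rule smooth_on_compose[OF smooth_transition[OF c d] O thick_open[OF OO] 1(1)]) auto
    show "smooth_on (?O \<times> (- {0 :: 'e})) (\<lambda>z. frechet_derivative (snd d \<circ> cinv c) (at (fst z)) (snd z))"
      by (rule smooth_on_frechet_derivative[OF smooth_transition[OF c d] O thick_open[OF OO] 1]) auto
  qed
  then show "smooth_on (snd (slit_chart A c) ` (fst (slit_chart A c) \<inter> fst (slit_chart A d)))
      (snd (slit_chart A d) \<circ> cinv (slit_chart A c))"
    unfolding slit_chart_overlap_image[OF c]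
  proof (rule smooth_on_cong[THEN iffD1, rotated])
    fix z assume "z \<in> ?O \<times> (- {0 :: 'e})"
    then show "((snd d \<circ> cinv c) (fst z), frechet_derivative (snd d \<circ> cinv c) (at (fst z)) (snd z)) =
        (snd (slit_chart A d) \<circ> cinv (slit_chart A c)) z"
      using slit_transition[OF c d, of z] by (simp add: mem_Times_iff)
  qed
qed (rule inj_on_slit_chart)

end

lemma (in atlas) openin_slit_preimage:
  assumes U: "openin top U"
  shows "openin (manifold_topology (slit A)) {w \<in> points (slit A). fst w \<in> U}"
proof -
  interpret slit: atlas "slit A" by unfold_locales (rule smooth_slit_atlas)
  show ?thesis
    unfolding slit.openin_iff
  proof (intro conjI ballI)
    fix d assume "d \<in> slit A"
    then obtain c where c: "c \<in> A" "d = slit_chart A c" by (auto simp: slit_def)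
    have "{w \<in> points (slit A). fst w \<in> U} \<inter> fst d = {w. fst w \<in> U} \<inter> fst (slit_chart A c)"
      using c slit_chart_points[OF c(1)] by auto
    moreover have "open (snd c ` (U \<inter> fst c) \<times> (- {0 :: 'e}))"
      using U c openin_iff by (intro open_Times) auto
    ultimately show "open (snd d ` ({w \<in> points (slit A). fst w \<in> U} \<inter> fst d))"
      using slit_chart_image[OF c(1), of U] c(2) by simp
  qed auto
qed

text \<open>Points over different base points are separated by preimages of open sets of the base.
  Points over the same base point lie in a common induced chart and are separated by their
  coordinates.\<close>

lemma (in hausdorff_atlas) Hausdorff_slit: "Hausdorff_space (manifold_topology (slit A))"
proof -
  interpret slit: atlas "slit A" by unfold_locales (rule smooth_slit_atlas)
  show ?thesis
    unfolding Hausdorff_space_def slit.topspace_top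
  proof (intro allI impI, elim conjE)
    fix w w' assume w: "w \<in> points (slit A)" and w': "w' \<in> points (slit A)" and ne: "w \<noteq> w'"
    show "\<exists>U V. openin slit.top U \<and> openin slit.top V \<and> w \<in> U \<and> w' \<in> V \<and> disjnt U V"
    proof (cases "fst w = fst w'")
      case False
      then obtain U V where "openin top U" "openin top V" "fst w \<in> U" "fst w' \<in> V" "disjnt U V"
        using Hausdorff w w' unfolding Hausdorff_space_def topspace_top in_slit_points by blast
      then show ?thesis
        using w w' by (intro exI[of _ "{w \<in> points (slit A). fst w \<in> U}"] exI[of _ "{w \<in> points (slit A). fst w \<in> V}"])
          (auto simp: openin_slit_preimage disjnt_def)
    next
      case True
      have "fst w \<in> points A" using w by (simp add: in_slit_points)
      then obtain c where c: "c \<in> A" "fst w \<in> fst c" unfolding points_def by blast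
      let ?c = "slit_chart A c"
      have wc: "w \<in> fst ?c" "w' \<in> fst ?c" using c w w' True by (auto simp: in_slit_chart_iff)
      then have "snd ?c w \<noteq> snd ?c w'" using ne inj_onD[OF inj_on_slit_chart[OF c(1)]] by blast
      then obtain S T where "open S" "open T" "snd ?c w \<in> S" "snd ?c w' \<in> T" "S \<inter> T = {}"
        using hausdorff[of "snd ?c w" "snd ?c w'"] by metis
      then show ?thesis
        using wc slit.openin_chart_preimage[OF slit_chart_in_slit[OF c(1)]]
        by (intro exI[of _ "{z \<in> fst ?c. snd ?c z \<in> S}"] exI[of _ "{z \<in> fst ?c. snd ?c z \<in> T}"])
          (auto simp: disjnt_def)
    qed
  qed
qed

text \<open>Kept apart from \<open>hausdorff_atlas\<close> on purpose: \<open>slit A\<close> is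
  again a Hausdorff atlas, and recording that fact for \<open>hausdorff_atlas\<close> itself would
  iterate the bundle construction without end.\<close>

locale tangent_bundle = hausdorff_atlas A for A :: "('p, 'e::euclidean_space) chart set"

sublocale tangent_bundle \<subseteq> slit: hausdorff_atlas "slit A"
  by unfold_locales (rule smooth_slit_atlas Hausdorff_slit)+

context tangent_bundle begin

abbreviation lift_chart :: "('p, 'e) chart \<Rightarrow> (('p, 'e) tvec, 'e \<times> 'e) chart"
  where "lift_chart c \<equiv> slit_chart A c"

end

context tangent_bundle begin

lemma open_overlap_times: "c \<in> A \<Longrightarrow> d \<in> A \<Longrightarrow> open (snd c ` (fst c \<inter> fst d) \<times> (- {0 :: 'e}))"
  by (intro open_Times open_overlap) auto

lemma slit_chart_mem:
  assumes "w \<in> points (slit A)" "c \<in> A" "fst w \<in> fst c"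
  shows "lift_chart c \<in> slit A" "w \<in> fst (lift_chart c)" "snd w c \<noteq> 0"
  using assms tangent_chart_nonzero[of "snd w" "fst w" c]
  by (auto simp: slit_chart_in_slit in_slit_chart_iff in_slit_points)

lemma slit_chart_cases:
  assumes "d \<in> slit A" "w \<in> fst d"
  obtains c where "c \<in> A" "d = lift_chart c" "fst w \<in> fst c" "w \<in> points (slit A)"
proof -
  obtain c where c: "c \<in> A" "d = lift_chart c" using assms(1) unfolding slit_def by blast
  then show thesis using that assms(2) slit_chart_points[of c w] by (simp add: in_slit_chart)
qed

lemma base_change_has_derivative:
  assumes "c \<in> A" "d \<in> A" "fst w \<in> fst c" "fst w \<in> fst d"
  shows "((\<lambda>z. (snd d \<circ> cinv c) (fst z)) has_derivative (\<lambda>\<zeta>. transition c d (fst w) (fst \<zeta>)))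
    (at (snd (lift_chart c) w))"
  using has_derivative_compose[OF bounded_linear_imp_has_derivative[OF bounded_linear_fst],
      where g = "snd d \<circ> cinv c" and g' = "transition c d (fst w)" and x = "snd (lift_chart c) w" and s = UNIV]
    transition_has_derivative[OF assms]
  by (simp only: snd_slit_chart fst_conv)

lemma slit_transition_fst:
  assumes w: "w \<in> points (slit A)" and c: "c \<in> A" "fst w \<in> fst c" and d: "d \<in> A" "fst w \<in> fst d"
  shows "fst (slit.transition (lift_chart c) (lift_chart d) w \<zeta>) = transition c d (fst w) (fst \<zeta>)"
proof -
  let ?F = "snd (lift_chart d) \<circ> cinv (lift_chart c)"
  have "((\<lambda>z. fst (?F z)) has_derivative (\<lambda>\<zeta>. fst (slit.transition (lift_chart c) (lift_chart d) w \<zeta>)))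
      (at (snd (lift_chart c) w))"
    by (rule has_derivative_fst[OF slit.transition_has_derivative])
      (use slit_chart_mem[OF w c] slit_chart_mem[OF w d] in auto)
  moreover have "((\<lambda>z. fst (?F z)) has_derivative (\<lambda>\<zeta>. transition c d (fst w) (fst \<zeta>)))
      (at (snd (lift_chart c) w))"
  proof (rule has_derivative_transform_within_open[OF base_change_has_derivative[OF c(1) d(1) c(2) d(2)]
        open_overlap_times[OF c(1) d(1)]])
    show "snd (lift_chart c) w \<in> snd c ` (fst c \<inter> fst d) \<times> (- {0 :: 'e})"
      using slit_chart_mem[OF w c] c d by (simp add: snd_slit_chart)
    show "(snd d \<circ> cinv c) (fst z) = fst (?F z)" if "z \<in> snd c ` (fst c \<inter> fst d) \<times> (- {0 :: 'e})" for z
      using slit_transition[OF c(1) d(1), of z] that by (simp add: mem_Times_iff)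
  qed
  ultimately show ?thesis by (rule fun_cong[OF has_derivative_unique])
qed

text \<open>On the line \<open>?y + t *\<^sub>R \<eta>\<close> inside one fibre the coordinate
  change is affine in \<open>t\<close>, with slope given by the transition of the base. The line may
  meet the zero section, so the comparison is made on the open set of those \<open>t\<close> where
  it does not.\<close>

lemma slit_transition_vertical:
  assumes w: "w \<in> points (slit A)" and c: "c \<in> A" "fst w \<in> fst c" and d: "d \<in> A" "fst w \<in> fst d"
  shows "slit.transition (lift_chart c) (lift_chart d) w (0, \<eta>) = (0, transition c d (fst w) \<eta>)"
proof -
  let ?F = "snd (lift_chart d) \<circ> cinv (lift_chart c)"
  let ?D = "slit.transition (lift_chart c) (lift_chart d) w"
  let ?x = "snd c (fst w)" and ?y = "snd w c"
  have l: "linear (transition c d (fst w))" using linear_transition c d by simp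
  have "(?F has_derivative ?D) (at ((\<lambda>t. (?x, ?y + t *\<^sub>R \<eta>)) 0))"
    using slit.transition_has_derivative[of "lift_chart c" "lift_chart d" w]
      slit_chart_mem[OF w c] slit_chart_mem[OF w d] by (simp add: snd_slit_chart)
  moreover have "((\<lambda>t. (?x, ?y + t *\<^sub>R \<eta>)) has_derivative (\<lambda>t. (0, t *\<^sub>R \<eta>))) (at 0)"
    by (auto intro!: derivative_eq_intros)
  ultimately have "((\<lambda>t. ?F (?x, ?y + t *\<^sub>R \<eta>)) has_derivative (\<lambda>t. ?D (0, t *\<^sub>R \<eta>))) (at 0)"
    by (rule has_derivative_compose[rotated])
  from has_derivative_snd[OF this]
  have "((\<lambda>t. snd (?F (?x, ?y + t *\<^sub>R \<eta>))) has_derivative (\<lambda>t. snd (?D (0, t *\<^sub>R \<eta>)))) (at 0)" .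
  moreover have "((\<lambda>t. snd (?F (?x, ?y + t *\<^sub>R \<eta>))) has_derivative
      (\<lambda>t. t *\<^sub>R transition c d (fst w) \<eta>)) (at 0)"
  proof (rule has_derivative_transform_within_open)
    show "((\<lambda>t. transition c d (fst w) ?y + t *\<^sub>R transition c d (fst w) \<eta>) has_derivative
        (\<lambda>t. t *\<^sub>R transition c d (fst w) \<eta>)) (at 0)"
      by (auto intro!: derivative_eq_intros)
    have "continuous_on UNIV (\<lambda>t. ?y + t *\<^sub>R \<eta>)" by (intro continuous_intros)
    then have "open ((\<lambda>t. ?y + t *\<^sub>R \<eta>) -` (- {0 :: 'e}))" by (intro open_vimage) auto
    then show "open {t. ?y + t *\<^sub>R \<eta> \<noteq> 0}" by (simp add: vimage_def)
    show "0 \<in> {t. ?y + t *\<^sub>R \<eta> \<noteq> 0}" using slit_chart_mem[OF w c] by simp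
    fix t assume "t \<in> {t. ?y + t *\<^sub>R \<eta> \<noteq> 0}"
    then have "snd (?F (?x, ?y + t *\<^sub>R \<eta>)) = transition c d (fst w) (?y + t *\<^sub>R \<eta>)"
      using slit_transition[OF c(1) d(1), of "(?x, ?y + t *\<^sub>R \<eta>)"] c d by simp
    then show "transition c d (fst w) ?y + t *\<^sub>R transition c d (fst w) \<eta> = snd (?F (?x, ?y + t *\<^sub>R \<eta>))"
      by (simp add: linear_add[OF l] linear_cmul[OF l])
  qed
  ultimately have "(\<lambda>t. snd (?D (0, t *\<^sub>R \<eta>))) = (\<lambda>t. t *\<^sub>R transition c d (fst w) \<eta>)"
    by (rule has_derivative_unique)
  from fun_cong[OF this, of 1] have "snd (?D (0, \<eta>)) = transition c d (fst w) \<eta>" by simp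
  moreover have "fst (?D (0, \<eta>)) = 0"
    using slit_transition_fst[OF w c d, of "(0, \<eta>)"] linear_0[OF l] by simp
  ultimately show ?thesis by (simp add: prod_eq_iff)
qed

lemma slit_chart_at:
  assumes "w \<in> points (slit A)"
  obtains c where "c \<in> A" "chart_at (slit A) w = lift_chart c" "fst w \<in> fst c"
  using slit_chart_cases[OF slit.chart_at[OF assms]] by metis

text \<open>The condition on \<open>chart_at\<close> reflects the chart that
  \<open>differential\<close> selects. Writing the outcome as a \<open>tvec\<close> makes it a
  tangent vector of the base for every family \<open>\<xi>\<close>.\<close>

lemma dproj_eq_tvec:
  assumes w: "w \<in> points (slit A)" and c: "c \<in> A" "fst w \<in> fst c" and at: "chart_at (slit A) w = lift_chart c"
  shows "dproj A w \<xi> = tvec c (fst w) (fst (\<xi> (lift_chart c)))"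
proof
  fix d
  have "frechet_derivative (snd d \<circ> fst \<circ> cinv (lift_chart c)) (at (snd (lift_chart c) w)) (\<xi> (lift_chart c)) =
      transition c d (fst w) (fst (\<xi> (lift_chart c)))" if d: "d \<in> A" "fst w \<in> fst d"
  proof -
    have "((snd d \<circ> fst \<circ> cinv (lift_chart c)) has_derivative (\<lambda>\<zeta>. transition c d (fst w) (fst \<zeta>)))
      (at (snd (lift_chart c) w))"
    proof (rule has_derivative_transform_within_open[OF base_change_has_derivative[OF c(1) d(1) c(2) d(2)]
          open_overlap_times[OF c(1) d(1)]])
      show "snd (lift_chart c) w \<in> snd c ` (fst c \<inter> fst d) \<times> (- {0 :: 'e})"
        using slit_chart_mem[OF w c] c d by (simp add: snd_slit_chart)
      show "(snd d \<circ> cinv c) (fst z) = (snd d \<circ> fst \<circ> cinv (lift_chart c)) z"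
        if "z \<in> snd c ` (fst c \<inter> fst d) \<times> (- {0 :: 'e})" for z
      proof -
        have "fst z \<in> snd c ` fst c" "snd z \<noteq> 0" using that by (auto simp: mem_Times_iff)
        then show ?thesis using cinv_slit_chart[OF c(1), of "fst z" "snd z"] by (simp add: slit_point_def)
      qed
    qed
    from fun_cong[OF frechet_derivative_at[OF this]] show ?thesis by simp
  qed
  then show "dproj A w \<xi> d = tvec c (fst w) (fst (\<xi> (lift_chart c))) d"
    by (simp add: dproj_def differential_def tvec_def at)
qed

lemma dproj_tangent:
  assumes "w \<in> points (slit A)" shows "dproj A w \<xi> \<in> tangent_space A (fst w)"
proof -
  obtain c where c: "c \<in> A" "chart_at (slit A) w = lift_chart c" "fst w \<in> fst c"
    using slit_chart_at[OF assms] .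
  show ?thesis unfolding dproj_eq_tvec[OF assms c(1,3,2)] by (rule tvec_tangent[OF c(1,3)])
qed

text \<open>The transformation law of \<open>\<xi>\<close> moves the formula from the chart selected
  by \<open>chart_at\<close> to an arbitrary one; the base component of a bundle transition involves
  only the base component of \<open>\<xi>\<close>.\<close>

lemma dproj_chart:
  assumes w: "w \<in> points (slit A)" and d: "d \<in> A" "fst w \<in> fst d" and \<xi>: "\<xi> \<in> tangent_space (slit A) w"
  shows "dproj A w \<xi> d = fst (\<xi> (lift_chart d))"
proof -
  obtain c where c: "c \<in> A" "chart_at (slit A) w = lift_chart c" "fst w \<in> fst c"
    using slit_chart_at[OF w] .
  have "\<xi> (lift_chart d) = slit.transition (lift_chart c) (lift_chart d) w (\<xi> (lift_chart c))"
    using slit.tangent_transition[OF \<xi>] slit_chart_mem[OF w c(1,3)] slit_chart_mem[OF w d] by blast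
  then have "fst (\<xi> (lift_chart d)) = transition c d (fst w) (fst (\<xi> (lift_chart c)))"
    using slit_transition_fst[OF w c(1,3) d] by simp
  then show ?thesis unfolding dproj_eq_tvec[OF w c(1,3,2)] using d by (simp add: tvec_def)
qed

lemma vlift_at_chart:
  assumes "w \<in> points (slit A)" "c \<in> A" "fst w \<in> fst c"
  shows "vlift_at A w u (lift_chart c) = (0, u c)"
proof -
  have "((\<lambda>t. (snd c (fst w), snd w c + t *\<^sub>R u c)) has_vector_derivative (0, u c)) (at 0)"
    by (auto intro!: derivative_eq_intros simp: has_vector_derivative_def)
  moreover have "snd (lift_chart c) \<circ> (\<lambda>t. (fst w, snd w + t *\<^sub>R u)) =
      (\<lambda>t. (snd c (fst w), snd w c + t *\<^sub>R u c))"
    by (simp add: fun_eq_iff snd_slit_chart scaleR_fun_def)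
  ultimately show ?thesis
    using slit_chart_mem[OF assms] vector_derivative_at by (simp add: vlift_at_def velocity_def)
qed

lemma vlift_at_outside:
  assumes "w \<notin> points (slit A)" shows "vlift_at A w u = 0"
proof
  fix d
  have "\<not> (d \<in> slit A \<and> w \<in> fst d)" using assms unfolding points_def by blast
  then show "vlift_at A w u d = 0 d" by (auto simp: vlift_at_def velocity_def)
qed

lemma vlift_at_tangent:
  assumes w: "w \<in> points (slit A)" and u: "u \<in> tangent_space A (fst w)"
  shows "vlift_at A w u \<in> tangent_space (slit A) w"
proof (rule slit.tangent_spaceI')
  fix d assume "d \<notin> slit A \<or> w \<notin> fst d"
  then show "vlift_at A w u d = 0" by (auto simp: vlift_at_def velocity_def)
next
  fix c d assume c: "c \<in> slit A" "w \<in> fst c" and d: "d \<in> slit A" "w \<in> fst d"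
  obtain c' where c': "c' \<in> A" "c = lift_chart c'" "fst w \<in> fst c'" using slit_chart_cases[OF c] .
  obtain d' where d': "d' \<in> A" "d = lift_chart d'" "fst w \<in> fst d'" using slit_chart_cases[OF d] .
  have "u d' = transition c' d' (fst w) (u c')"
    using tangent_transition[OF u] c' d' by blast
  then show "vlift_at A w u d = slit.transition c d w (vlift_at A w u c)"
    unfolding c'(2) d'(2) vlift_at_chart[OF w c'(1,3)] vlift_at_chart[OF w d'(1,3)]
      slit_transition_vertical[OF w c'(1,3) d'(1,3)] by simp
qed

lemma slit_tangent_eqI:
  assumes "\<xi> \<in> tangent_space (slit A) w" "\<eta> \<in> tangent_space (slit A) w" "w \<in> points (slit A)"
    "c \<in> A" "fst w \<in> fst c" "\<xi> (lift_chart c) = \<eta> (lift_chart c)"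
  shows "\<xi> = \<eta>"
  using slit.tangent_eqI[OF assms(1,2)] slit_chart_mem[OF assms(3-5)] assms(6) by blast

lemma vertical_iff:
  assumes w: "w \<in> points (slit A)" and c: "c \<in> A" "fst w \<in> fst c"
  shows "\<xi> \<in> vertical A w \<longleftrightarrow> \<xi> \<in> tangent_space (slit A) w \<and> fst (\<xi> (lift_chart c)) = 0"
proof -
  have "dproj A w \<xi> = 0 \<longleftrightarrow> fst (\<xi> (lift_chart c)) = 0" if "\<xi> \<in> tangent_space (slit A) w"
    using dproj_chart[OF w c that] tangent_eqI[OF dproj_tangent[OF w] subspace_0[OF subspace_tangent_space] c, of \<xi>]
    by auto
  then show ?thesis unfolding vertical_def by blast
qed

lemma vert_endo_tangent: "w \<in> points (slit A) \<Longrightarrow> vert_endo A X w \<in> tangent_space (slit A) w"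
  unfolding vert_endo_def by (rule vlift_at_tangent[OF _ dproj_tangent])

lemma vert_endo_chart:
  assumes X: "X w \<in> tangent_space (slit A) w" and w: "w \<in> points (slit A)" and c: "c \<in> A" "fst w \<in> fst c"
  shows "vert_endo A X w (lift_chart c) = (0, fst (X w (lift_chart c)))"
  unfolding vert_endo_def vlift_at_chart[OF w c] dproj_chart[OF w c X] ..

lemma cinv_slit_in:
  assumes "c \<in> A" "z \<in> snd (lift_chart c) ` fst (lift_chart c)"
  shows "cinv (lift_chart c) z \<in> points (slit A)" "fst (cinv (lift_chart c) z) \<in> fst c"
    "(snd c (fst (cinv (lift_chart c) z)), snd (cinv (lift_chart c) z) c) = z"
proof -
  have "cinv (lift_chart c) z \<in> fst (lift_chart c)" by (rule cinv_in_chart[OF assms(2)])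
  then show "cinv (lift_chart c) z \<in> points (slit A)" "fst (cinv (lift_chart c) z) \<in> fst c"
    using slit_chart_points[OF assms(1)] by (auto simp: in_slit_chart)
  show "(snd c (fst (cinv (lift_chart c) z)), snd (cinv (lift_chart c) z) c) = z"
    using chart_cinv[OF assms(2)] by (simp add: snd_slit_chart)
qed

lemma vsectionsI:
  assumes "\<sigma> \<in> slit.gfields"
    "\<And>c w. c \<in> A \<Longrightarrow> fst w \<in> fst c \<Longrightarrow> w \<in> points (slit A) \<Longrightarrow> fst (\<sigma> w (lift_chart c)) = 0"
  shows "\<sigma> \<in> vsections A"
  unfolding vsections_def
proof (intro CollectI conjI ballI assms(1))
  fix w assume w: "w \<in> points (slit A)"
  then have "fst w \<in> points A" by (simp add: in_slit_points)
  then obtain c where c: "c \<in> A" "fst w \<in> fst c" unfolding points_def by blast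
  show "\<sigma> w \<in> vertical A w"
    unfolding vertical_iff[OF w c] using slit.field_tangent[OF assms(1) w] assms(2)[OF c w] by blast
qed

lemma vsections_gfields: "\<sigma> \<in> vsections A \<Longrightarrow> \<sigma> \<in> slit.gfields"
  by (simp add: vsections_def)

lemma vsections_chart:
  assumes "\<sigma> \<in> vsections A" "w \<in> points (slit A)" "c \<in> A" "fst w \<in> fst c"
  shows "fst (\<sigma> w (lift_chart c)) = 0"
  using assms(1,2) vertical_iff[OF assms(2-4), of "\<sigma> w"] unfolding vsections_def by blast

lemma vsections_add: "\<sigma> \<in> vsections A \<Longrightarrow> \<tau> \<in> vsections A \<Longrightarrow> \<sigma> + \<tau> \<in> vsections A"
  by (rule vsectionsI) (simp_all add: slit.gfields_add vsections_gfields vsections_chart)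

lemma vsections_scale:
  "smooth_fun (slit A) f \<Longrightarrow> \<sigma> \<in> vsections A \<Longrightarrow> (\<lambda>w. f w *\<^sub>R \<sigma> w) \<in> vsections A"
  by (rule vsectionsI[OF slit.gfields_scale[OF _ vsections_gfields]])
    (simp_all add: vsections_chart scaleR_fun_def)

lemma vsections_zero: "0 \<in> vsections A"
  by (rule vsectionsI) (simp_all add: slit.gfields_zero)

lemma ext_field_vsections:
  assumes c: "c \<in> A" and f: "slit.ext_field (lift_chart c) \<beta> g \<in> slit.gfields" and g: "\<And>z. fst (g z) = 0"
  shows "slit.ext_field (lift_chart c) \<beta> g \<in> vsections A"
  unfolding vsections_def
proof (intro CollectI conjI ballI f)
  fix w assume w: "w \<in> points (slit A)"
  have t: "slit.ext_field (lift_chart c) \<beta> g w \<in> tangent_space (slit A) w" using slit.field_tangent[OF f w] .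
  show "slit.ext_field (lift_chart c) \<beta> g w \<in> vertical A w"
  proof (cases "fst w \<in> fst c")
    case True
    then show ?thesis
      using vertical_iff[OF w c True] t g slit.ext_field_chart[of "lift_chart c" w] slit_chart_mem[OF w c True]
      by simp
  next
    case False
    have "fst w \<in> points A" using w by (simp add: in_slit_points)
    then obtain d where d: "d \<in> A" "fst w \<in> fst d" unfolding points_def by blast
    have "slit.ext_field (lift_chart c) \<beta> g w = 0"
      using False by (simp add: slit.ext_field_def in_slit_chart)
    then show ?thesis unfolding vertical_iff[OF w d] using t by simp
  qed
qed

lemma vert_endo_vsections:
  assumes X: "X \<in> slit.gfields" shows "vert_endo A X \<in> vsections A"
proof (rule vsectionsI)
  show "vert_endo A X \<in> slit.gfields"
    unfolding slit.gfields_iff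
  proof (intro conjI ballI allI impI)
    show "vert_endo A X w \<in> tangent_space (slit A) w" if "w \<in> points (slit A)" for w
      by (rule vert_endo_tangent[OF that])
    show "vert_endo A X w = 0" if "w \<notin> points (slit A)" for w
      using vlift_at_outside[OF that] by (simp add: vert_endo_def)
    fix d assume "d \<in> slit A"
    then obtain c where c: "c \<in> A" "d = lift_chart c" unfolding slit_def by blast
    let ?U = "snd (lift_chart c) ` fst (lift_chart c)"
    have t: "thick ?U" using slit.thick_chart_image slit_chart_in_slit[OF c(1)] by blast
    have "smooth_on ?U (\<lambda>z. X (cinv (lift_chart c) z) (lift_chart c))"
      using slit.gfields_smooth[OF X slit_chart_in_slit[OF c(1)]] .
    then have "smooth_on ?U (\<lambda>z. (0, fst (X (cinv (lift_chart c) z) (lift_chart c))))"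
      by (intro smooth_on_Pair[OF t] smooth_on_const[OF t] smooth_on_fst[OF t])
    then show "smooth_on (snd d ` fst d) (\<lambda>z. vert_endo A X (cinv d z) d)"
      unfolding c(2)
    proof (rule smooth_on_cong[THEN iffD1, rotated])
      fix z assume "z \<in> ?U"
      then show "(0, fst (X (cinv (lift_chart c) z) (lift_chart c))) =
          vert_endo A X (cinv (lift_chart c) z) (lift_chart c)"
        using vert_endo_chart[of X "cinv (lift_chart c) z" c] cinv_slit_in[OF c(1), of z] c(1)
          slit.field_tangent[OF X] by simp
    qed
  qed
  show "fst (vert_endo A X w (lift_chart c)) = 0" if "c \<in> A" "fst w \<in> fst c" "w \<in> points (slit A)" for c w
    using vert_endo_chart[of X w c] slit.field_tangent[OF X that(3)] that by simp
qed

end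

section \<open>Sprays and horizontal vectors\<close>

lemma (in tangent_bundle) canonical_field_chart:
  "w \<in> points (slit A) \<Longrightarrow> c \<in> A \<Longrightarrow> fst w \<in> fst c \<Longrightarrow> canonical_field A w (lift_chart c) = (0, snd w c)"
  by (simp add: canonical_field_def vlift_at_chart)

lemma (in tangent_bundle) frechet_derivative_slit_cong:
  assumes c: "c \<in> A" and w: "w \<in> points (slit A)" "fst w \<in> fst c"
    and f: "(f has_derivative f') (at (snd (lift_chart c) w))"
    and eq: "\<And>z. z \<in> points (slit A) \<Longrightarrow> fst z \<in> fst c \<Longrightarrow> g z = f (snd c (fst z), snd z c)"
  shows "frechet_derivative (\<lambda>z. g (cinv (lift_chart c) z)) (at (snd (lift_chart c) w)) = f'"
proof -
  have "((\<lambda>z. g (cinv (lift_chart c) z)) has_derivative f') (at (snd (lift_chart c) w))"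
  proof (rule has_derivative_transform_within_open[OF f])
    show "open (snd (lift_chart c) ` fst (lift_chart c))"
      by (rule slit.open_chart_image[OF slit_chart_in_slit[OF c]])
    show "snd (lift_chart c) w \<in> snd (lift_chart c) ` fst (lift_chart c)"
      using slit_chart_mem[OF w(1) c w(2)] by simp
    show "f z = g (cinv (lift_chart c) z)" if "z \<in> snd (lift_chart c) ` fst (lift_chart c)" for z
      using eq[OF cinv_slit_in(1,2)[OF c that]] cinv_slit_in(3)[OF c that] by simp
  qed
  from frechet_derivative_at[OF this] show ?thesis by simp
qed

locale spray_bundle = tangent_bundle A for A :: "('p, 'e::euclidean_space) chart set" +
  fixes S :: "('p, 'e) tvec \<Rightarrow> ('p, 'e) ttvec"
  assumes spray: "spray A S"
begin

lemma spray_gfields: "S \<in> slit.gfields"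
  using spray by (simp add: spray_def)

lemma spray_chart_fst:
  assumes "w \<in> points (slit A)" "c \<in> A" "fst w \<in> fst c"
  shows "fst (S w (lift_chart c)) = snd w c"
proof -
  have "vert_endo A S w (lift_chart c) = canonical_field A w (lift_chart c)"
    using spray by (simp add: spray_def)
  then show ?thesis
    using vert_endo_chart[of S w c] slit.field_tangent[OF spray_gfields assms(1)] assms
    by (simp add: canonical_field_chart)
qed

text \<open>In a chart a spray is \<open>(y, s(x, y))\<close>, and this is the fibre derivative of
  \<open>s\<close> at \<open>z\<close> in the direction \<open>a\<close>. In the usual notation
  \<open>s = -2 G\<close>, so it is \<open>-2 N a\<close> with the connection coefficients
  \<open>N\<close> obtained from \<open>G\<close> by differentiating in \<open>y\<close>.\<close>

definition spray_deriv :: "('p, 'e) chart \<Rightarrow> 'e \<times> 'e \<Rightarrow> 'e \<Rightarrow> 'e"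
  where "spray_deriv c z a = frechet_derivative (\<lambda>z. snd (S (cinv (lift_chart c) z) (lift_chart c))) (at z) (0, a)"

context
  fixes w c assumes w: "w \<in> points (slit A)" and c: "c \<in> A" "fst w \<in> fst c"
begin

abbreviation (input) deriv_at :: "(('p, 'e) tvec \<Rightarrow> ('p, 'e) ttvec) \<Rightarrow> 'e \<times> 'e \<Rightarrow> 'e \<times> 'e"
  where "deriv_at X \<equiv> frechet_derivative (\<lambda>z. X (cinv (lift_chart c) z) (lift_chart c)) (at (snd (lift_chart c) w))"

lemma deriv_at: "X \<in> slit.gfields \<Longrightarrow> ((\<lambda>z. X (cinv (lift_chart c) z) (lift_chart c)) has_derivative deriv_at X)
    (at (snd (lift_chart c) w))"
  using slit.field_has_derivative slit_chart_mem[OF w c] by blast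

lemma spray_deriv_at_fst: "fst (deriv_at S v) = snd v"
proof -
  have "frechet_derivative (\<lambda>z. fst (S (cinv (lift_chart c) z) (lift_chart c))) (at (snd (lift_chart c) w)) = snd"
    by (rule frechet_derivative_slit_cong[OF c(1) w c(2),
          of snd snd "\<lambda>z. fst (S z (lift_chart c))"])
      (use c in \<open>auto simp: spray_chart_fst intro: bounded_linear_imp_has_derivative bounded_linear_snd\<close>)
  then show ?thesis
    using fun_cong[OF frechet_derivative_at[OF has_derivative_fst[OF deriv_at[OF spray_gfields]]], of v] by simp
qed

lemma spray_deriv_at_snd: "snd (deriv_at S (0, a)) = spray_deriv c (snd (lift_chart c) w) a"
  using fun_cong[OF frechet_derivative_at[OF has_derivative_snd[OF deriv_at[OF spray_gfields]]], of "(0, a)"]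
  by (simp add: spray_deriv_def)

lemma vert_endo_deriv_at:
  assumes X: "X \<in> slit.gfields"
  shows "deriv_at (vert_endo A X) v = (0, fst (deriv_at X v))"
proof -
  have "frechet_derivative (\<lambda>z. vert_endo A X (cinv (lift_chart c) z) (lift_chart c)) (at (snd (lift_chart c) w)) =
      (\<lambda>v. (0, fst (deriv_at X v)))"
  proof (rule frechet_derivative_slit_cong[OF c(1) w c(2),
        of "\<lambda>z. (0, fst (X (cinv (lift_chart c) z) (lift_chart c)))" _ "\<lambda>z. vert_endo A X z (lift_chart c)"])
    show "((\<lambda>z. (0, fst (X (cinv (lift_chart c) z) (lift_chart c)))) has_derivative
        (\<lambda>v. (0, fst (deriv_at X v)))) (at (snd (lift_chart c) w))"
      by (rule has_derivative_Pair[OF has_derivative_const has_derivative_fst[OF deriv_at[OF X]]])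
    show "vert_endo A X z (lift_chart c) =
        (0, fst (X (cinv (lift_chart c) (snd c (fst z), snd z c)) (lift_chart c)))"
      if z: "z \<in> points (slit A)" "fst z \<in> fst c" for z
      using vert_endo_chart[of X z c] slit.field_tangent[OF X z(1)] z c
        slit.cinv_chart[of "lift_chart c" z] slit_chart_mem[OF z(1) c(1) z(2)]
      by (simp add: snd_slit_chart)
  qed
  then show ?thesis by simp
qed

text \<open>The derivative of \<open>X\<close> along \<open>S\<close> occurs in
  \<open>J [S, X]\<close> and in \<open>[S, J X]\<close> with the same vertical value and cancels.
  What remains comes from differentiating \<open>S\<close>, whose first component is the fibre
  variable, and depends on \<open>X w\<close> only.\<close>

lemma canonical_connection_chart:
  assumes X: "X \<in> slit.gfields"
  shows "canonical_connection A S X w (lift_chart c) =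
    (fst (X w (lift_chart c)),
     spray_deriv c (snd (lift_chart c) w) (fst (X w (lift_chart c))) - snd (X w (lift_chart c)))"
proof -
  let ?a = "fst (X w (lift_chart c))" and ?b = "snd (X w (lift_chart c))"
  note mem = slit_chart_mem[OF w c]
  have SX: "lie_bracket (slit A) S X w (lift_chart c) = deriv_at X (S w (lift_chart c)) - deriv_at S (?a, ?b)"
    by (simp add: slit.lie_bracket_chart[OF mem(1,2)])
  have JX: "vert_endo A X w (lift_chart c) = (0, ?a)"
    by (rule vert_endo_chart[of X w c, OF slit.field_tangent[OF X w] w c])
  have SJX: "lie_bracket (slit A) S (vert_endo A X) w (lift_chart c) =
      (0, fst (deriv_at X (S w (lift_chart c)))) - deriv_at S (0, ?a)"
    by (simp add: slit.lie_bracket_chart[OF mem(1,2)] JX vert_endo_deriv_at[OF X])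
  have "vert_endo A (lie_bracket (slit A) S X) w (lift_chart c) =
      (0, fst (lie_bracket (slit A) S X w (lift_chart c)))"
    using vert_endo_chart[of "lie_bracket (slit A) S X" w c] slit.lie_bracket_tangent[OF spray_gfields X] w c
    by blast
  then show ?thesis
    unfolding canonical_connection_def
    by (simp add: SX SJX prod_eq_iff spray_deriv_at_fst spray_deriv_at_snd)
qed

text \<open>This is Euler's relation: the second component of \<open>[C, S] = S\<close> expresses
  homogeneity of degree 2 of the spray coefficient in the fibre variable.\<close>

lemma spray_homogeneous: "spray_deriv c (snd (lift_chart c) w) (snd w c) = 2 *\<^sub>R snd (S w (lift_chart c))"
proof -
  note mem = slit_chart_mem[OF w c]
  have C: "deriv_at (canonical_field A) v = (0, snd v)" for v
  proof -
    have "frechet_derivative (\<lambda>z. canonical_field A (cinv (lift_chart c) z) (lift_chart c))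
        (at (snd (lift_chart c) w)) = (\<lambda>v. (0, snd v))"
      by (rule frechet_derivative_slit_cong[OF c(1) w c(2),
            of "\<lambda>z. (0, snd z)" _ "\<lambda>z. canonical_field A z (lift_chart c)"])
        (use c in \<open>auto simp: canonical_field_chart intro!: derivative_eq_intros\<close>)
    then show ?thesis by simp
  qed
  have "lie_bracket (slit A) (canonical_field A) S w (lift_chart c) = S w (lift_chart c)"
    using spray by (simp add: spray_def)
  then have "deriv_at S (0, snd w c) - (0, snd (S w (lift_chart c))) = S w (lift_chart c)"
    by (simp add: slit.lie_bracket_chart[OF mem(1,2)] C canonical_field_chart[OF w c])
  from arg_cong[where f = snd, OF this]
  have "snd (deriv_at S (0, snd w c)) - snd (S w (lift_chart c)) = snd (S w (lift_chart c))" by simp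
  then show ?thesis by (simp add: spray_deriv_at_snd scaleR_2 algebra_simps)
qed

text \<open>By \<open>canonical_connection_chart\<close> the fixed point equation at
  \<open>w\<close> involves only \<open>X w\<close>, so the choice of the extending field in
  \<open>horizontal\<close> has no influence. With \<open>a\<close> and \<open>b\<close> the two
  components of \<open>\<xi>\<close>, it is the familiar \<open>b = - N a\<close>.\<close>

lemma horizontal_iff:
  "\<xi> \<in> horizontal A S w \<longleftrightarrow> \<xi> \<in> tangent_space (slit A) w \<and>
    2 *\<^sub>R snd (\<xi> (lift_chart c)) = spray_deriv c (snd (lift_chart c) w) (fst (\<xi> (lift_chart c)))"
proof -
  note mem = slit_chart_mem[OF w c]
  have eq: "canonical_connection A S X w = X w \<longleftrightarrow>
      2 *\<^sub>R snd (X w (lift_chart c)) = spray_deriv c (snd (lift_chart c) w) (fst (X w (lift_chart c)))"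
    if X: "X \<in> slit.gfields" for X
  proof -
    have "canonical_connection A S X w \<in> tangent_space (slit A) w"
      unfolding canonical_connection_def
      by (subst minus_apply, intro subspace_diff[OF slit.subspace_tangent_space] vert_endo_tangent[OF w]
          slit.lie_bracket_tangent spray_gfields vsections_gfields vert_endo_vsections X)
    then have "canonical_connection A S X w = X w \<longleftrightarrow>
        canonical_connection A S X w (lift_chart c) = X w (lift_chart c)"
      using slit_tangent_eqI[OF _ slit.field_tangent[OF X w] w c] by (intro iffI) simp_all
    also have "\<dots> \<longleftrightarrow> 2 *\<^sub>R snd (X w (lift_chart c)) =
        spray_deriv c (snd (lift_chart c) w) (fst (X w (lift_chart c)))"
      unfolding canonical_connection_chart[OF X] by (auto simp: prod_eq_iff scaleR_2 algebra_simps)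
    finally show ?thesis .
  qed
  show ?thesis
  proof
    assume "\<xi> \<in> horizontal A S w"
    then obtain X where X: "X \<in> slit.gfields" "canonical_connection A S X w = X w" "\<xi> = X w"
      unfolding horizontal_def by blast
    then show "\<xi> \<in> tangent_space (slit A) w \<and>
        2 *\<^sub>R snd (\<xi> (lift_chart c)) = spray_deriv c (snd (lift_chart c) w) (fst (\<xi> (lift_chart c)))"
      using eq[OF X(1)] slit.field_tangent[OF X(1) w] by simp
  next
    assume \<xi>: "\<xi> \<in> tangent_space (slit A) w \<and>
        2 *\<^sub>R snd (\<xi> (lift_chart c)) = spray_deriv c (snd (lift_chart c) w) (fst (\<xi> (lift_chart c)))"
    then have "\<xi> \<in> tangent_space (slit A) w" by blast
    then obtain \<beta> where "slit.ext_field (lift_chart c) \<beta> (\<lambda>z. \<xi> (lift_chart c)) w = \<xi>"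
      "slit.ext_field (lift_chart c) \<beta> (\<lambda>z. \<xi> (lift_chart c)) \<in> slit.gfields"
      using slit.extend_tangent[OF mem(1,2), of \<xi>] by blast
    then show "\<xi> \<in> horizontal A S w"
      using eq[of "slit.ext_field (lift_chart c) \<beta> (\<lambda>z. \<xi> (lift_chart c))"] \<xi>
      unfolding horizontal_def mem_Collect_eq by metis
  qed
qed

end

lemma slit_point_chart:
  assumes "w \<in> points (slit A)" obtains c where "c \<in> A" "fst w \<in> fst c"
  using assms unfolding in_slit_points points_def[of A] by blast

text \<open>In a chart, horizontality of \<open>S w\<close> is exactly Euler's relation
  \<open>spray_homogeneous\<close>.\<close>

lemma spray_horizontal:
  assumes w: "w \<in> points (slit A)"
  shows "S w \<in> horizontal A S w" "dproj A w (S w) = snd w"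
proof -
  obtain c where c: "c \<in> A" "fst w \<in> fst c" using slit_point_chart[OF w] .
  have t: "S w \<in> tangent_space (slit A) w" using slit.field_tangent[OF spray_gfields w] .
  show "S w \<in> horizontal A S w"
    unfolding horizontal_iff[OF w c] spray_chart_fst[OF w c] spray_homogeneous[OF w c] using t by simp
  show "dproj A w (S w) = snd w"
    by (rule tangent_eqI[OF dproj_tangent[OF w] _ c])
      (use w in \<open>simp_all add: in_slit_points dproj_chart[OF w c t] spray_chart_fst[OF w c]\<close>)
qed

lemma horizontal_unique:
  assumes w: "w \<in> points (slit A)" and "\<xi> \<in> horizontal A S w" "\<eta> \<in> horizontal A S w" "dproj A w \<xi> = dproj A w \<eta>"
  shows "\<xi> = \<eta>"
proof -
  obtain c where c: "c \<in> A" "fst w \<in> fst c" using slit_point_chart[OF w] .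
  note \<xi> = assms(2)[unfolded horizontal_iff[OF w c]] and \<eta> = assms(3)[unfolded horizontal_iff[OF w c]]
  have "fst (\<xi> (lift_chart c)) = fst (\<eta> (lift_chart c))"
    using dproj_chart[OF w c] \<xi> \<eta> assms(4) by metis
  then have "\<xi> (lift_chart c) = \<eta> (lift_chart c)"
    using \<xi> \<eta> by (metis (no_types) prod_eq_iff scaleR_cancel_left zero_neq_numeral)
  then show ?thesis using slit_tangent_eqI[OF _ _ w c] \<xi> \<eta> by blast
qed

lemma hlift_eq:
  assumes w: "w \<in> points (slit A)" and \<xi>: "\<xi> \<in> horizontal A S w"
  shows "hlift A S w (dproj A w \<xi>) = \<xi>"
  unfolding hlift_def by (rule the_equality) (use assms horizontal_unique[OF w] in auto)

lemma horizontal_exists: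
  assumes w: "w \<in> points (slit A)" and u: "u \<in> tangent_space A (fst w)"
  obtains \<xi> where "\<xi> \<in> horizontal A S w" "dproj A w \<xi> = u"
proof -
  obtain c where c: "c \<in> A" "fst w \<in> fst c" using slit_point_chart[OF w] .
  note mem = slit_chart_mem[OF w c]
  define \<xi> where "\<xi> = slit.tvec (lift_chart c) w (u c, (1/2) *\<^sub>R spray_deriv c (snd (lift_chart c) w) (u c))"
  have t: "\<xi> \<in> tangent_space (slit A) w" unfolding \<xi>_def by (rule slit.tvec_tangent[OF mem(1,2)])
  have \<xi>c: "\<xi> (lift_chart c) = (u c, (1/2) *\<^sub>R spray_deriv c (snd (lift_chart c) w) (u c))"
    unfolding \<xi>_def by (rule slit.tvec_chart[OF mem(1,2)])
  have "\<xi> \<in> horizontal A S w" unfolding horizontal_iff[OF w c] \<xi>c using t by simp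
  moreover have "dproj A w \<xi> = u"
    by (rule tangent_eqI[OF dproj_tangent[OF w] u c]) (simp add: dproj_chart[OF w c t] \<xi>c)
  ultimately show thesis by (rule that)
qed

end

section \<open>Connections on the vertical bundle\<close>

lemma sum_fun_apply: "(\<Sum>i\<in>I. f i) x = (\<Sum>i\<in>I. f i x)"
  for f :: "'i \<Rightarrow> 'a \<Rightarrow> 'b::comm_monoid_add"
  by (induction I rule: infinite_finite_induct) auto

lemma (in atlas) cutoff_support:
  assumes c: "c \<in> A" and \<beta>: "cutoff c (snd c ` (U \<inter> fst c)) \<beta>" and q: "\<beta> q \<noteq> 0"
  shows "q \<in> U" "q \<in> fst c"
proof -
  obtain K where K: "K \<subseteq> snd c ` (U \<inter> fst c)" "\<forall>q. \<beta> q \<noteq> 0 \<longrightarrow> q \<in> fst c \<and> snd c q \<in> K"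
    using \<beta> unfolding cutoff_def by blast
  then show "q \<in> fst c" using q by blast
  moreover obtain p where "p \<in> U" "p \<in> fst c" "snd c q = snd c p" using K q by blast
  ultimately show "q \<in> U" using inj_onD[OF inj_on_chart[OF c], of q p] by simp
qed

text \<open>The cutoff appears twice because one factor makes the coefficient functions global and
  the other the coordinate fields. The local expansion of \<open>X\<close> thereby becomes an
  identity of global fields, to which the axioms of a connection apply.\<close>

lemma (in atlas) field_expansion:
  assumes c: "c \<in> A" and \<beta>: "cutoff c T \<beta>" and X: "X \<in> gfields"
  shows "(\<lambda>p. (\<beta> p * \<beta> p) *\<^sub>R X p) =
    (\<lambda>p. \<Sum>b\<in>Basis. ext_fun c \<beta> (\<lambda>z. X (cinv c z) c \<bullet> b) p *\<^sub>R ext_field c \<beta> (\<lambda>z. b) p)"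
proof
  fix p
  show "(\<beta> p * \<beta> p) *\<^sub>R X p =
    (\<Sum>b\<in>Basis. ext_fun c \<beta> (\<lambda>z. X (cinv c z) c \<bullet> b) p *\<^sub>R ext_field c \<beta> (\<lambda>z. b) p)"
  proof (cases "p \<in> fst c")
    case True
    then have p: "p \<in> points A" using c unfolding points_def by blast
    show ?thesis
    proof (rule tangent_eqI[OF _ _ c True])
      show "(\<beta> p * \<beta> p) *\<^sub>R X p \<in> tangent_space A p"
        by (rule subspace_scale[OF subspace_tangent_space field_tangent[OF X p]])
      show "(\<Sum>b\<in>Basis. ext_fun c \<beta> (\<lambda>z. X (cinv c z) c \<bullet> b) p *\<^sub>R ext_field c \<beta> (\<lambda>z. b) p) \<in> tangent_space A p"
        by (intro subspace_sum[OF subspace_tangent_space] subspace_scale[OF subspace_tangent_space])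
          (simp add: ext_field_def True tvec_tangent[OF c True])
      show "((\<beta> p * \<beta> p) *\<^sub>R X p) c =
          (\<Sum>b\<in>Basis. ext_fun c \<beta> (\<lambda>z. X (cinv c z) c \<bullet> b) p *\<^sub>R ext_field c \<beta> (\<lambda>z. b) p) c"
        using linear_basis_expansion[OF bounded_linear.linear[OF bounded_linear_scaleR_right], of "\<beta> p" "X p c"]
        by (simp add: sum_fun_apply scaleR_fun_def ext_fun_def True cinv_chart[OF c True]
            ext_field_chart[OF c True] scaleR_sum_right[symmetric] ac_simps flip: scaleR_scaleR)
    qed
  next
    case False
    then have "\<beta> p = 0" using \<beta> unfolding cutoff_def by blast
    then show ?thesis by (simp add: ext_fun_def False)
  qed
qed

locale connection = tangent_bundle A for A :: "('p, 'e::euclidean_space) chart set" +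
  fixes N :: "('p, 'e) vconn"
  assumes connection: "linear_connection A N"
begin

lemma N_add_field: "X \<in> slit.gfields \<Longrightarrow> Y \<in> slit.gfields \<Longrightarrow> \<sigma> \<in> vsections A \<Longrightarrow> N (X + Y) \<sigma> = N X \<sigma> + N Y \<sigma>"
  using connection unfolding linear_connection_def by blast

lemma N_scale_field: "smooth_fun (slit A) f \<Longrightarrow> X \<in> slit.gfields \<Longrightarrow> \<sigma> \<in> vsections A \<Longrightarrow>
    N (\<lambda>w. f w *\<^sub>R X w) \<sigma> = (\<lambda>w. f w *\<^sub>R N X \<sigma> w)"
  using connection unfolding linear_connection_def by blast

lemma N_add: "X \<in> slit.gfields \<Longrightarrow> \<sigma> \<in> vsections A \<Longrightarrow> \<tau> \<in> vsections A \<Longrightarrow> N X (\<sigma> + \<tau>) = N X \<sigma> + N X \<tau>"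
  using connection unfolding linear_connection_def by blast

lemma N_Leibniz: "smooth_fun (slit A) f \<Longrightarrow> X \<in> slit.gfields \<Longrightarrow> \<sigma> \<in> vsections A \<Longrightarrow>
    N X (\<lambda>w. f w *\<^sub>R \<sigma> w) = (\<lambda>w. dir_deriv (slit A) X f w *\<^sub>R \<sigma> w + f w *\<^sub>R N X \<sigma> w)"
  using connection unfolding linear_connection_def by blast

lemma N_zero_field: "\<sigma> \<in> vsections A \<Longrightarrow> N 0 \<sigma> = 0"
  using N_add_field[OF slit.gfields_zero slit.gfields_zero, of \<sigma>] by simp

lemma N_zero: "X \<in> slit.gfields \<Longrightarrow> N X 0 = 0"
  using N_add[OF _ vsections_zero vsections_zero, of X] by simp

lemma N_sum_field:
  assumes "finite I" "\<And>i. i \<in> I \<Longrightarrow> X i \<in> slit.gfields" "\<sigma> \<in> vsections A"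
  shows "(\<lambda>w. \<Sum>i\<in>I. X i w) \<in> slit.gfields \<and> N (\<lambda>w. \<Sum>i\<in>I. X i w) \<sigma> = (\<lambda>w. \<Sum>i\<in>I. N (X i) \<sigma> w)"
  using assms(1,2)
proof (induction I rule: finite_induct)
  case empty
  then show ?case
    using slit.gfields_zero N_zero_field[OF assms(3)] by (simp add: zero_fun_def)
next
  case (insert i I)
  have *: "(\<lambda>w. \<Sum>i\<in>insert i I. X i w) = X i + (\<lambda>w. \<Sum>i\<in>I. X i w)"
    using insert.hyps by (simp add: plus_fun_def)
  have X: "X i \<in> slit.gfields" "(\<lambda>w. \<Sum>i\<in>I. X i w) \<in> slit.gfields"
    "N (\<lambda>w. \<Sum>i\<in>I. X i w) \<sigma> = (\<lambda>w. \<Sum>i\<in>I. N (X i) \<sigma> w)"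
    using insert by simp_all
  show ?case unfolding * N_add_field[OF X(1,2) assms(3)] X(3)
    using slit.gfields_add[OF X(1,2)] insert.hyps by (simp add: plus_fun_def)
qed

lemma N_sum:
  assumes "finite I" "\<And>i. i \<in> I \<Longrightarrow> \<sigma> i \<in> vsections A" "X \<in> slit.gfields"
  shows "(\<lambda>w. \<Sum>i\<in>I. \<sigma> i w) \<in> vsections A \<and> N X (\<lambda>w. \<Sum>i\<in>I. \<sigma> i w) = (\<lambda>w. \<Sum>i\<in>I. N X (\<sigma> i) w)"
  using assms(1,2)
proof (induction I rule: finite_induct)
  case empty
  then show ?case
    using vsections_zero N_zero[OF assms(3)] by (simp add: zero_fun_def)
next
  case (insert i I)
  have *: "(\<lambda>w. \<Sum>i\<in>insert i I. \<sigma> i w) = \<sigma> i + (\<lambda>w. \<Sum>i\<in>I. \<sigma> i w)"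
    using insert.hyps by (simp add: plus_fun_def)
  have \<sigma>: "\<sigma> i \<in> vsections A" "(\<lambda>w. \<Sum>i\<in>I. \<sigma> i w) \<in> vsections A"
    "N X (\<lambda>w. \<Sum>i\<in>I. \<sigma> i w) = (\<lambda>w. \<Sum>i\<in>I. N X (\<sigma> i) w)"
    using insert by simp_all
  show ?case unfolding * N_add[OF assms(3) \<sigma>(1,2)] \<sigma>(3)
    using vsections_add[OF \<sigma>(1,2)] insert.hyps by (simp add: plus_fun_def)
qed

text \<open>Multiplying by \<open>\<beta> * \<beta>\<close>, which is 1 at \<open>w\<close>, and
  expanding in cut off coordinate fields, linearity over smooth functions expresses
  \<open>N X \<sigma> w\<close> through the components of \<open>X w\<close> alone.\<close>

lemma N_tensorial:
  assumes w: "w \<in> points (slit A)" and X: "X \<in> slit.gfields" and Y: "Y \<in> slit.gfields"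
    and \<sigma>: "\<sigma> \<in> vsections A" and eq: "X w = Y w"
  shows "N X \<sigma> w = N Y \<sigma> w"
proof -
  obtain c where c: "c \<in> slit A" "w \<in> fst c" using w unfolding points_def by blast
  obtain \<beta> U' where \<beta>: "slit.cutoff c (snd c ` (fst c \<inter> fst c)) \<beta>" "openin slit.top U'" "w \<in> U'"
    "U' \<subseteq> fst c \<inter> fst c" "\<forall>q\<in>U'. \<beta> q = 1"
    by (rule slit.cutoff_exists[OF c slit.openin_chart[OF c(1)] c(2)])
  have \<beta>c: "slit.cutoff c (snd c ` fst c) \<beta>" using \<beta>(1) by simp
  have \<beta>w: "\<beta> w = 1" using \<beta>(3,5) by blast
  note O = slit.open_chart_image[OF c(1)]
  note t = slit.thick_chart_image[OF c(1)]
  have E: "slit.ext_field c \<beta> (\<lambda>z. b) \<in> slit.gfields" for b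
    by (rule slit.ext_field_gfields[OF c(1) O order_refl \<beta>c smooth_on_const[OF t]])
  have formula: "N Z \<sigma> w = (\<Sum>b\<in>Basis. (Z w c \<bullet> b) *\<^sub>R N (slit.ext_field c \<beta> (\<lambda>z. b)) \<sigma> w)"
    if Z: "Z \<in> slit.gfields" for Z
  proof -
    have \<beta>s: "smooth_fun (slit A) (\<lambda>p. \<beta> p * \<beta> p)"
      using \<beta>c unfolding slit.cutoff_def by (intro slit.smooth_fun_mult) blast+
    have x: "smooth_fun (slit A) (slit.ext_fun c \<beta> (\<lambda>z. Z (cinv c z) c \<bullet> b))" for b
      by (rule slit.ext_fun_smooth[OF c(1) O order_refl \<beta>c smooth_on_inner_left[OF t slit.gfields_smooth[OF Z c(1)]]])
    have "N Z \<sigma> w = (\<beta> w * \<beta> w) *\<^sub>R N Z \<sigma> w" by (simp add: \<beta>w)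
    also have "\<dots> = N (\<lambda>p. (\<beta> p * \<beta> p) *\<^sub>R Z p) \<sigma> w"
      by (simp add: N_scale_field[OF \<beta>s Z \<sigma>])
    also have "\<dots> = (\<Sum>b\<in>Basis. N (\<lambda>p. slit.ext_fun c \<beta> (\<lambda>z. Z (cinv c z) c \<bullet> b) p *\<^sub>R
        slit.ext_field c \<beta> (\<lambda>z. b) p) \<sigma> w)"
      unfolding slit.field_expansion[OF c(1) \<beta>c Z]
      using N_sum_field[of Basis "\<lambda>b p. slit.ext_fun c \<beta> (\<lambda>z. Z (cinv c z) c \<bullet> b) p *\<^sub>R
          slit.ext_field c \<beta> (\<lambda>z. b) p", OF finite_Basis _ \<sigma>] slit.gfields_scale[OF x E] by simp
    also have "\<dots> = (\<Sum>b\<in>Basis. (Z w c \<bullet> b) *\<^sub>R N (slit.ext_field c \<beta> (\<lambda>z. b)) \<sigma> w)"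
      unfolding N_scale_field[OF x E \<sigma>]
      by (simp add: slit.ext_fun_def c(2) slit.cinv_chart[OF c] \<beta>w)
    finally show ?thesis .
  qed
  show ?thesis unfolding formula[OF X] formula[OF Y] eq ..
qed

text \<open>With \<open>\<beta>\<close> supported in \<open>U\<close> and equal to 1 at
  \<open>w\<close>, the products of \<open>\<beta>\<close> with the two sections are the same global
  section. In the Leibniz rule at \<open>w\<close> the terms containing the derivative of
  \<open>\<beta>\<close> agree because \<open>\<sigma> w = \<tau> w\<close>.\<close>

lemma N_local:
  assumes U: "openin slit.top U" "w \<in> U" and X: "X \<in> slit.gfields"
    and \<sigma>: "\<sigma> \<in> vsections A" "\<tau> \<in> vsections A" and eq: "\<And>z. z \<in> U \<Longrightarrow> \<sigma> z = \<tau> z"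
  shows "N X \<sigma> w = N X \<tau> w"
proof -
  have "w \<in> points (slit A)" using U slit.openin_iff by blast
  then obtain c where c: "c \<in> slit A" "w \<in> fst c" unfolding points_def by blast
  obtain \<beta> U' where \<beta>: "slit.cutoff c (snd c ` (U \<inter> fst c)) \<beta>" "openin slit.top U'" "w \<in> U'"
    "U' \<subseteq> U \<inter> fst c" "\<forall>q\<in>U'. \<beta> q = 1"
    by (rule slit.cutoff_exists[OF c U])
  have \<beta>s: "smooth_fun (slit A) \<beta>" using \<beta>(1) unfolding slit.cutoff_def by blast
  have \<beta>w: "\<beta> w = 1" using \<beta>(3,5) by blast
  have "\<beta> z *\<^sub>R \<sigma> z = \<beta> z *\<^sub>R \<tau> z" for z
    using slit.cutoff_support(1)[OF c(1) \<beta>(1), of z] eq[of z] by (cases "\<beta> z = 0") simp_all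
  then have "N X (\<lambda>z. \<beta> z *\<^sub>R \<sigma> z) w = N X (\<lambda>z. \<beta> z *\<^sub>R \<tau> z) w" by presburger
  then show ?thesis
    unfolding N_Leibniz[OF \<beta>s X \<sigma>(1)] N_Leibniz[OF \<beta>s X \<sigma>(2)] using eq[OF U(2)] by (simp add: \<beta>w)
qed

text \<open>Tensoriality in the field and locality in the section make the \<open>THE\<close> in
  \<open>cov_deriv_at\<close> unambiguous, so any convenient extensions may be used to evaluate
  it.\<close>

lemma cov_deriv_at_eq:
  assumes U: "openin slit.top U" "w \<in> U" and X: "X \<in> slit.gfields"
    and \<sigma>: "\<sigma> \<in> vsections A" and eq: "\<And>z. z \<in> U \<Longrightarrow> \<sigma> z = s z"
  shows "cov_deriv_at A N w (X w) s = N X \<sigma> w"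
  unfolding cov_deriv_at_def
proof (rule the_equality)
  show "\<exists>Y\<in>slit.gfields. \<exists>\<tau>\<in>vsections A. \<exists>U. Y w = X w \<and> openin slit.top U \<and> w \<in> U \<and>
      (\<forall>z\<in>U. \<tau> z = s z) \<and> N X \<sigma> w = N Y \<tau> w"
    using U eq by (intro bexI[OF _ X] bexI[OF _ \<sigma>] exI[of _ U]) simp
next
  fix \<eta>
  assume "\<exists>Y\<in>slit.gfields. \<exists>\<tau>\<in>vsections A. \<exists>U. Y w = X w \<and> openin slit.top U \<and> w \<in> U \<and>
      (\<forall>z\<in>U. \<tau> z = s z) \<and> \<eta> = N Y \<tau> w"
  then obtain Y \<tau> V where Y: "Y \<in> slit.gfields" "Y w = X w" and \<tau>: "\<tau> \<in> vsections A"
    and V: "openin slit.top V" "w \<in> V" "\<forall>z\<in>V. \<tau> z = s z" and \<eta>: "\<eta> = N Y \<tau> w" by blast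
  have "w \<in> points (slit A)" using U slit.openin_iff by blast
  then have "N Y \<tau> w = N X \<tau> w" by (rule N_tensorial[OF _ Y(1) X \<tau> Y(2)])
  also have "\<dots> = N X \<sigma> w"
    by (rule N_local[OF openin_Int[OF U(1) V(1)] _ X \<tau> \<sigma>]) (use U V eq in auto)
  finally show "\<eta> = N X \<sigma> w" using \<eta> by simp
qed

end

section \<open>Local preimages under the vertical endomorphism, velocities of lifted curves\<close>

context tangent_bundle begin

lemma smooth_section_chart:
  assumes "\<sigma> \<in> slit.gfields" "c \<in> A"
  shows "smooth_on (snd (lift_chart c) ` fst (lift_chart c)) (\<lambda>z. snd (\<sigma> (cinv (lift_chart c) z) (lift_chart c)))"
  using smooth_on_snd[OF slit.thick_chart_image slit.gfields_smooth[OF assms(1)]]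
    slit_chart_in_slit[OF assms(2)] by blast

text \<open>In a chart \<open>J\<close> moves the base component into the fibre, so the fibre
  component of \<open>\<sigma>\<close> is used as the base component of \<open>Y\<close>, with zero
  in the fibre. The chart form of \<open>Y\<close> is recorded for the bracket with a vertical
  field.\<close>

lemma vsection_preimage:
  assumes \<sigma>: "\<sigma> \<in> vsections A" and w: "w \<in> points (slit A)" and c: "c \<in> A" "fst w \<in> fst c"
  obtains Y U where "Y \<in> slit.gfields" "openin slit.top U" "w \<in> U" "U \<subseteq> fst (lift_chart c)"
    "\<forall>z\<in>U. vert_endo A Y z = \<sigma> z" "\<forall>z\<in>U. Y z (lift_chart c) = (snd (\<sigma> z (lift_chart c)), 0)"
proof -
  let ?C = "lift_chart c"
  note mem = slit_chart_mem[OF w c]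
  obtain \<beta> U' where \<beta>: "slit.cutoff ?C (snd ?C ` (fst ?C \<inter> fst ?C)) \<beta>" "openin slit.top U'" "w \<in> U'"
    "U' \<subseteq> fst ?C \<inter> fst ?C" "\<forall>q\<in>U'. \<beta> q = 1"
    by (rule slit.cutoff_exists[OF mem(1,2) slit.openin_chart[OF mem(1)] mem(2)])
  define Y where "Y = slit.ext_field ?C \<beta> (\<lambda>z. (snd (\<sigma> (cinv ?C z) ?C), 0))"
  note t = slit.thick_chart_image[OF mem(1)]
  have Y: "Y \<in> slit.gfields"
    unfolding Y_def
    by (rule slit.ext_field_gfields[OF mem(1) slit.open_chart_image[OF mem(1)] order_refl])
      (use \<beta>(1) smooth_on_Pair[OF t smooth_section_chart[OF vsections_gfields[OF \<sigma>] c(1)] smooth_on_const[OF t]]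
        in simp_all)
  have U: "z \<in> points (slit A)" "fst z \<in> fst c" "z \<in> fst ?C" if "z \<in> U'" for z
  proof -
    show z: "z \<in> fst ?C" using that \<beta>(4) by blast
    show "z \<in> points (slit A)" "fst z \<in> fst c"
      using z slit_chart_points[OF c(1) z] by (simp_all add: in_slit_chart)
  qed
  have Yz: "Y z ?C = (snd (\<sigma> z ?C), 0)" if "z \<in> U'" for z
    using slit.ext_field_chart[OF mem(1) U(3)[OF that]] slit.cinv_chart[OF mem(1) U(3)[OF that]] \<beta>(5) that
    by (simp add: Y_def)
  have "vert_endo A Y z = \<sigma> z" if z: "z \<in> U'" for z
  proof (rule slit_tangent_eqI[OF vert_endo_tangent _ _ c(1)])
    show "vert_endo A Y z ?C = \<sigma> z ?C"
      using vert_endo_chart[of Y z c] slit.field_tangent[OF Y U(1)[OF z]] U[OF z] c(1) Yz[OF z]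
        vsections_chart[OF \<sigma> U(1)[OF z] c(1) U(2)[OF z]] by (simp add: prod_eq_iff)
  qed (use U[OF z] slit.field_tangent[OF vsections_gfields[OF \<sigma>]] in blast)+
  then show thesis using that[OF Y \<beta>(2,3)] \<beta>(4) Yz by simp
qed

lemma dproj_velocity:
  assumes J: "openin (top_of_set I) J" "thick J" "t \<in> J" and \<mu>: "smooth_curve (slit A) J \<mu>"
    and \<gamma>: "\<forall>t\<in>J. fst (\<mu> t) = \<gamma> t"
  shows "dproj A (\<mu> t) (velocity (slit A) J \<mu> t) = velocity A I \<gamma> t"
proof
  fix d
  have w: "\<mu> t \<in> points (slit A)" using \<mu> J(3) by (simp add: smooth_curve_def)
  have vt: "velocity (slit A) J \<mu> t \<in> tangent_space (slit A) (\<mu> t)"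
    by (rule slit.velocity_tangent[OF \<mu> J(2,3)])
  have at: "at t within J = at t within I" by (rule at_within_openin[OF J(1,3)])
  have \<gamma>t: "\<gamma> t = fst (\<mu> t)" using \<gamma> J(3) by simp
  show "dproj A (\<mu> t) (velocity (slit A) J \<mu> t) d = velocity A I \<gamma> t d"
  proof (cases "d \<in> A \<and> fst (\<mu> t) \<in> fst d")
    case True
    then have d: "d \<in> A" "fst (\<mu> t) \<in> fst d" by auto
    have "((\<lambda>s. fst ((snd (lift_chart d) \<circ> \<mu>) s)) has_vector_derivative
        fst (velocity (slit A) J \<mu> t (lift_chart d))) (at t within J)"
      using slit.chart_curve_has_vector_derivative[OF \<mu> J(3) slit_chart_mem(1,2)[OF w d]]
      unfolding has_vector_derivative_def by (rule has_derivative_fst[THEN has_derivative_eq_rhs]) simp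
    then have "((snd d \<circ> \<gamma>) has_vector_derivative
        fst (velocity (slit A) J \<mu> t (lift_chart d))) (at t within J)"
      by (rule has_vector_derivative_transform[rotated 2]) (use J(3) \<gamma> in \<open>simp_all add: snd_slit_chart\<close>)
    then have "vector_derivative (snd d \<circ> \<gamma>) (at t within J) = fst (velocity (slit A) J \<mu> t (lift_chart d))"
      by (rule vector_derivative_thick[OF J(2,3)])
    then show ?thesis
      using velocity_chart[of d \<gamma> t I] d by (simp add: dproj_chart[OF w d vt] at \<gamma>t)
  next
    case False
    then have "velocity A I \<gamma> t d = 0" by (auto simp: velocity_def \<gamma>t)
    then show ?thesis using tangent_outside[OF dproj_tangent[OF w]] False by simp
  qed
qed

lemma lift_through_facts:
  assumes I: "thick I" and l: "lift_through A I \<gamma> t w J \<mu>"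
  shows "openin (top_of_set I) J" "thick J" "t \<in> J" "smooth_curve (slit A) J \<mu>" "\<mu> t = w"
    "w \<in> points (slit A)" "dproj A w (velocity (slit A) J \<mu> t) = velocity A I \<gamma> t" "fst w = \<gamma> t"
    "at t within J = at t within I"
proof -
  show 1: "openin (top_of_set I) J" "t \<in> J" "smooth_curve (slit A) J \<mu>" "\<mu> t = w"
    using l by (simp_all add: lift_through_def)
  show 2: "thick J" using thick_openin[OF I 1(1)] .
  show "w \<in> points (slit A)" using 1 by (auto simp: smooth_curve_def)
  show "dproj A w (velocity (slit A) J \<mu> t) = velocity A I \<gamma> t"
    using dproj_velocity[OF 1(1) 2 1(2,3), of \<gamma>] l 1(4) by (simp add: lift_through_def)
  show "fst w = \<gamma> t" using l by (auto simp: lift_through_def)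
  show "at t within J = at t within I" by (rule at_within_openin[OF 1(1,2)])
qed

end

context spray_bundle begin

section \<open>Derivatives along the spray\<close>

lemma lift_spray_derivative:
  assumes N: "lift_of_canonical_connection A S N" and N': "lift_of_canonical_connection A S N'"
    and T: "\<forall>Y\<in>slit.gfields. torsion A N S Y = 0" and T': "\<forall>Y\<in>slit.gfields. torsion A N' S Y = 0"
    and w: "w \<in> points (slit A)" and \<sigma>: "\<sigma> \<in> vsections A"
  shows "N S \<sigma> w = N' S \<sigma> w"
proof -
  interpret N: connection A N
    using N by unfold_locales (simp add: lift_of_canonical_connection_def)
  interpret N': connection A N'
    using N' by unfold_locales (simp add: lift_of_canonical_connection_def)
  obtain c where c: "c \<in> A" "fst w \<in> fst c" using slit_point_chart[OF w] .
  obtain Y U where Y: "Y \<in> slit.gfields" "openin slit.top U" "w \<in> U" "\<forall>z\<in>U. vert_endo A Y z = \<sigma> z"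
    using vsection_preimage[OF \<sigma> w c] by metis
  have JS: "vert_endo A S = canonical_field A" using spray by (simp add: spray_def)
  \<comment> \<open>Both sides are \<open>vproj A S w (Y w)\<close>, because both connections are
    lifts of the same canonical connection.\<close>
  have "N Y (canonical_field A) w = N' Y (canonical_field A) w"
    using N N' Y(1) w by (simp add: lift_of_canonical_connection_def)
  moreover have "torsion A N S Y w = torsion A N' S Y w" using T T' Y(1) by simp
  ultimately have "N S (vert_endo A Y) w = N' S (vert_endo A Y) w"
    unfolding torsion_def JS by (simp add: fun_eq_iff)
  moreover have "N S (vert_endo A Y) w = N S \<sigma> w" "N' S (vert_endo A Y) w = N' S \<sigma> w"
    using N.N_local[OF Y(2,3) spray_gfields vert_endo_vsections[OF Y(1)] \<sigma>]
      N'.N_local[OF Y(2,3) spray_gfields vert_endo_vsections[OF Y(1)] \<sigma>] Y(4) by blast+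
  ultimately show ?thesis by simp
qed

text \<open>The map \<open>s\<close> is arbitrary and need not agree with a global section near
  \<open>w\<close>; then \<open>THE\<close> has no specified value. Showing that the predicates for
  \<open>N\<close> and \<open>N'\<close> are equivalent covers this case too.\<close>

lemma cov_deriv_at_spray:
  assumes N: "lift_of_canonical_connection A S N" and N': "lift_of_canonical_connection A S N'"
    and T: "\<forall>Y\<in>slit.gfields. torsion A N S Y = 0" and T': "\<forall>Y\<in>slit.gfields. torsion A N' S Y = 0"
    and w: "w \<in> points (slit A)"
  shows "cov_deriv_at A N w (S w) s = cov_deriv_at A N' w (S w) s"
proof -
  interpret N: connection A N
    using N by unfold_locales (simp add: lift_of_canonical_connection_def)
  interpret N': connection A N'
    using N' by unfold_locales (simp add: lift_of_canonical_connection_def)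
  have "N X \<sigma> w = N' X \<sigma> w" if "X \<in> slit.gfields" "\<sigma> \<in> vsections A" "X w = S w" for X \<sigma>
    using N.N_tensorial[OF w that(1) spray_gfields that(2,3)] N'.N_tensorial[OF w that(1) spray_gfields that(2,3)]
      lift_spray_derivative[OF N N' T T' w that(2)] by simp
  then have "(\<exists>X\<in>slit.gfields. \<exists>\<sigma>\<in>vsections A. \<exists>U. X w = S w \<and> openin slit.top U \<and> w \<in> U \<and>
        (\<forall>z\<in>U. \<sigma> z = s z) \<and> \<eta> = N X \<sigma> w) \<longleftrightarrow>
      (\<exists>X\<in>slit.gfields. \<exists>\<sigma>\<in>vsections A. \<exists>U. X w = S w \<and> openin slit.top U \<and> w \<in> U \<and>
        (\<forall>z\<in>U. \<sigma> z = s z) \<and> \<eta> = N' X \<sigma> w)" for \<eta>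
    by (intro bex_cong[OF refl] ex_cong1) auto
  then show ?thesis unfolding cov_deriv_at_def by presburger
qed

lemma D_field_spray:
  assumes N: "lift_of_canonical_connection A S N" and N': "lift_of_canonical_connection A S N'"
    and T: "\<forall>Y\<in>slit.gfields. torsion A N S Y = 0" and T': "\<forall>Y\<in>slit.gfields. torsion A N' S Y = 0"
    and w: "(x, W x) \<in> points (slit A)"
  shows "D_field A S N W W V x = D_field A S N' W W V x"
proof -
  have "hlift A S (x, W x) (W x) = S (x, W x)"
    using hlift_eq[OF w spray_horizontal(1)[OF w]] by (simp add: spray_horizontal(2)[OF w])
  then show ?thesis
    unfolding D_field_def D_at_def by (simp add: cov_deriv_at_spray[OF assms])
qed

text \<open>A horizontal lift through the velocity of \<open>\<gamma>\<close> has a horizontal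
  velocity lying over that same vector, and so equal to the value of \<open>S\<close>. Hence only
  derivatives along \<open>S\<close> occur, and the descriptions for \<open>N\<close> and
  \<open>N'\<close> are the same predicate.\<close>

lemma D_along_spray:
  assumes N: "lift_of_canonical_connection A S N" and N': "lift_of_canonical_connection A S N'"
    and T: "\<forall>Y\<in>slit.gfields. torsion A N S Y = 0" and T': "\<forall>Y\<in>slit.gfields. torsion A N' S Y = 0"
    and I: "thick I"
  shows "D_along A S N I \<gamma> (velocity A I \<gamma>) V t = D_along A S N' I \<gamma> (velocity A I \<gamma>) V t"
proof -
  let ?w = "(\<gamma> t, velocity A I \<gamma> t)"
  have "cov_deriv_along A N J \<mu> s t = cov_deriv_along A N' J \<mu> s t"
    if h: "horizontal_lift_through A S I \<gamma> t ?w J \<mu>" for J \<mu> s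
  proof -
    have l: "lift_through A I \<gamma> t ?w J \<mu>" and hor: "velocity (slit A) J \<mu> t \<in> horizontal A S (\<mu> t)"
      using h by (auto simp: horizontal_lift_through_def lift_through_def)
    note f = lift_through_facts[OF I l]
    have "velocity (slit A) J \<mu> t = S ?w"
      by (rule horizontal_unique[OF f(6) _ spray_horizontal(1)[OF f(6)]])
        (use hor f(5,7) spray_horizontal(2)[OF f(6)] in simp_all)
    then show ?thesis
      unfolding cov_deriv_along_def f(5) using cov_deriv_at_spray[OF N N' T T' f(6)] by simp
  qed
  then have "(\<exists>J \<mu>. horizontal_lift_through A S I \<gamma> t ?w J \<mu> \<and>
        v = vlift_inv A ?w (cov_deriv_along A N J \<mu> (vlift_along A \<mu> V) t)) \<longleftrightarrow>
      (\<exists>J \<mu>. horizontal_lift_through A S I \<gamma> t ?w J \<mu> \<and>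
        v = vlift_inv A ?w (cov_deriv_along A N' J \<mu> (vlift_along A \<mu> V) t))" for v
    by (intro ex_cong1) auto
  then show ?thesis unfolding D_along_def D_along_at_def by presburger
qed

end

section \<open>Vertical coordinate frames and fibre derivatives\<close>

context tangent_bundle begin

lemma vlift_at_zero: "vlift_at A w 0 = 0"
proof (cases "w \<in> points (slit A)")
  case True
  then have "fst w \<in> points A" by (simp add: in_slit_points)
  then obtain c where c: "c \<in> A" "fst w \<in> fst c" unfolding points_def by blast
  show ?thesis
    by (rule slit_tangent_eqI[OF vlift_at_tangent[OF True] _ True c])
      (simp_all add: vlift_at_chart[OF True c] subspace_0[OF subspace_tangent_space]
        subspace_0[OF slit.subspace_tangent_space] zero_prod_def)
qed (rule vlift_at_outside)

lemma vert_endo_vertical: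
  assumes "Z \<in> vsections A" shows "vert_endo A Z = 0"
proof
  fix w
  have "dproj A w (Z w) = 0" if "w \<in> points (slit A)"
    using assms that unfolding vsections_def vertical_def by blast
  then show "vert_endo A Z w = 0 w"
    using vlift_at_zero[of w] vlift_at_outside[of w] by (cases "w \<in> points (slit A)") (simp_all add: vert_endo_def)
qed

abbreviation section_chart :: "('p, 'e) chart \<Rightarrow> (('p, 'e) tvec \<Rightarrow> ('p, 'e) ttvec) \<Rightarrow> 'e \<times> 'e \<Rightarrow> 'e"
  where "section_chart c \<sigma> \<equiv> (\<lambda>z. snd (\<sigma> (cinv (lift_chart c) z) (lift_chart c)))"

lemma section_chart_has_derivative:
  assumes "\<sigma> \<in> slit.gfields" "w \<in> points (slit A)" "c \<in> A" "fst w \<in> fst c"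
  shows "(section_chart c \<sigma> has_derivative frechet_derivative (section_chart c \<sigma>) (at (snd (lift_chart c) w)))
    (at (snd (lift_chart c) w))"
  by (rule smooth_on_has_derivative[OF smooth_section_chart[OF assms(1,3)]
        slit.open_chart_image[OF slit_chart_in_slit[OF assms(3)]]])
    (use slit_chart_mem[OF assms(2-4)] in simp)

text \<open>A coefficient that depends on the base point alone is constant along the fibres.
  Vertical lifts and, near \<open>w\<close>, the fields \<open>vframe\<close> are of this kind; the
  vanishing fibre derivative is the hypothesis under which the torsion condition is
  exploited.\<close>

lemma basic_section_derivative:
  assumes w: "w \<in> points (slit A)" and c: "c \<in> A" "fst w \<in> fst c"
    and U: "openin slit.top U" "w \<in> U"
    and \<sigma>: "\<forall>z\<in>U. z \<in> fst (lift_chart c) \<longrightarrow> snd (\<sigma> z (lift_chart c)) = h (snd c (fst z))"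
    and h: "(h has_derivative h') (at (snd c (fst w)))"
  shows "frechet_derivative (section_chart c \<sigma>) (at (snd (lift_chart c) w)) (0, b) = 0"
proof -
  note mem = slit_chart_mem[OF w c]
  have "((\<lambda>z. h (fst z)) has_derivative (\<lambda>v. h' (fst v))) (at (snd (lift_chart c) w))"
    using has_derivative_compose[OF bounded_linear_imp_has_derivative[OF bounded_linear_fst],
        where g = h and g' = h' and x = "snd (lift_chart c) w" and s = UNIV] h
    by (simp only: snd_slit_chart fst_conv)
  then have "(section_chart c \<sigma> has_derivative (\<lambda>v. h' (fst v))) (at (snd (lift_chart c) w))"
  proof (rule has_derivative_transform_within_open)
    show "open (snd (lift_chart c) ` (U \<inter> fst (lift_chart c)))" using U(1) mem(1) slit.openin_iff by blast
    show "snd (lift_chart c) w \<in> snd (lift_chart c) ` (U \<inter> fst (lift_chart c))" using U(2) mem(2) by blast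
    fix z assume "z \<in> snd (lift_chart c) ` (U \<inter> fst (lift_chart c))"
    then obtain q where q: "q \<in> U" "q \<in> fst (lift_chart c)" "z = snd (lift_chart c) q" by blast
    then show "h (fst z) = section_chart c \<sigma> z"
      using \<sigma> slit.cinv_chart[OF mem(1) q(2)] by (simp add: snd_slit_chart)
  qed
  from frechet_derivative_at[OF this] show ?thesis
    using linear_0[OF has_derivative_linear[OF h]] by (metis fst_conv)
qed

text \<open>The vertical coordinate field in the fibre direction \<open>b\<close>, cut off so as to
  be a global section.\<close>

definition vframe :: "('p, 'e) chart \<Rightarrow> (('p, 'e) tvec \<Rightarrow> real) \<Rightarrow> 'e \<Rightarrow> ('p, 'e) tvec \<Rightarrow> ('p, 'e) ttvec"
  where "vframe c \<beta> b = slit.ext_field (lift_chart c) \<beta> (\<lambda>z. (0, b))"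

lemma vframe_vsections:
  assumes "c \<in> A" "slit.cutoff (lift_chart c) (snd (lift_chart c) ` fst (lift_chart c)) \<beta>"
  shows "vframe c \<beta> b \<in> vsections A"
  unfolding vframe_def
  by (intro ext_field_vsections slit.ext_field_gfields[OF _ _ order_refl assms(2)] slit_chart_in_slit
      slit.open_chart_image smooth_on_const slit.thick_chart_image assms(1)) simp

lemma vframe_chart:
  "c \<in> A \<Longrightarrow> z \<in> fst (lift_chart c) \<Longrightarrow> vframe c \<beta> b z (lift_chart c) = (0, \<beta> z *\<^sub>R b)"
  by (simp add: vframe_def slit.ext_field_chart[OF slit_chart_in_slit])

text \<open>The vertical counterpart of \<open>field_expansion\<close>, with one cutoff factor for
  the coefficients and one for the frame.\<close>

lemma vsection_expansion:
  assumes c: "c \<in> A" and \<beta>: "slit.cutoff (lift_chart c) (snd (lift_chart c) ` fst (lift_chart c)) \<beta>"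
    and \<sigma>: "\<sigma> \<in> vsections A"
  shows "(\<lambda>w. (\<beta> w * \<beta> w) *\<^sub>R \<sigma> w) =
    (\<lambda>w. \<Sum>b\<in>Basis. slit.ext_fun (lift_chart c) \<beta> (\<lambda>z. section_chart c \<sigma> z \<bullet> b) w *\<^sub>R vframe c \<beta> b w)"
proof
  fix w
  let ?C = "lift_chart c"
  show "(\<beta> w * \<beta> w) *\<^sub>R \<sigma> w =
    (\<Sum>b\<in>Basis. slit.ext_fun ?C \<beta> (\<lambda>z. section_chart c \<sigma> z \<bullet> b) w *\<^sub>R vframe c \<beta> b w)"
  proof (cases "w \<in> fst ?C")
    case True
    have w: "w \<in> points (slit A)" "fst w \<in> fst c"
      using slit_chart_points[OF c True] True by (simp_all add: in_slit_chart)
    show ?thesis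
    proof (rule slit_tangent_eqI[OF _ _ w(1) c w(2)])
      show "(\<beta> w * \<beta> w) *\<^sub>R \<sigma> w \<in> tangent_space (slit A) w"
        by (rule subspace_scale[OF slit.subspace_tangent_space slit.field_tangent[OF vsections_gfields[OF \<sigma>] w(1)]])
      show "(\<Sum>b\<in>Basis. slit.ext_fun ?C \<beta> (\<lambda>z. section_chart c \<sigma> z \<bullet> b) w *\<^sub>R vframe c \<beta> b w)
          \<in> tangent_space (slit A) w"
        by (intro subspace_sum[OF slit.subspace_tangent_space] subspace_scale[OF slit.subspace_tangent_space]
            slit.field_tangent[OF vsections_gfields[OF vframe_vsections[OF c \<beta>]] w(1)])
      have \<sigma>w: "\<sigma> w ?C = (0, snd (\<sigma> w ?C))"
        using vsections_chart[OF \<sigma> w(1) c w(2)] by (simp add: prod_eq_iff)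
      have "(\<Sum>b\<in>Basis. slit.ext_fun ?C \<beta> (\<lambda>z. section_chart c \<sigma> z \<bullet> b) w *\<^sub>R vframe c \<beta> b w) ?C =
          (\<Sum>b\<in>Basis. (snd (\<sigma> w ?C) \<bullet> b) *\<^sub>R (0, (\<beta> w * \<beta> w) *\<^sub>R b))"
        unfolding sum_fun_apply scaleR_fun_def vframe_chart[OF c True]
        by (rule sum.cong)
          (simp_all add: slit.ext_fun_def True slit.cinv_chart[OF slit_chart_in_slit[OF c] True])
      also have "\<dots> = (0, (\<beta> w * \<beta> w) *\<^sub>R snd (\<sigma> w ?C))"
      proof -
        have "linear (\<lambda>v. (0 :: 'e, (\<beta> w * \<beta> w) *\<^sub>R v))"
          by (rule linearI) (simp_all add: algebra_simps)
        from linear_basis_expansion[OF this, of "snd (\<sigma> w ?C)"] show ?thesis by simp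
      qed
      finally show "((\<beta> w * \<beta> w) *\<^sub>R \<sigma> w) ?C =
          (\<Sum>b\<in>Basis. slit.ext_fun ?C \<beta> (\<lambda>z. section_chart c \<sigma> z \<bullet> b) w *\<^sub>R vframe c \<beta> b w) ?C"
        using \<sigma>w by (simp add: scaleR_fun_def prod_eq_iff)
    qed
  next
    case False
    then have "\<beta> w = 0" using \<beta> unfolding slit.cutoff_def by blast
    then show ?thesis by (simp add: slit.ext_fun_def False)
  qed
qed

end

context connection begin

section \<open>Vanishing torsion\<close>

text \<open>With \<open>J Y = \<sigma>\<close> near \<open>w\<close> and \<open>J Z = 0\<close>,
  vanishing torsion reduces the claim to \<open>J [Z, Y] = 0\<close> at \<open>w\<close>, so only
  the base component of the bracket counts. It is the derivative of the coefficient of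
  \<open>\<sigma>\<close> along \<open>Z\<close>, zero by \<open>D\<close>, minus the derivative of
  the base component of \<open>Z\<close>, which is identically zero.\<close>

lemma torsion_free_vertical:
  assumes T: "\<forall>X\<in>slit.gfields. \<forall>Y\<in>slit.gfields. torsion A N X Y = 0"
    and w: "w \<in> points (slit A)" and c: "c \<in> A" "fst w \<in> fst c"
    and Z: "Z \<in> vsections A" and \<sigma>: "\<sigma> \<in> vsections A"
    and D: "frechet_derivative (section_chart c \<sigma>) (at (snd (lift_chart c) w)) (Z w (lift_chart c)) = 0"
  shows "N Z \<sigma> w = 0"
proof -
  note mem = slit_chart_mem[OF w c] and Zg = vsections_gfields[OF Z]
  let ?C = "lift_chart c"
  obtain Y U where Y: "Y \<in> slit.gfields" "openin slit.top U" "w \<in> U" "U \<subseteq> fst ?C"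
    "\<forall>z\<in>U. vert_endo A Y z = \<sigma> z" "\<forall>z\<in>U. Y z ?C = (snd (\<sigma> z ?C), 0)"
    by (rule vsection_preimage[OF \<sigma> w c])
  have dY: "fst (frechet_derivative (\<lambda>z. Y (cinv ?C z) ?C) (at (snd ?C w)) (Z w ?C)) = 0"
  proof -
    have "frechet_derivative (\<lambda>z. fst (Y (cinv ?C z) ?C)) (at (snd ?C w)) =
        frechet_derivative (section_chart c \<sigma>) (at (snd ?C w))"
    proof (rule frechet_derivative_cong_at)
      show "open (snd ?C ` (U \<inter> fst ?C))" using Y(2) mem(1) slit.openin_iff by blast
      show "snd ?C w \<in> snd ?C ` (U \<inter> fst ?C)" using Y(3) mem(2) by blast
      show "fst (Y (cinv ?C z) ?C) = section_chart c \<sigma> z" if "z \<in> snd ?C ` (U \<inter> fst ?C)" for z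
        using that Y(6) slit.cinv_chart[OF mem(1)] by auto
    qed
    then show ?thesis
      using D fun_cong[OF frechet_derivative_at[OF has_derivative_fst[OF
            slit.field_has_derivative[OF Y(1) mem(1,2)]]], of "Z w ?C"] by simp
  qed
  have dZ: "fst (frechet_derivative (\<lambda>z. Z (cinv ?C z) ?C) (at (snd ?C w)) v) = 0" for v
  proof -
    have "frechet_derivative (\<lambda>z. fst (Z (cinv ?C z) ?C)) (at (snd ?C w)) = (\<lambda>v. 0)"
      by (rule frechet_derivative_slit_cong[OF c(1) w c(2), of "\<lambda>z. 0" _ "\<lambda>z. fst (Z z ?C)"])
        (use vsections_chart[OF Z _ c(1)] in auto)
    then show ?thesis
      using fun_cong[OF frechet_derivative_at[OF has_derivative_fst[OF
            slit.field_has_derivative[OF Zg mem(1,2)]]], of v] by simp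
  qed
  have "vert_endo A (lie_bracket (slit A) Z Y) w ?C = (0, 0)"
    using vert_endo_chart[of "lie_bracket (slit A) Z Y" w c] slit.lie_bracket_tangent[OF Zg Y(1)] w c
    by (simp add: slit.lie_bracket_chart[OF mem(1,2)] dY dZ)
  then have "vert_endo A (lie_bracket (slit A) Z Y) w = 0"
    by (intro slit_tangent_eqI[OF vert_endo_tangent[OF w] subspace_0[OF slit.subspace_tangent_space] w c])
      (simp add: zero_prod_def)
  moreover have "torsion A N Z Y w = 0" using T Zg Y(1) by simp
  ultimately have "N Z (vert_endo A Y) w = 0"
    unfolding torsion_def vert_endo_vertical[OF Z] N_zero[OF Y(1)] by (simp add: fun_eq_iff)
  moreover have "N Z (vert_endo A Y) w = N Z \<sigma> w"
    using N_local[OF Y(2,3) Zg vert_endo_vsections[OF Y(1)] \<sigma>] Y(5) by blast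
  ultimately show ?thesis by simp
qed

lemma torsion_free_dproj:
  assumes T: "\<forall>X\<in>slit.gfields. \<forall>Y\<in>slit.gfields. torsion A N X Y = 0"
    and w: "w \<in> points (slit A)" and c: "c \<in> A" "fst w \<in> fst c"
    and X: "X \<in> slit.gfields" and X': "X' \<in> slit.gfields" and eq: "dproj A w (X w) = dproj A w (X' w)"
    and \<sigma>: "\<sigma> \<in> vsections A"
    and D: "\<And>b. frechet_derivative (section_chart c \<sigma>) (at (snd (lift_chart c) w)) (0, b) = 0"
  shows "N X \<sigma> w = N X' \<sigma> w"
proof -
  note mem = slit_chart_mem[OF w c]
  let ?C = "lift_chart c"
  define \<zeta> where "\<zeta> = X w - X' w"
  have tX: "X w \<in> tangent_space (slit A) w" "X' w \<in> tangent_space (slit A) w"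
    using slit.field_tangent[OF X w] slit.field_tangent[OF X' w] by auto
  have \<zeta>: "\<zeta> \<in> tangent_space (slit A) w"
    unfolding \<zeta>_def by (rule subspace_diff[OF slit.subspace_tangent_space tX])
  have "fst (X w ?C) = fst (X' w ?C)"
    using dproj_chart[OF w c tX(1)] dproj_chart[OF w c tX(2)] eq by simp
  then have \<zeta>0: "fst (\<zeta> ?C) = 0" by (simp add: \<zeta>_def)
  obtain \<beta> where \<beta>: "slit.ext_field ?C \<beta> (\<lambda>z. \<zeta> ?C) w = \<zeta>" "slit.ext_field ?C \<beta> (\<lambda>z. \<zeta> ?C) \<in> slit.gfields"
    using slit.extend_tangent[OF mem(1,2) \<zeta>] by blast
  let ?Z = "slit.ext_field ?C \<beta> (\<lambda>z. \<zeta> ?C)"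
  have Z: "?Z \<in> vsections A" by (rule ext_field_vsections[OF c(1) \<beta>(2) \<zeta>0])
  have "\<zeta> ?C = (0, snd (\<zeta> ?C))" using \<zeta>0 by (simp add: prod_eq_iff)
  then have "frechet_derivative (section_chart c \<sigma>) (at (snd ?C w)) (\<zeta> ?C) = 0" using D by metis
  then have 0: "N ?Z \<sigma> w = 0"
    by (intro torsion_free_vertical[OF T w c Z \<sigma>]) (simp add: \<beta>(1))
  have "N X \<sigma> w = N (X' + ?Z) \<sigma> w"
  proof (rule N_tensorial[OF w X slit.gfields_add[OF X' \<beta>(2)] \<sigma>])
    have "X w = X' w + \<zeta>" by (simp add: \<zeta>_def)
    then show "X w = (X' + ?Z) w" by (simp only: plus_fun_apply \<beta>(1))
  qed
  then show ?thesis by (simp add: N_add_field[OF X' \<beta>(2) \<sigma>] 0)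
qed

end

section \<open>Covariant derivatives along curves\<close>

text \<open>This exchanges the sum over the terms of a representation with the sum over the basis,
  collecting the coefficients of the frame vectors \<open>e\<close> and of their covariant
  derivatives \<open>h\<close>.\<close>

lemma frame_sum_rearrange:
  fixes e h :: "'b::euclidean_space \<Rightarrow> 'v::real_vector" and m D :: "nat \<Rightarrow> 'b"
  shows "(\<Sum>a<n. f' a *\<^sub>R (\<Sum>b\<in>Basis. (m a \<bullet> b) *\<^sub>R e b) +
      f a *\<^sub>R (\<Sum>b\<in>Basis. (D a \<bullet> b) *\<^sub>R e b + (m a \<bullet> b) *\<^sub>R h b)) =
    (\<Sum>b\<in>Basis. ((\<Sum>a<n. f a *\<^sub>R D a + f' a *\<^sub>R m a) \<bullet> b) *\<^sub>R e b + ((\<Sum>a<n. f a *\<^sub>R m a) \<bullet> b) *\<^sub>R h b)"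
  (is "?l = ?r")
proof -
  have "?l = (\<Sum>a<n. \<Sum>b\<in>Basis. ((f a *\<^sub>R D a + f' a *\<^sub>R m a) \<bullet> b) *\<^sub>R e b + ((f a *\<^sub>R m a) \<bullet> b) *\<^sub>R h b)"
    by (rule sum.cong[OF refl]) (simp add: scaleR_sum_right sum.distrib[symmetric] algebra_simps)
  also have "\<dots> = (\<Sum>b\<in>Basis. \<Sum>a<n. ((f a *\<^sub>R D a + f' a *\<^sub>R m a) \<bullet> b) *\<^sub>R e b + ((f a *\<^sub>R m a) \<bullet> b) *\<^sub>R h b)"
    by (rule sum.swap)
  also have "\<dots> = ?r"
    by (rule sum.cong[OF refl]) (simp only: inner_sum_left inner_add_left scaleR_sum_left scaleR_left_distrib sum.distrib)
  finally show ?thesis .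
qed

context connection begin

context
  fixes w c \<beta> U
  assumes w: "w \<in> points (slit A)" and c: "c \<in> A" "fst w \<in> fst c"
    and chart: "chart_at (slit A) w = lift_chart c"
    and \<beta>: "slit.cutoff (lift_chart c) (snd (lift_chart c) ` fst (lift_chart c)) \<beta>"
    and U: "openin slit.top U" "w \<in> U" "U \<subseteq> fst (lift_chart c)" "\<forall>z\<in>U. \<beta> z = 1"
begin

lemma frame_expansion:
  assumes z: "z \<in> U" and \<xi>: "\<xi> \<in> vertical A z"
  shows "\<xi> = (\<Sum>b\<in>Basis. (snd (\<xi> (lift_chart c)) \<bullet> b) *\<^sub>R vframe c \<beta> b z)"
proof -
  have zc: "z \<in> fst (lift_chart c)" using z U by blast
  have zp: "z \<in> points (slit A)" "fst z \<in> fst c"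
    using slit_chart_points[OF c(1) zc] zc by (simp_all add: in_slit_chart)
  show ?thesis
  proof (rule slit_tangent_eqI[OF _ _ zp(1) c(1) zp(2)])
    show "\<xi> \<in> tangent_space (slit A) z" using \<xi> by (simp add: vertical_def)
    show "(\<Sum>b\<in>Basis. (snd (\<xi> (lift_chart c)) \<bullet> b) *\<^sub>R vframe c \<beta> b z) \<in> tangent_space (slit A) z"
      by (intro subspace_sum[OF slit.subspace_tangent_space] subspace_scale[OF slit.subspace_tangent_space]
            slit.field_tangent[OF vsections_gfields[OF vframe_vsections[OF c(1) \<beta>]] zp(1)])
    have "(\<Sum>b\<in>Basis. (snd (\<xi> (lift_chart c)) \<bullet> b) *\<^sub>R vframe c \<beta> b z) (lift_chart c) =
        (\<Sum>b\<in>Basis. (snd (\<xi> (lift_chart c)) \<bullet> b) *\<^sub>R (0, b))"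
      unfolding sum_fun_apply scaleR_fun_def vframe_chart[OF c(1) zc] using U(4) z by simp
    also have "\<dots> = (0, snd (\<xi> (lift_chart c)))"
    proof -
      have "linear (\<lambda>v. (0 :: 'e, v))" by (rule linearI) simp_all
      from linear_basis_expansion[OF this, of "snd (\<xi> (lift_chart c))"] show ?thesis by simp
    qed
    finally show "\<xi> (lift_chart c) = (\<Sum>b\<in>Basis. (snd (\<xi> (lift_chart c)) \<bullet> b) *\<^sub>R vframe c \<beta> b z) (lift_chart c)"
      using \<xi> vertical_iff[OF zp(1) c(1) zp(2), of \<xi>] by (simp add: prod_eq_iff)
  qed
qed

text \<open>The usual coordinate formula for a connection, by the Leibniz rule applied to the frame
  expansion. The directional derivatives there are computed in the chart given by
  \<open>chart_at\<close>, which is why the context fixes precisely that chart.\<close>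

lemma N_frame:
  assumes X: "X \<in> slit.gfields" and \<sigma>: "\<sigma> \<in> vsections A"
  shows "N X \<sigma> w = (\<Sum>b\<in>Basis.
    (frechet_derivative (section_chart c \<sigma>) (at (snd (lift_chart c) w)) (X w (lift_chart c)) \<bullet> b) *\<^sub>R vframe c \<beta> b w +
    (snd (\<sigma> w (lift_chart c)) \<bullet> b) *\<^sub>R N X (vframe c \<beta> b) w)"
proof -
  let ?C = "lift_chart c"
  note mem = slit_chart_mem[OF w c]
  let ?f = "\<lambda>b. slit.ext_fun ?C \<beta> (\<lambda>z. section_chart c \<sigma> z \<bullet> b)"
  have f: "smooth_fun (slit A) (?f b)" for b
    by (rule slit.ext_fun_smooth[OF mem(1) slit.open_chart_image[OF mem(1)] order_refl \<beta>
          smooth_on_inner_left[OF slit.thick_chart_image[OF mem(1)]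
            smooth_section_chart[OF vsections_gfields[OF \<sigma>] c(1)]]])
  have e: "vframe c \<beta> b \<in> vsections A" for b by (rule vframe_vsections[OF c(1) \<beta>])
  have \<beta>s: "smooth_fun (slit A) (\<lambda>p. \<beta> p * \<beta> p)"
    using \<beta> unfolding slit.cutoff_def by (intro slit.smooth_fun_mult) blast+
  have fw: "?f b w = snd (\<sigma> w ?C) \<bullet> b" for b
    using U mem(2) by (simp add: slit.ext_fun_def slit.cinv_chart[OF mem(1,2)])
  have df: "dir_deriv (slit A) X (?f b) w =
      frechet_derivative (section_chart c \<sigma>) (at (snd ?C w)) (X w ?C) \<bullet> b" for b
  proof -
    have "frechet_derivative (?f b \<circ> cinv ?C) (at (snd ?C w)) =
        frechet_derivative (\<lambda>z. section_chart c \<sigma> z \<bullet> b) (at (snd ?C w))"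
    proof (rule frechet_derivative_cong_at)
      show "open (snd ?C ` (U \<inter> fst ?C))" using U(1) mem(1) slit.openin_iff by blast
      show "snd ?C w \<in> snd ?C ` (U \<inter> fst ?C)" using U(2) mem(2) by blast
      fix z assume "z \<in> snd ?C ` (U \<inter> fst ?C)"
      then obtain q where q: "q \<in> U" "q \<in> fst ?C" "z = snd ?C q" by blast
      then show "(?f b \<circ> cinv ?C) z = section_chart c \<sigma> z \<bullet> b"
        using U(4) slit.cinv_chart[OF mem(1) q(2)] by (simp add: slit.ext_fun_def)
    qed
    then show ?thesis
      using fun_cong[OF frechet_derivative_at[OF bounded_linear.has_derivative[OF bounded_linear_inner_left[of b]
            section_chart_has_derivative[OF vsections_gfields[OF \<sigma>] w c]]], of "X w ?C"]
      by (simp add: dir_deriv_def chart Let_def)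
  qed
  have "N X \<sigma> w = N X (\<lambda>p. (\<beta> p * \<beta> p) *\<^sub>R \<sigma> p) w"
    by (rule N_local[OF U(1,2) X \<sigma> vsections_scale[OF \<beta>s \<sigma>]]) (use U(4) in simp)
  also have "\<dots> = (\<Sum>b\<in>Basis. N X (\<lambda>p. ?f b p *\<^sub>R vframe c \<beta> b p) w)"
    unfolding vsection_expansion[OF c(1) \<beta> \<sigma>]
    using N_sum[of Basis "\<lambda>b p. ?f b p *\<^sub>R vframe c \<beta> b p" X, OF finite_Basis _ X] vsections_scale[OF f e]
    by simp
  also have "\<dots> = (\<Sum>b\<in>Basis.
    (frechet_derivative (section_chart c \<sigma>) (at (snd ?C w)) (X w ?C) \<bullet> b) *\<^sub>R vframe c \<beta> b w +
    (snd (\<sigma> w ?C) \<bullet> b) *\<^sub>R N X (vframe c \<beta> b) w)"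
    unfolding N_Leibniz[OF f X e] fw df ..
  finally show ?thesis .
qed

lemma vframe_derivative:
  "frechet_derivative (section_chart c (vframe c \<beta> b)) (at (snd (lift_chart c) w)) (0, a) = 0"
  by (rule basic_section_derivative[OF w c U(1,2), where h = "\<lambda>x. b" and h' = "\<lambda>x. 0"])
    (use U(4) in \<open>simp_all add: vframe_chart[OF c(1)]\<close>)

text \<open>Every admissible representation of the section gives this value, because in the chart it
  becomes an identity for \<open>V t c\<close> that can be differentiated. The lift enters the
  right-hand side only through its point \<open>w\<close>, through \<open>X w\<close>, and through
  the filter \<open>at t\<^sub>0 within J\<close>.\<close>

lemma cov_deriv_along_eq:
  assumes J: "thick J" and t: "t\<^sub>0 \<in> J" and \<mu>: "smooth_curve (slit A) J \<mu>" "\<mu> t\<^sub>0 = w"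
    and X: "X \<in> slit.gfields" "X w = velocity (slit A) J \<mu> t\<^sub>0"
    and V: "\<forall>t\<in>J. V t \<in> tangent_space A (fst (\<mu> t))" "smooth_on {t \<in> J. fst (\<mu> t) \<in> fst c} (\<lambda>t. V t c)"
  shows "cov_deriv_along A N J \<mu> (vlift_along A \<mu> V) t\<^sub>0 =
    (\<Sum>b\<in>Basis. (vector_derivative (\<lambda>t. V t c) (at t\<^sub>0 within J) \<bullet> b) *\<^sub>R vframe c \<beta> b w +
      (V t\<^sub>0 c \<bullet> b) *\<^sub>R N X (vframe c \<beta> b) w)" (is "_ = ?\<eta>")
proof -
  let ?C = "lift_chart c"
  note mem = slit_chart_mem[OF w c]
  have e: "vframe c \<beta> b \<in> vsections A" for b by (rule vframe_vsections[OF c(1) \<beta>])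
  have \<mu>p: "\<mu> t \<in> points (slit A)" if "t \<in> J" for t using \<mu>(1) that by (simp add: smooth_curve_def)
  have unique: "\<eta> = ?\<eta>" if K: "openin (top_of_set J) K" "t\<^sub>0 \<in> K"
    and f: "\<forall>a<n. smooth_on K (f a) \<and> \<sigma> a \<in> vsections A"
    and s: "\<forall>t\<in>K. vlift_along A \<mu> V t = (\<Sum>a<n. f a t *\<^sub>R \<sigma> a (\<mu> t))"
    and \<eta>: "\<eta> = (\<Sum>a<n. vector_derivative (f a) (at t\<^sub>0 within J) *\<^sub>R \<sigma> a (\<mu> t\<^sub>0) +
                f a t\<^sub>0 *\<^sub>R cov_deriv_at A N (\<mu> t\<^sub>0) (velocity (slit A) J \<mu> t\<^sub>0) (\<sigma> a))"
    for \<eta> K f \<sigma> and n :: nat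
  proof -
    let ?m = "\<lambda>a. snd (\<sigma> a w ?C)"
    let ?D = "\<lambda>a. frechet_derivative (section_chart c (\<sigma> a)) (at (snd ?C w)) (X w ?C)"
    let ?f' = "\<lambda>a. vector_derivative (f a) (at t\<^sub>0 within J)"
    have KJ: "K \<subseteq> J" using K(1) openin_imp_subset by blast
    have atK: "at t\<^sub>0 within K = at t\<^sub>0 within J" by (rule at_within_openin[OF K])
    define L where "L = K \<inter> {t \<in> J. \<mu> t \<in> fst ?C}"
    have L: "openin (top_of_set J) L" "t\<^sub>0 \<in> L"
      unfolding L_def using K t \<mu>(2) mem(2) slit.curve_in_chart(1)[OF \<mu>(1) mem(1)] by auto
    have coeff: "V t c = (\<Sum>a<n. f a t *\<^sub>R section_chart c (\<sigma> a) (snd ?C (\<mu> t)))" if t: "t \<in> L" for t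
    proof -
      have tt: "t \<in> K" "\<mu> t \<in> fst ?C" "t \<in> J" using t by (auto simp: L_def)
      have "vlift_along A \<mu> V t ?C = (0, V t c)"
        unfolding vlift_along_def
        by (rule vlift_at_chart[OF \<mu>p[OF tt(3)] c(1)]) (use tt(2) in \<open>simp add: in_slit_chart\<close>)
      then have "V t c = snd ((\<Sum>a<n. f a t *\<^sub>R \<sigma> a (\<mu> t)) ?C)" using s tt(1) by simp
      then show ?thesis
        by (simp add: sum_fun_apply scaleR_fun_def snd_sum slit.cinv_chart[OF mem(1) tt(2)])
    qed
    \<comment> \<open>Product rule for the summands, and chain rule for the coefficients of
      \<open>\<sigma> a\<close> along \<open>\<mu>\<close>, whose velocity in the chart is the
      component of \<open>X w\<close>.\<close>
    have "((\<lambda>t. \<Sum>a<n. f a t *\<^sub>R section_chart c (\<sigma> a) (snd ?C (\<mu> t))) has_vector_derivative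
        (\<Sum>a<n. f a t\<^sub>0 *\<^sub>R ?D a + ?f' a *\<^sub>R section_chart c (\<sigma> a) (snd ?C (\<mu> t\<^sub>0)))) (at t\<^sub>0 within J)"
    proof (rule has_vector_derivative_sum, rule has_vector_derivative_scaleR)
      fix a assume "a \<in> {..<n}"
      then have a: "smooth_on K (f a)" "\<sigma> a \<in> vsections A" using f by auto
      show "(f a has_field_derivative ?f' a) (at t\<^sub>0 within J)"
        using smooth_on_has_vector_derivative[OF a(1) K(2)]
        unfolding atK has_real_derivative_iff_has_vector_derivative .
      show "((\<lambda>t. section_chart c (\<sigma> a) (snd ?C (\<mu> t))) has_vector_derivative ?D a) (at t\<^sub>0 within J)"
        using slit.smooth_compose_curve_has_vector_derivative[OF \<mu>(1) t mem(1),
            of "section_chart c (\<sigma> a)" "frechet_derivative (section_chart c (\<sigma> a)) (at (snd ?C w))"]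
          section_chart_has_derivative[OF vsections_gfields[OF a(2)] w c] mem(2)
        by (simp add: \<mu>(2) X(2))
    qed
    then have "((\<lambda>t. \<Sum>a<n. f a t *\<^sub>R section_chart c (\<sigma> a) (snd ?C (\<mu> t))) has_vector_derivative
        (\<Sum>a<n. f a t\<^sub>0 *\<^sub>R ?D a + ?f' a *\<^sub>R ?m a)) (at t\<^sub>0 within L)"
      unfolding at_within_openin[OF L] by (simp add: \<mu>(2) slit.cinv_chart[OF mem(1,2)])
    then have "((\<lambda>t. V t c) has_vector_derivative (\<Sum>a<n. f a t\<^sub>0 *\<^sub>R ?D a + ?f' a *\<^sub>R ?m a)) (at t\<^sub>0 within L)"
      by (rule has_vector_derivative_transform[OF L(2), rotated]) (rule coeff)
    then have V': "vector_derivative (\<lambda>t. V t c) (at t\<^sub>0 within J) = (\<Sum>a<n. f a t\<^sub>0 *\<^sub>R ?D a + ?f' a *\<^sub>R ?m a)"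
      unfolding at_within_openin[OF L] by (rule vector_derivative_thick[OF J t])
    have V0: "V t\<^sub>0 c = (\<Sum>a<n. f a t\<^sub>0 *\<^sub>R ?m a)"
      using coeff[OF L(2)] by (simp add: \<mu>(2) slit.cinv_chart[OF mem(1,2)])
    \<comment> \<open>Everything is expanded in the frame. After rearrangement the coefficients are
      the right-hand sides of \<open>V'\<close> and \<open>V0\<close>, so the representation has
      disappeared.\<close>
    have "\<eta> = (\<Sum>a<n. ?f' a *\<^sub>R (\<Sum>b\<in>Basis. (?m a \<bullet> b) *\<^sub>R vframe c \<beta> b w) +
      f a t\<^sub>0 *\<^sub>R (\<Sum>b\<in>Basis. (?D a \<bullet> b) *\<^sub>R vframe c \<beta> b w + (?m a \<bullet> b) *\<^sub>R N X (vframe c \<beta> b) w))"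
      unfolding \<eta>
    proof (rule sum.cong[OF refl])
      fix a assume "a \<in> {..<n}"
      then have a: "\<sigma> a \<in> vsections A" using f by auto
      have "\<sigma> a w = (\<Sum>b\<in>Basis. (?m a \<bullet> b) *\<^sub>R vframe c \<beta> b w)"
        by (rule frame_expansion[OF U(2)]) (use a w in \<open>simp add: vsections_def\<close>)
      moreover have "cov_deriv_at A N w (X w) (\<sigma> a) = N X (\<sigma> a) w"
        by (rule cov_deriv_at_eq[OF U(1,2) X(1) a refl])
      ultimately show "?f' a *\<^sub>R \<sigma> a (\<mu> t\<^sub>0) +
            f a t\<^sub>0 *\<^sub>R cov_deriv_at A N (\<mu> t\<^sub>0) (velocity (slit A) J \<mu> t\<^sub>0) (\<sigma> a) =
          ?f' a *\<^sub>R (\<Sum>b\<in>Basis. (?m a \<bullet> b) *\<^sub>R vframe c \<beta> b w) +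
          f a t\<^sub>0 *\<^sub>R (\<Sum>b\<in>Basis. (?D a \<bullet> b) *\<^sub>R vframe c \<beta> b w + (?m a \<bullet> b) *\<^sub>R N X (vframe c \<beta> b) w)"
        unfolding \<mu>(2) X(2)[symmetric] using N_frame[OF X(1) a] by metis
    qed
    also have "\<dots> = (\<Sum>b\<in>Basis. ((\<Sum>a<n. f a t\<^sub>0 *\<^sub>R ?D a + ?f' a *\<^sub>R ?m a) \<bullet> b) *\<^sub>R vframe c \<beta> b w +
        ((\<Sum>a<n. f a t\<^sub>0 *\<^sub>R ?m a) \<bullet> b) *\<^sub>R N X (vframe c \<beta> b) w)"
      by (rule frame_sum_rearrange)
    finally show "\<eta> = ?\<eta>" unfolding V' V0 .
  qed
  have exists: "\<exists>K (n::nat) f \<sigma>. openin (top_of_set J) K \<and> t\<^sub>0 \<in> K \<and>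
    (\<forall>a<n. smooth_on K (f a) \<and> \<sigma> a \<in> vsections A) \<and>
    (\<forall>t\<in>K. vlift_along A \<mu> V t = (\<Sum>a<n. f a t *\<^sub>R \<sigma> a (\<mu> t)))"
  proof -
    \<comment> \<open>The definition indexes representations by numbers below \<open>n\<close>, so
      the basis is enumerated.\<close>
    obtain h :: "nat \<Rightarrow> 'e" where h: "bij_betw h {0..<card (Basis :: 'e set)} Basis"
      using ex_bij_betw_nat_finite[OF finite_Basis] by blast
    let ?n = "card (Basis :: 'e set)"
    let ?K = "{t \<in> J. \<mu> t \<in> U}"
    have K: "openin (top_of_set J) ?K" by (rule slit.curve_openin_preimage[OF \<mu>(1) U(1)])
    have tK: "t\<^sub>0 \<in> ?K" using t \<mu>(2) U(2) by simp
    have sub: "?K \<subseteq> {t \<in> J. fst (\<mu> t) \<in> fst c}" using U(3) by (auto simp: in_slit_chart)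
    have sm: "smooth_on ?K (\<lambda>t. V t c \<bullet> h a)" for a
      by (rule smooth_on_inner_left[OF thick_openin[OF J K] smooth_on_openin[OF V(2)]])
        (rule openin_subset_trans[OF K sub], auto)
    have "vlift_along A \<mu> V t = (\<Sum>a<?n. (V t c \<bullet> h a) *\<^sub>R vframe c \<beta> (h a) (\<mu> t))" if t: "t \<in> ?K" for t
    proof -
      have tt: "t \<in> J" "\<mu> t \<in> U" "fst (\<mu> t) \<in> fst c" using t sub by auto
      have ch: "vlift_along A \<mu> V t ?C = (0, V t c)"
        unfolding vlift_along_def by (rule vlift_at_chart[OF \<mu>p[OF tt(1)] c(1) tt(3)])
      have "vlift_along A \<mu> V t \<in> vertical A (\<mu> t)"
        unfolding vertical_iff[OF \<mu>p[OF tt(1)] c(1) tt(3)]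
        using vlift_at_tangent[OF \<mu>p[OF tt(1)]] V(1) tt(1) ch by (simp add: vlift_along_def)
      from frame_expansion[OF tt(2) this]
      have "vlift_along A \<mu> V t = (\<Sum>b\<in>Basis. (V t c \<bullet> b) *\<^sub>R vframe c \<beta> b (\<mu> t))" by (simp add: ch)
      also have "\<dots> = (\<Sum>a<?n. (V t c \<bullet> h a) *\<^sub>R vframe c \<beta> (h a) (\<mu> t))"
        using sum.reindex_bij_betw[OF h, of "\<lambda>b. (V t c \<bullet> b) *\<^sub>R vframe c \<beta> b (\<mu> t)"]
        by (simp add: atLeast0LessThan)
      finally show ?thesis .
    qed
    then show ?thesis
      using K tK sm e
      by (intro exI[of _ ?K] exI[of _ ?n] exI[of _ "\<lambda>a t. V t c \<bullet> h a"] exI[of _ "\<lambda>a. vframe c \<beta> (h a)"]) simp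
  qed
  show ?thesis
    unfolding cov_deriv_along_def
  proof (rule the_equality)
    show "\<exists>K (n::nat) f \<sigma>. openin (top_of_set J) K \<and> t\<^sub>0 \<in> K \<and>
      (\<forall>a<n. smooth_on K (f a) \<and> \<sigma> a \<in> vsections A) \<and>
      (\<forall>t\<in>K. vlift_along A \<mu> V t = (\<Sum>a<n. f a t *\<^sub>R \<sigma> a (\<mu> t))) \<and>
      ?\<eta> = (\<Sum>a<n. vector_derivative (f a) (at t\<^sub>0 within J) *\<^sub>R \<sigma> a (\<mu> t\<^sub>0) +
                  f a t\<^sub>0 *\<^sub>R cov_deriv_at A N (\<mu> t\<^sub>0) (velocity (slit A) J \<mu> t\<^sub>0) (\<sigma> a))"
    proof -
      obtain K n f \<sigma> where r: "openin (top_of_set J) K" "t\<^sub>0 \<in> K"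
        "\<forall>a<n::nat. smooth_on K (f a) \<and> \<sigma> a \<in> vsections A"
        "\<forall>t\<in>K. vlift_along A \<mu> V t = (\<Sum>a<n. f a t *\<^sub>R \<sigma> a (\<mu> t))"
        using exists by (elim exE conjE)
      show ?thesis
        by (intro exI[of _ K] exI[of _ n] exI[of _ f] exI[of _ \<sigma>] conjI r unique[OF r refl, symmetric])
    qed
  qed (elim exE conjE, rule unique)
qed

end

end

lemma (in tangent_bundle) frame_exists:
  assumes w: "w \<in> points (slit A)"
  obtains c \<beta> U where "c \<in> A" "fst w \<in> fst c" "chart_at (slit A) w = lift_chart c"
    "slit.cutoff (lift_chart c) (snd (lift_chart c) ` fst (lift_chart c)) \<beta>"
    "openin slit.top U" "w \<in> U" "U \<subseteq> fst (lift_chart c)" "\<forall>z\<in>U. \<beta> z = 1"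
proof -
  obtain c where c: "c \<in> A" "chart_at (slit A) w = lift_chart c" "fst w \<in> fst c" using slit_chart_at[OF w] .
  note mem = slit_chart_mem[OF w c(1,3)]
  obtain \<beta> U where \<beta>: "slit.cutoff (lift_chart c) (snd (lift_chart c) ` (fst (lift_chart c) \<inter> fst (lift_chart c))) \<beta>"
    "openin slit.top U" "w \<in> U" "U \<subseteq> fst (lift_chart c) \<inter> fst (lift_chart c)" "\<forall>q\<in>U. \<beta> q = 1"
    by (rule slit.cutoff_exists[OF mem(1,2) slit.openin_chart[OF mem(1)] mem(2)])
  show thesis by (rule that[OF c(1,3,2) _ \<beta>(2,3) _ \<beta>(5)]) (use \<beta>(1,4) in simp_all)
qed

lemma (in tangent_bundle) extend_slit_tangent:
  assumes w: "w \<in> points (slit A)" and \<xi>: "\<xi> \<in> tangent_space (slit A) w"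
  obtains X where "X \<in> slit.gfields" "X w = \<xi>"
proof -
  obtain c where c: "c \<in> A" "chart_at (slit A) w = lift_chart c" "fst w \<in> fst c" using slit_chart_at[OF w] .
  show thesis
    by (rule slit.extend_tangent[OF slit_chart_mem(1,2)[OF w c(1,3)] \<xi>]) (rule that)
qed

lemma (in tangent_bundle) fields_along_lift:
  assumes V: "V \<in> fields_along A I \<gamma>" and l: "lift_through A I \<gamma> t w J \<mu>" and c: "c \<in> A"
  shows "\<forall>t\<in>J. V t \<in> tangent_space A (fst (\<mu> t))" "smooth_on {t \<in> J. fst (\<mu> t) \<in> fst c} (\<lambda>t. V t c)"
proof -
  have J: "openin (top_of_set I) J" "\<forall>t\<in>J. fst (\<mu> t) = \<gamma> t" using l by (simp_all add: lift_through_def)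
  have JI: "J \<subseteq> I" using J(1) openin_imp_subset by blast
  show "\<forall>t\<in>J. V t \<in> tangent_space A (fst (\<mu> t))" using V J(2) JI by (auto simp: fields_along_def)
  have "{t \<in> J. fst (\<mu> t) \<in> fst c} = {t \<in> I. \<gamma> t \<in> fst c} \<inter> J" using J(2) JI by auto
  moreover have "openin (top_of_set {t \<in> I. \<gamma> t \<in> fst c}) ({t \<in> I. \<gamma> t \<in> fst c} \<inter> J)"
    using openin_subtopology_Int2[of "top_of_set I" J "{t \<in> I. \<gamma> t \<in> fst c}"] J(1)
    by (simp add: subtopology_subtopology Int_absorb1 Collect_conj_eq)
  ultimately show "smooth_on {t \<in> J. fst (\<mu> t) \<in> fst c} (\<lambda>t. V t c)"
    using smooth_on_openin V c by (fastforce simp: fields_along_def)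
qed

context connection begin

text \<open>In the formula of \<open>cov_deriv_along_eq\<close> only the terms
  \<open>N X (vframe c \<beta> b) w\<close> involve the velocity of the lift. The frame has constant
  coefficients near \<open>w\<close>, so in the absence of torsion these terms depend only on the
  projected velocity, which is that of \<open>\<gamma>\<close>.\<close>

lemma cov_deriv_along_lift_independent:
  assumes T: "\<forall>X\<in>slit.gfields. \<forall>Y\<in>slit.gfields. torsion A N X Y = 0"
    and I: "thick I" and V: "V \<in> fields_along A I \<gamma>"
    and l: "lift_through A I \<gamma> t w J \<mu>" and l': "lift_through A I \<gamma> t w J' \<mu>'"
  shows "cov_deriv_along A N J \<mu> (vlift_along A \<mu> V) t = cov_deriv_along A N J' \<mu>' (vlift_along A \<mu>' V) t"
proof -
  note f = lift_through_facts[OF I l] and f' = lift_through_facts[OF I l']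
  note w = f(6)
  obtain c \<beta> U where fr: "c \<in> A" "fst w \<in> fst c" "chart_at (slit A) w = lift_chart c"
    "slit.cutoff (lift_chart c) (snd (lift_chart c) ` fst (lift_chart c)) \<beta>"
    "openin slit.top U" "w \<in> U" "U \<subseteq> fst (lift_chart c)" "\<forall>z\<in>U. \<beta> z = 1"
    by (rule frame_exists[OF w])
  have vel: "velocity (slit A) J \<mu> t \<in> tangent_space (slit A) w"
    "velocity (slit A) J' \<mu>' t \<in> tangent_space (slit A) w"
    using slit.velocity_tangent[OF f(4,2,3)] slit.velocity_tangent[OF f'(4,2,3)] f(5) f'(5) by simp_all
  obtain X where X: "X \<in> slit.gfields" "X w = velocity (slit A) J \<mu> t"
    by (rule extend_slit_tangent[OF w vel(1)])
  obtain X' where X': "X' \<in> slit.gfields" "X' w = velocity (slit A) J' \<mu>' t"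
    by (rule extend_slit_tangent[OF w vel(2)])
  have "dproj A w (X w) = dproj A w (X' w)" using f(7) f'(7) X(2) X'(2) by simp
  then have "N X (vframe c \<beta> b) w = N X' (vframe c \<beta> b) w" for b
    by (rule torsion_free_dproj[OF T w fr(1,2) X(1) X'(1) _ vframe_vsections[OF fr(1,4)]
          vframe_derivative[OF w fr]])
  then show ?thesis
    unfolding cov_deriv_along_eq[OF w fr f(2,3,4,5) X fields_along_lift[OF V l fr(1)]]
      cov_deriv_along_eq[OF w fr f'(2,3,4,5) X' fields_along_lift[OF V l' fr(1)]] f(9) f'(9)
    by simp
qed

text \<open>Since \<open>V\<close> is given over \<open>U\<close> only, its vertical lift is first
  replaced by a global section \<open>\<sigma>\<close> with the same germ at \<open>w\<close>. The
  cutoff is taken inside the preimage of \<open>U\<close>, where the coefficients of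
  \<open>V\<close> are smooth.\<close>

lemma cov_deriv_at_vlift_independent:
  assumes T: "\<forall>X\<in>slit.gfields. \<forall>Y\<in>slit.gfields. torsion A N X Y = 0"
    and U: "openin top U" and V: "V \<in> fields A U" and w: "w \<in> points (slit A)" "fst w \<in> U"
    and \<xi>: "\<xi> \<in> tangent_space (slit A) w" and \<eta>: "\<eta> \<in> tangent_space (slit A) w" and eq: "dproj A w \<xi> = dproj A w \<eta>"
  shows "cov_deriv_at A N w \<xi> (vlift A V) = cov_deriv_at A N w \<eta> (vlift A V)"
proof -
  have "fst w \<in> points A" using w by (simp add: in_slit_points)
  then obtain c where c: "c \<in> A" "fst w \<in> fst c" unfolding points_def by blast
  let ?C = "lift_chart c"
  note mem = slit_chart_mem[OF w(1) c]
  let ?U = "{z \<in> points (slit A). fst z \<in> U}"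
  have pre: "openin slit.top ?U" by (rule openin_slit_preimage[OF U])
  obtain \<beta> U' where \<beta>: "slit.cutoff ?C (snd ?C ` (?U \<inter> fst ?C)) \<beta>" "openin slit.top U'" "w \<in> U'"
    "U' \<subseteq> ?U \<inter> fst ?C" "\<forall>q\<in>U'. \<beta> q = 1"
    by (rule slit.cutoff_exists[OF mem(1,2) pre]) (use w in simp_all)
  let ?V = "\<lambda>x. V (cinv c x) c"
  have O: "open (snd c ` (fst c \<inter> U))" using U c(1) openin_iff by (simp add: Int_commute)
  have sV: "smooth_on (snd c ` (fst c \<inter> U)) ?V" using V c(1) by (simp add: fields_def)
  have im: "snd ?C ` (?U \<inter> fst ?C) = snd c ` (fst c \<inter> U) \<times> (- {0})"
  proof -
    have "?U \<inter> fst ?C = {z. fst z \<in> U} \<inter> fst ?C" using slit_chart_points[OF c(1)] by auto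
    then show ?thesis using slit_chart_image[OF c(1), of U] by (simp add: Int_commute)
  qed
  have OO: "open (snd ?C ` (?U \<inter> fst ?C))" using pre mem(1) slit.openin_iff by blast
  \<comment> \<open>The coefficient ignores the fibre variable \<open>snd z\<close>, as befits a
    vertical lift.\<close>
  define \<sigma> where "\<sigma> = slit.ext_field ?C \<beta> (\<lambda>z. (0, ?V (fst z)))"
  have "smooth_on (snd ?C ` (?U \<inter> fst ?C)) (\<lambda>z. (0 :: 'e, ?V (fst z)))"
  proof (intro smooth_on_Pair thick_open OO smooth_on_const)
    show "smooth_on (snd ?C ` (?U \<inter> fst ?C)) (\<lambda>z. ?V (fst z))"
      by (rule smooth_on_compose[OF sV O thick_open[OF OO] smooth_on_fst[OF thick_open[OF OO]
              smooth_on_id[OF thick_open[OF OO]]]]) (use im in auto)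
  qed
  then have \<sigma>: "\<sigma> \<in> vsections A"
    unfolding \<sigma>_def
    by (intro ext_field_vsections slit.ext_field_gfields[OF mem(1) OO _ \<beta>(1)] c(1)) auto
  have pts: "z \<in> points (slit A)" "fst z \<in> fst c" "fst z \<in> U" "z \<in> fst ?C" if "z \<in> U'" for z
    using that \<beta>(4) by (auto simp: in_slit_chart)
  have \<sigma>c: "\<sigma> z ?C = (0, V (fst z) c)" if z: "z \<in> U'" for z
    using slit.ext_field_chart[OF mem(1) pts(4)[OF z]] \<beta>(5) z cinv_chart[OF c(1) pts(2)[OF z]]
    by (simp add: \<sigma>_def snd_slit_chart)
  have \<sigma>V: "\<sigma> z = vlift A V z" if z: "z \<in> U'" for z
  proof (rule slit_tangent_eqI[OF _ _ pts(1)[OF z] c(1) pts(2)[OF z]])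
    show "\<sigma> z \<in> tangent_space (slit A) z" by (rule slit.field_tangent[OF vsections_gfields[OF \<sigma>] pts(1)[OF z]])
    show "vlift A V z \<in> tangent_space (slit A) z"
      unfolding vlift_def by (rule vlift_at_tangent[OF pts(1)[OF z] field_tangent[OF V pts(3)[OF z]]])
    show "\<sigma> z ?C = vlift A V z ?C"
      unfolding vlift_def vlift_at_chart[OF pts(1)[OF z] c(1) pts(2)[OF z]] \<sigma>c[OF z] ..
  qed
  have D: "frechet_derivative (section_chart c \<sigma>) (at (snd ?C w)) (0, b) = 0" for b
  proof (rule basic_section_derivative[OF w(1) c \<beta>(2,3)])
    show "\<forall>z\<in>U'. z \<in> fst ?C \<longrightarrow> snd (\<sigma> z ?C) = ?V (snd c (fst z))"
      using \<sigma>c cinv_chart[OF c(1) pts(2)] by simp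
    show "(?V has_derivative frechet_derivative ?V (at (snd c (fst w)))) (at (snd c (fst w)))"
      by (rule smooth_on_has_derivative[OF sV O]) (use c w in simp)
  qed
  obtain X where X: "X \<in> slit.gfields" "X w = \<xi>" by (rule extend_slit_tangent[OF w(1) \<xi>])
  obtain Y where Y: "Y \<in> slit.gfields" "Y w = \<eta>" by (rule extend_slit_tangent[OF w(1) \<eta>])
  have "cov_deriv_at A N w \<xi> (vlift A V) = N X \<sigma> w"
    using cov_deriv_at_eq[OF \<beta>(2,3) X(1) \<sigma> \<sigma>V] X(2) by simp
  also have "\<dots> = N Y \<sigma> w"
    by (rule torsion_free_dproj[OF T w(1) c X(1) Y(1) _ \<sigma> D]) (simp add: X(2) Y(2) eq)
  also have "\<dots> = cov_deriv_at A N w \<eta> (vlift A V)"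
    using cov_deriv_at_eq[OF \<beta>(2,3) Y(1) \<sigma> \<sigma>V] Y(2) by simp
  finally show ?thesis .
qed

end

lemma (in spray_bundle) D_at_lift_independent:
  assumes N: "linear_connection A N" and T: "\<forall>X\<in>slit.gfields. \<forall>Y\<in>slit.gfields. torsion A N X Y = 0"
    and U: "openin top U" and V: "V \<in> fields A U" and w: "w \<in> points (slit A)" "fst w \<in> U"
    and \<xi>: "\<xi> \<in> tangent_space (slit A) w"
  shows "D_at A S N w (dproj A w \<xi>) V = vlift_inv A w (cov_deriv_at A N w \<xi> (vlift A V))"
proof -
  interpret connection A N by unfold_locales (rule N)
  obtain \<eta> where \<eta>: "\<eta> \<in> horizontal A S w" "dproj A w \<eta> = dproj A w \<xi>"
    by (rule horizontal_exists[OF w(1) dproj_tangent[OF w(1)]])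
  obtain c where c: "c \<in> A" "fst w \<in> fst c" using slit_point_chart[OF w(1)] .
  have t: "\<eta> \<in> tangent_space (slit A) w" using \<eta>(1) horizontal_iff[OF w(1) c] by blast
  have "hlift A S w (dproj A w \<xi>) = \<eta>" using hlift_eq[OF w(1) \<eta>(1)] \<eta>(2) by simp
  then show ?thesis
    unfolding D_at_def using cov_deriv_at_vlift_independent[OF T U V w t \<xi> \<eta>(2)] by simp
qed

section \<open>Ordinary differential equations\<close>

text \<open>Picard iteration as a fixed point in the complete space of bounded continuous functions
  on the whole line. For this \<open>F\<close> is extended to all times and points by clamping the
  time and projecting onto the ball; the projection does not increase distances, so bound and
  Lipschitz constant survive. Derivatives are within an interval because \<open>t0\<close> may be an
  end point of \<open>{a..b}\<close>.\<close>

lemma ode_local_solution: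
  fixes F :: "real \<Rightarrow> 'a::euclidean_space \<Rightarrow> 'a"
  assumes ab: "a \<le> t0" "t0 \<le> b" and r: "r > 0"
    and cont: "continuous_on ({a..b} \<times> cball y0 r) (\<lambda>(t, y). F t y)"
    and lip: "\<And>t y y'. t \<in> {a..b} \<Longrightarrow> y \<in> cball y0 r \<Longrightarrow> y' \<in> cball y0 r \<Longrightarrow>
      norm (F t y - F t y') \<le> L * norm (y - y')"
  obtains h y where "h > 0" "y t0 = y0"
    "\<forall>t\<in>{t0 - h..t0 + h}. y t \<in> cball y0 r"
    "\<forall>t\<in>{a..b} \<inter> {t0 - h..t0 + h}.
      (y has_vector_derivative F t (y t)) (at t within {a..b} \<inter> {t0 - h..t0 + h})"
proof -
  define \<rho> where "\<rho> t = max a (min b t)" for t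
  define P where "P = closest_point (cball y0 r)"
  define G where "G t y = F (\<rho> t) (P y)" for t y
  have ball: "convex (cball y0 r)" "closed (cball y0 r)" "cball y0 r \<noteq> {}" using r by auto
  have P: "P y \<in> cball y0 r" for y unfolding P_def using ball closest_point_in_set by blast
  have P_id: "P y = y" if "y \<in> cball y0 r" for y unfolding P_def using that by (rule closest_point_self)
  have \<rho>: "\<rho> t \<in> {a..b}" for t using ab by (auto simp: \<rho>_def)
  have contG: "continuous_on U (\<lambda>t. G t (\<phi> t))" if "continuous_on U \<phi>" for \<phi> U
  proof -
    have "continuous_on U (\<lambda>t. (\<rho> t, P (\<phi> t)))"
      unfolding \<rho>_def P_def
      by (intro continuous_intros continuous_on_compose2[OF continuous_on_closest_point[OF ball, of UNIV] that]) auto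
    moreover have "(\<lambda>t. (\<rho> t, P (\<phi> t))) ` U \<subseteq> {a..b} \<times> cball y0 r" using \<rho> P by blast
    ultimately have "continuous_on U (\<lambda>t. (\<lambda>(t, y). F t y) (\<rho> t, P (\<phi> t)))"
      by (rule continuous_on_compose2[OF cont])
    then show ?thesis by (simp add: G_def)
  qed
  obtain M where M: "M > 0" "\<And>t y. norm (G t y) \<le> M"
  proof -
    have "compact ((\<lambda>(t, y). F t y) ` ({a..b} \<times> cball y0 r))"
      by (intro compact_continuous_image[OF cont] compact_Times) auto
    from compact_imp_bounded[OF this]
    obtain M where "M > 0" "\<forall>z\<in>(\<lambda>(t, y). F t y) ` ({a..b} \<times> cball y0 r). norm z \<le> M"
      unfolding bounded_pos by blast
    then show thesis using \<rho> P by (intro that[of M]) (auto simp: G_def)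
  qed
  define L' where "L' = max L 0"
  have L': "L' \<ge> 0" "norm (G t y - G t y') \<le> L' * norm (y - y')" for t y y'
  proof -
    show "L' \<ge> 0" by (simp add: L'_def)
    have "norm (G t y - G t y') \<le> L * norm (P y - P y')" unfolding G_def by (rule lip[OF \<rho> P P])
    also have "\<dots> \<le> L' * norm (P y - P y')" by (intro mult_right_mono) (auto simp: L'_def)
    also have "\<dots> \<le> L' * norm (y - y')"
      using closest_point_lipschitz[OF ball, of y y'] \<open>L' \<ge> 0\<close>
      by (intro mult_left_mono) (auto simp: P_def dist_norm)
    finally show "norm (G t y - G t y') \<le> L' * norm (y - y')" .
  qed
  \<comment> \<open>The first bound makes the iteration a contraction with factor 1/2, the second
    keeps the solution in the ball. The factor 4 in \<open>4 * h\<close> arises from two integrals,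
    each over a length of at most \<open>2 * h\<close>; the summand 1 allows for
    \<open>L' = 0\<close>.\<close>
  define h where "h = min (1 / (8 * (L' + 1))) (r / (4 * M))"
  have h: "h > 0" "4 * h * L' \<le> 1 / 2" "4 * h * M \<le> r"
  proof -
    show "h > 0" using L'(1) M(1) r by (simp add: h_def add_nonneg_pos)
    have "4 * h * L' \<le> 4 * (1 / (8 * (L' + 1))) * L'"
      using L'(1) by (intro mult_right_mono mult_left_mono) (auto simp: h_def)
    also have "\<dots> \<le> 1 / 2" using L'(1) by (simp add: field_simps)
    finally show "4 * h * L' \<le> 1 / 2" .
    have "4 * h * M \<le> 4 * (r / (4 * M)) * M"
      using M(1) by (intro mult_right_mono mult_left_mono) (auto simp: h_def)
    then show "4 * h * M \<le> r" using M(1) by simp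
  qed
  \<comment> \<open>Starting at \<open>t0 - h\<close> keeps the limits of integration ordered on
    both sides of \<open>t0\<close>; the integral from \<open>t0\<close> is recovered as the
    difference \<open>J \<phi> s - J \<phi> t0\<close>.\<close>
  define J where "J \<phi> s = integral {t0 - h..s} (\<lambda>\<tau>. G \<tau> (\<phi> \<tau>))" for \<phi> s
  \<comment> \<open>Outside the interval the iterates are continued by constants, which keeps them
    bounded and continuous on the whole line.\<close>
  define clip where "clip t = max (t0 - h) (min (t0 + h) t)" for t
  have clip: "clip t \<in> {t0 - h..t0 + h}" for t using h(1) by (auto simp: clip_def)
  have t0: "t0 \<in> {t0 - h..t0 + h}" using h(1) by simp
  have J_bound: "norm (J \<phi> s) \<le> 2 * h * M" if "continuous_on UNIV \<phi>" "s \<in> {t0 - h..t0 + h}" for \<phi> s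
  proof -
    have "norm (J \<phi> s) \<le> M * (s - (t0 - h))"
      unfolding J_def using that M(2)
      by (intro integral_bound contG continuous_on_subset[OF that(1)]) auto
    also have "\<dots> \<le> M * (2 * h)" using that M(1) by (intro mult_left_mono) auto
    finally show ?thesis by (simp add: mult.commute)
  qed
  have J_lip: "norm (J \<phi> s - J \<psi> s) \<le> 2 * h * (L' * d)"
    if c: "continuous_on UNIV \<phi>" "continuous_on UNIV \<psi>" and s: "s \<in> {t0 - h..t0 + h}"
      and d: "\<And>\<tau>. norm (\<phi> \<tau> - \<psi> \<tau>) \<le> d" "d \<ge> 0" for \<phi> \<psi> s d
  proof -
    have i: "(\<lambda>\<tau>. G \<tau> (\<phi> \<tau>)) integrable_on {t0 - h..s}" "(\<lambda>\<tau>. G \<tau> (\<psi> \<tau>)) integrable_on {t0 - h..s}"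
      by (intro integrable_continuous_real contG continuous_on_subset[OF c(1)] continuous_on_subset[OF c(2)]; simp)+
    have "J \<phi> s - J \<psi> s = integral {t0 - h..s} (\<lambda>\<tau>. G \<tau> (\<phi> \<tau>) - G \<tau> (\<psi> \<tau>))"
      unfolding J_def by (rule Henstock_Kurzweil_Integration.integral_diff[OF i, symmetric])
    also have "norm \<dots> \<le> (L' * d) * (s - (t0 - h))"
    proof (rule integral_bound)
      show "t0 - h \<le> s" using s by simp
      show "continuous_on {t0 - h..s} (\<lambda>\<tau>. G \<tau> (\<phi> \<tau>) - G \<tau> (\<psi> \<tau>))"
        by (intro continuous_on_diff contG continuous_on_subset[OF c(1)] continuous_on_subset[OF c(2)]; simp)
      show "norm (G \<tau> (\<phi> \<tau>) - G \<tau> (\<psi> \<tau>)) \<le> L' * d" for \<tau>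
        using L'(2)[of \<tau> "\<phi> \<tau>" "\<psi> \<tau>"] mult_left_mono[OF d(1)[of \<tau>] L'(1)] by linarith
    qed
    also have "\<dots> \<le> (L' * d) * (2 * h)" using s d(2) L'(1) by (intro mult_left_mono) auto
    finally show ?thesis by (simp add: mult.commute)
  qed
  have J_deriv: "(J \<phi> has_vector_derivative G s (\<phi> s)) (at s within {t0 - h..t0 + h})"
    if "continuous_on UNIV \<phi>" "s \<in> {t0 - h..t0 + h}" for \<phi> s
    unfolding J_def[abs_def]
    by (rule integral_has_vector_derivative[OF contG that(2)]) (rule continuous_on_subset[OF that(1)], simp)
  define T where "T \<phi> t = y0 + (J \<phi> (clip t) - J \<phi> t0)" for \<phi> t
  have T_bcontfun: "T (apply_bcontfun \<phi>) \<in> bcontfun" for \<phi> :: "real \<Rightarrow>\<^sub>C 'a"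
  proof (rule bcontfun_normI)
    have "continuous_on {t0 - h..t0 + h} (J (apply_bcontfun \<phi>))"
      unfolding continuous_on_eq_continuous_within
      by (intro ballI has_vector_derivative_continuous[OF J_deriv]) simp_all
    moreover have "continuous_on UNIV clip"
      unfolding clip_def by (intro continuous_intros)
    moreover have "range clip \<subseteq> {t0 - h..t0 + h}" using clip by blast
    ultimately have "continuous_on UNIV (\<lambda>t. J (apply_bcontfun \<phi>) (clip t))"
      by (rule continuous_on_compose2)
    then show "continuous_on UNIV (T (apply_bcontfun \<phi>))"
      unfolding T_def by (intro continuous_intros)
    fix t
    have "norm (T (apply_bcontfun \<phi>) t) \<le> norm y0 + norm (J (apply_bcontfun \<phi>) (clip t) - J (apply_bcontfun \<phi>) t0)"
      unfolding T_def by (rule norm_triangle_ineq)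
    moreover have "norm (J (apply_bcontfun \<phi>) (clip t)) \<le> 2 * h * M" by (rule J_bound[OF _ clip]) simp
    moreover have "norm (J (apply_bcontfun \<phi>) t0) \<le> 2 * h * M" by (rule J_bound[OF _ t0]) simp
    ultimately show "norm (T (apply_bcontfun \<phi>) t) \<le> norm y0 + (2 * h * M + 2 * h * M)"
      using norm_triangle_ineq4[of "J (apply_bcontfun \<phi>) (clip t)" "J (apply_bcontfun \<phi>) t0"] by linarith
  qed
  have "\<exists>!\<phi>. Bcontfun (T (apply_bcontfun \<phi>)) = \<phi>"
  proof (rule banach_fix_type)
    show "\<forall>\<phi> \<psi>. dist (Bcontfun (T (apply_bcontfun \<phi>))) (Bcontfun (T (apply_bcontfun \<psi>))) \<le> 1 / 2 * dist \<phi> \<psi>"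
    proof (intro allI dist_bound)
      fix \<phi> \<psi> :: "real \<Rightarrow>\<^sub>C 'a" and t
      let ?p = "apply_bcontfun \<phi>" and ?q = "apply_bcontfun \<psi>"
      have d: "norm (?p \<tau> - ?q \<tau>) \<le> dist \<phi> \<psi>" for \<tau>
        using dist_bounded[of \<phi> \<tau> \<psi>] by (simp add: dist_norm)
      have "dist (T ?p t) (T ?q t) = norm ((J ?p (clip t) - J ?q (clip t)) - (J ?p t0 - J ?q t0))"
        by (simp add: T_def dist_norm algebra_simps)
      also have "\<dots> \<le> 2 * h * (L' * dist \<phi> \<psi>) + 2 * h * (L' * dist \<phi> \<psi>)"
      proof -
        have "norm (J ?p (clip t) - J ?q (clip t)) \<le> 2 * h * (L' * dist \<phi> \<psi>)"
          by (rule J_lip[OF _ _ clip d]) simp_all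
        moreover have "norm (J ?p t0 - J ?q t0) \<le> 2 * h * (L' * dist \<phi> \<psi>)"
          by (rule J_lip[OF _ _ t0 d]) simp_all
        ultimately show ?thesis
          using norm_triangle_ineq4[of "J ?p (clip t) - J ?q (clip t)" "J ?p t0 - J ?q t0"] by linarith
      qed
      also have "\<dots> = (4 * h * L') * dist \<phi> \<psi>" by simp
      also have "\<dots> \<le> 1 / 2 * dist \<phi> \<psi>" using h(2) by (intro mult_right_mono) auto
      finally show "dist (apply_bcontfun (Bcontfun (T ?p)) t) (apply_bcontfun (Bcontfun (T ?q)) t) \<le> 1 / 2 * dist \<phi> \<psi>"
        by (simp add: Bcontfun_inverse[OF T_bcontfun])
    qed
  qed auto
  then obtain \<phi> where \<phi>: "Bcontfun (T (apply_bcontfun \<phi>)) = \<phi>" by blast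
  define y where "y = apply_bcontfun \<phi>"
  have cy: "continuous_on UNIV y" by (simp add: y_def)
  have y: "y t = y0 + (J y t - J y t0)" if "t \<in> {t0 - h..t0 + h}" for t
  proof -
    have "y t = T y t" using \<phi> Bcontfun_inverse[OF T_bcontfun, of \<phi>] by (simp add: y_def)
    moreover have "clip t = t" using that by (simp add: clip_def)
    ultimately show ?thesis by (simp add: T_def)
  qed
  have y_ball: "y t \<in> cball y0 r" if "t \<in> {t0 - h..t0 + h}" for t
  proof -
    have "norm (J y t - J y t0) \<le> 2 * h * M + 2 * h * M"
      using norm_triangle_ineq4[of "J y t" "J y t0"] J_bound[OF cy that] J_bound[OF cy t0] by linarith
    then have "norm (J y t - J y t0) \<le> r" using h(3) by linarith
    then show ?thesis using y[OF that] by (simp add: dist_norm norm_minus_commute)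
  qed
  show thesis
  proof (rule that[OF h(1)]; (intro ballI)?)
    show "y t0 = y0" using y[OF t0] by simp
    show "y t \<in> cball y0 r" if "t \<in> {t0 - h..t0 + h}" for t by (rule y_ball[OF that])
    fix t assume t: "t \<in> {a..b} \<inter> {t0 - h..t0 + h}"
    have "((\<lambda>t. y0 + (J y t - J y t0)) has_vector_derivative G t (y t)) (at t within {t0 - h..t0 + h})"
      using J_deriv[OF cy, of t] t by (auto intro!: derivative_eq_intros)
    then have "(y has_vector_derivative G t (y t)) (at t within {t0 - h..t0 + h})"
      by (rule has_vector_derivative_transform[rotated 2]) (use t y in auto)
    \<comment> \<open>At this point the clamping and the projection both act as the identity, so the
      modified equation is the original one.\<close>
    moreover have "\<rho> t = t" using t by (auto simp: \<rho>_def)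
    then have "G t (y t) = F t (y t)" using P_id[OF y_ball] t by (simp add: G_def)
    ultimately show "(y has_vector_derivative F t (y t)) (at t within {a..b} \<inter> {t0 - h..t0 + h})"
      by (auto intro: has_vector_derivative_within_subset)
  qed
qed

text \<open>The derivative in the second variable is continuous, hence bounded on the compact
  product, basis vector by basis vector. The mean value inequality on the convex set
  \<open>B\<close> turns this into a Lipschitz bound uniform in the parameter.\<close>

lemma smooth_on_lipschitz_compact:
  fixes H :: "'a::euclidean_space \<times> 'b::euclidean_space \<Rightarrow> 'c::euclidean_space"
  assumes H: "smooth_on \<Omega> H" "open \<Omega>" and K: "compact K" "compact B" "convex B" "K \<times> B \<subseteq> \<Omega>"
  obtains L where "\<forall>k\<in>K. \<forall>y\<in>B. \<forall>y'\<in>B. norm (H (k, y) - H (k, y')) \<le> L * norm (y - y')"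
proof -
  let ?D = "\<lambda>z. frechet_derivative H (at z)"
  have "\<exists>M. \<forall>z\<in>K \<times> B. norm (?D z (0, b)) \<le> M" for b
  proof -
    have "smooth_on \<Omega> (\<lambda>z. ?D z (0, b))"
      by (rule smooth_on_frechet_derivative[OF H]) (use H(2) in \<open>auto simp: thick_open smooth_on_id smooth_on_const\<close>)
    then have "continuous_on (K \<times> B) (\<lambda>z. ?D z (0, b))"
      by (rule continuous_on_subset[OF smooth_on_continuous K(4)])
    then have "compact ((\<lambda>z. ?D z (0, b)) ` (K \<times> B))"
      using K by (intro compact_continuous_image compact_Times)
    from compact_imp_bounded[OF this] show ?thesis by (simp add: bounded_iff)
  qed
  then obtain M where M: "\<And>b z. z \<in> K \<times> B \<Longrightarrow> norm (?D z (0, b)) \<le> M b" by metis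
  define L where "L = (\<Sum>b\<in>Basis. M b)"
  have bound: "norm (?D z (0, v)) \<le> L * norm v" if z: "z \<in> K \<times> B" for z v
  proof -
    have l: "linear (?D z)" by (rule smooth_on_linear_derivative[OF H]) (use z K(4) in blast)
    have "linear (\<lambda>v. ?D z (0, v))"
    proof (rule linearI)
      show "?D z (0, u + v) = ?D z (0, u) + ?D z (0, v)" for u v
        using linear_add[OF l, of "(0, u)" "(0, v)"] by simp
      show "?D z (0, c *\<^sub>R u) = c *\<^sub>R ?D z (0, u)" for c u
        using linear_cmul[OF l, of c "(0, u)"] by simp
    qed
    from linear_basis_expansion[OF this, of v]
    have "norm (?D z (0, v)) = norm (\<Sum>b\<in>Basis. (v \<bullet> b) *\<^sub>R ?D z (0, b))" by simp
    also have "\<dots> \<le> (\<Sum>b\<in>Basis. norm v * M b)"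
      by (intro sum_norm_le) (auto intro!: mult_mono M[OF z] simp: Basis_le_norm)
    finally show ?thesis by (simp add: L_def sum_distrib_left mult.commute)
  qed
  have "norm (H (k, y) - H (k, y')) \<le> L * norm (y - y')" if k: "k \<in> K" and y: "y \<in> B" "y' \<in> B" for k y y'
  proof (rule differentiable_bound[OF K(3) _ _ y])
    fix x assume x: "x \<in> B"
    then have z: "(k, x) \<in> \<Omega>" using k K(4) by blast
    have "((\<lambda>x. (k, x)) has_derivative (\<lambda>v. (0, v))) (at x)" by (auto intro!: derivative_eq_intros)
    from has_derivative_compose[OF this smooth_on_has_derivative[OF H z]]
    show "((\<lambda>x. H (k, x)) has_derivative (\<lambda>v. ?D (k, x) (0, v))) (at x within B)"
      by (rule has_derivative_at_withinI)
    show "onorm (\<lambda>v. ?D (k, x) (0, v)) \<le> L"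
      by (rule onorm_le) (use bound[of "(k, x)"] k x in auto)
  qed
  then show thesis by (intro that ballI)
qed

text \<open>Bootstrapping: if \<open>y\<close> is of class C^n, then so is the right-hand side of
  its equation, and \<open>y\<close> gains one order.\<close>

lemma ode_solution_smooth:
  fixes y :: "real \<Rightarrow> 'a::euclidean_space" and k :: "real \<Rightarrow> 'b::euclidean_space"
  assumes J: "thick J" and H: "smooth_on \<Omega> H" "open \<Omega>" and k: "smooth_on J k"
    and mem: "\<And>t. t \<in> J \<Longrightarrow> (k t, y t) \<in> \<Omega>"
    and y: "\<And>t. t \<in> J \<Longrightarrow> (y has_vector_derivative H (k t, y t)) (at t within J)"
  shows "smooth_on J y"
  unfolding smooth_on_def
proof
  fix n show "Ck_on n J y"
  proof (induction n)
    case 0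
    show ?case
      unfolding Ck_on.simps continuous_on_eq_continuous_within
      by (intro ballI has_vector_derivative_continuous[OF y])
  next
    case (Suc n)
    show ?case
    proof (rule Ck_on_SucI[OF J])
      show "(y has_derivative (\<lambda>v. v *\<^sub>R H (k t, y t))) (at t within J)" if "t \<in> J" for t
        using y[OF that] by (simp add: has_vector_derivative_def)
      have "Ck_on n J (\<lambda>t. H (k t, y t))"
      proof (rule Ck_on_compose[OF J H(2)])
        show "(\<lambda>t. (k t, y t)) ` J \<subseteq> \<Omega>" using mem by blast
        show "Ck_on n J (\<lambda>t. (k t, y t))" using k Suc by (intro Ck_on_Pair[OF J]) (simp_all add: smooth_on_def)
        show "Ck_on n \<Omega> H" using H(1) by (simp add: smooth_on_def)
      qed
      then show "Ck_on n J (\<lambda>t. v *\<^sub>R H (k t, y t))" for v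
        by (rule Ck_on_linear[OF bounded_linear_scaleR_right J])
    qed
  qed
qed

text \<open>The compact interval is needed for the uniform estimates on the equation, and it must
  still contain a relative neighbourhood of \<open>t\<close> when \<open>t\<close> is an end point
  of \<open>I\<close>. The two sides are therefore treated separately.\<close>

lemma interval_neighbourhood:
  fixes I J :: "real set"
  assumes J: "openin (top_of_set I) J" "t \<in> J" and I: "is_interval I"
  obtains a b \<delta> where "a \<le> t" "t \<le> b" "{a..b} \<subseteq> J" "\<delta> > 0" "I \<inter> {t - \<delta><..<t + \<delta>} \<subseteq> {a..b}"
proof -
  obtain T where T: "open T" "J = I \<inter> T" using J(1) openin_open by blast
  obtain e where e: "e > 0" "ball t e \<subseteq> T" using T J(2) openE by blast
  have near: "s \<in> J" if "s \<in> I" "\<bar>s - t\<bar> < e" for s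
    using that T(2) e(2) by (auto simp: dist_real_def abs_minus_commute subset_iff)
  have tI: "t \<in> I" using J(2) T(2) by blast
  obtain a \<delta> where a: "a \<le> t" "{a..t} \<subseteq> J" "\<delta> > 0" "\<And>s. s \<in> I \<Longrightarrow> t - \<delta> < s \<Longrightarrow> s \<le> t \<Longrightarrow> a \<le> s"
  proof (cases "\<exists>s\<in>I. s < t")
    case True
    then obtain s where s: "s \<in> I" "s < t" by blast
    let ?a = "max s (t - e / 2)"
    have "{?a..t} \<subseteq> J"
    proof
      fix r assume r: "r \<in> {?a..t}"
      then have "r \<in> I" using I s(1) tI unfolding is_interval_1 by (metis atLeastAtMost_iff max.bounded_iff)
      then show "r \<in> J" using near[of r] r e(1) by auto
    qed
    moreover have "?a < t" using s e(1) by simp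
    ultimately show thesis by (intro that[of ?a "t - ?a"]) auto
  next
    \<comment> \<open>Here \<open>t\<close> is the left end of \<open>I\<close>: the compact
      interval starts at \<open>t\<close>, and any positive \<open>\<delta>\<close> will do.\<close>
    case False
    then show thesis using J(2) by (intro that[of t 1]) force+
  qed
  obtain b \<epsilon> where b: "t \<le> b" "{t..b} \<subseteq> J" "\<epsilon> > 0" "\<And>s. s \<in> I \<Longrightarrow> s < t + \<epsilon> \<Longrightarrow> t \<le> s \<Longrightarrow> s \<le> b"
  proof (cases "\<exists>s\<in>I. t < s")
    case True
    then obtain s where s: "s \<in> I" "t < s" by blast
    let ?b = "min s (t + e / 2)"
    have "{t..?b} \<subseteq> J"
    proof
      fix r assume r: "r \<in> {t..?b}"
      then have "r \<in> I" using I s(1) tI unfolding is_interval_1 by (metis atLeastAtMost_iff min.bounded_iff)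
      then show "r \<in> J" using near[of r] r e(1) by auto
    qed
    moreover have "t < ?b" using s e(1) by simp
    ultimately show thesis by (intro that[of ?b "?b - t"]) auto
  next
    case False
    then show thesis using J(2) by (intro that[of t 1]) force+
  qed
  have "{a..b} \<subseteq> J"
  proof
    fix s assume "s \<in> {a..b}"
    then show "s \<in> J" using a(2) b(2) by (cases "s \<le> t") auto
  qed
  moreover have "I \<inter> {t - min \<delta> \<epsilon><..<t + min \<delta> \<epsilon>} \<subseteq> {a..b}"
  proof
    fix s assume s: "s \<in> I \<inter> {t - min \<delta> \<epsilon><..<t + min \<delta> \<epsilon>}"
    then show "s \<in> {a..b}" using a(1) a(4)[of s] b(1) b(4)[of s] by (cases "s \<le> t") auto
  qed
  ultimately show thesis using a(1,3) b(1,3) by (intro that[of a b "min \<delta> \<epsilon>"]) auto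
qed

context spray_bundle begin

section \<open>Horizontal lifts\<close>

text \<open>By \<open>horizontal_iff\<close>, being horizontal is a first order equation for the
  fibre coordinate alone, since the base coordinate \<open>x\<close> is prescribed. Treating
  \<open>(x, x')\<close> as a parameter \<open>k\<close> makes the right-hand side smooth in
  \<open>(k t, y)\<close>. The equation is in general nonlinear in \<open>y\<close>, so the lift is
  local.\<close>

lemma horizontal_lift_exists:
  assumes I: "is_interval I" "thick I" and \<gamma>: "smooth_curve A I \<gamma>" and t0: "t\<^sub>0 \<in> I"
    and w: "w \<in> points (slit A)" "fst w = \<gamma> t\<^sub>0"
  obtains J \<mu> where "horizontal_lift_through A S I \<gamma> t\<^sub>0 w J \<mu>"
proof -
  obtain c where c: "c \<in> A" "fst w \<in> fst c" using slit_point_chart[OF w(1)] .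
  let ?C = "lift_chart c"
  note mem = slit_chart_mem[OF w(1) c]
  let ?I = "{t \<in> I. \<gamma> t \<in> fst c}"
  let ?O = "snd c ` fst c"
  let ?s = "section_chart c S"
  define x where "x = snd c \<circ> \<gamma>"
  define x' where "x' t = vector_derivative x (at t within I)" for t
  have Ic: "openin (top_of_set I) ?I" "smooth_on ?I x" unfolding x_def by (rule curve_in_chart[OF \<gamma> c(1)])+
  have thickI: "thick ?I" by (rule thick_openin[OF I(2) Ic(1)])
  have xO: "x t \<in> ?O" if "t \<in> ?I" for t using that by (simp add: x_def)
  have sx': "smooth_on ?I x'"
    using smooth_on_vector_derivative[OF thickI Ic(2)]
    by (rule smooth_on_cong[THEN iffD1, rotated]) (simp add: x'_def at_within_openin[OF Ic(1)])
  \<comment> \<open>In the chart, horizontal lifts are the solutions of \<open>y' = H ((x, x'), y)\<close>.\<close>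
  define H :: "('e \<times> 'e) \<times> 'e \<Rightarrow> 'e"
    where "H z = (1/2) *\<^sub>R frechet_derivative ?s (at (fst (fst z), snd z)) (0, snd (fst z))" for z
  let ?\<Omega> = "(?O \<times> (UNIV :: 'e set)) \<times> (- {0 :: 'e})"
  have \<Omega>: "open ?\<Omega>" by (intro open_Times open_chart_image[OF c(1)] open_UNIV) auto
  note t\<Omega> = thick_open[OF \<Omega>]
  have range: "snd ?C ` fst ?C = ?O \<times> (- {0})" by (rule slit_chart_range[OF c(1)])
  have sH: "smooth_on ?\<Omega> H"
  proof -
    have id: "smooth_on ?\<Omega> (\<lambda>z. z)" by (rule smooth_on_id[OF t\<Omega>])
    have "smooth_on ?\<Omega> (\<lambda>z. frechet_derivative ?s (at (fst (fst z), snd z)) (0, snd (fst z)))"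
    proof (rule smooth_on_frechet_derivative[OF smooth_section_chart[OF spray_gfields c(1)]
          slit.open_chart_image[OF mem(1)] t\<Omega>])
      show "smooth_on ?\<Omega> (\<lambda>z. (fst (fst z), snd z))"
        by (intro smooth_on_Pair[OF t\<Omega>] smooth_on_fst[OF t\<Omega>] smooth_on_snd[OF t\<Omega>] id)
      show "smooth_on ?\<Omega> (\<lambda>z. (0 :: 'e, snd (fst z)))"
        by (intro smooth_on_Pair[OF t\<Omega>] smooth_on_fst[OF t\<Omega>] smooth_on_snd[OF t\<Omega>] id smooth_on_const[OF t\<Omega>])
      show "(\<lambda>z. (fst (fst z), snd z)) ` ?\<Omega> \<subseteq> snd ?C ` fst ?C" unfolding range by auto
    qed
    then show ?thesis
      unfolding H_def[abs_def] by (rule smooth_on_linear[OF bounded_linear_scaleR_right t\<Omega>])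
  qed
  define k where "k t = (x t, x' t)" for t
  have sk: "smooth_on ?I k" unfolding k_def[abs_def] by (rule smooth_on_Pair[OF thickI Ic(2) sx'])
  obtain a b \<delta> where ab: "a \<le> t\<^sub>0" "t\<^sub>0 \<le> b" "{a..b} \<subseteq> ?I" "\<delta> > 0" "I \<inter> {t\<^sub>0 - \<delta><..<t\<^sub>0 + \<delta>} \<subseteq> {a..b}"
    by (rule interval_neighbourhood[OF Ic(1) _ I(1), of t\<^sub>0]) (use t0 w(2) c in auto)
  define y0 where "y0 = snd w c"
  \<comment> \<open>Half the norm of the initial vector, so that the closed ball avoids zero and the
    solution stays in the slit bundle.\<close>
  define r where "r = norm y0 / 2"
  have r: "r > 0" using mem(3) by (simp add: r_def y0_def)
  have ball: "cball y0 r \<subseteq> - {0}" using r by (auto simp: r_def)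
  have K: "k ` {a..b} \<times> cball y0 r \<subseteq> ?\<Omega>" using ab(3) xO ball by (auto simp: k_def)
  have ck: "continuous_on {a..b} k" by (rule continuous_on_subset[OF smooth_on_continuous[OF sk] ab(3)])
  have comp: "compact (k ` {a..b})" by (rule compact_continuous_image[OF ck compact_Icc])
  obtain L where L: "\<forall>z\<in>k ` {a..b}. \<forall>y\<in>cball y0 r. \<forall>y'\<in>cball y0 r.
      norm (H (z, y) - H (z, y')) \<le> L * norm (y - y')"
    by (rule smooth_on_lipschitz_compact[OF sH \<Omega> comp compact_cball convex_cball K])
  have cont: "continuous_on ({a..b} \<times> cball y0 r) (\<lambda>(t, y). H (k t, y))"
  proof -
    have "continuous_on ({a..b} \<times> cball y0 r) (\<lambda>p. (k (fst p), snd p))"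
      by (intro continuous_on_Pair continuous_on_compose2[OF ck] continuous_intros) auto
    moreover have "(\<lambda>p. (k (fst p), snd p)) ` ({a..b} \<times> cball y0 r) \<subseteq> ?\<Omega>"
    proof
      fix q assume "q \<in> (\<lambda>p. (k (fst p), snd p)) ` ({a..b} \<times> cball y0 r)"
      then have "q \<in> k ` {a..b} \<times> cball y0 r" by force
      then show "q \<in> ?\<Omega>" by (rule subsetD[OF K])
    qed
    ultimately have "continuous_on ({a..b} \<times> cball y0 r) (\<lambda>p. H (k (fst p), snd p))"
      by (rule continuous_on_compose2[OF smooth_on_continuous[OF sH]])
    then show ?thesis by (simp add: case_prod_beta')
  qed
  have lip: "norm (H (k t, y) - H (k t, y')) \<le> L * norm (y - y')"
    if "t \<in> {a..b}" "y \<in> cball y0 r" "y' \<in> cball y0 r" for t y y'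
    using L that by blast
  obtain h y where hy: "h > 0" "y t\<^sub>0 = y0" "\<forall>t\<in>{t\<^sub>0 - h..t\<^sub>0 + h}. y t \<in> cball y0 r"
    "\<forall>t\<in>{a..b} \<inter> {t\<^sub>0 - h..t\<^sub>0 + h}.
      (y has_vector_derivative H (k t, y t)) (at t within {a..b} \<inter> {t\<^sub>0 - h..t\<^sub>0 + h})"
    by (rule ode_local_solution[OF ab(1,2) r cont lip])
  \<comment> \<open>A lift must be defined on a relatively open subinterval of \<open>I\<close>. The
    bound \<open>\<delta>\<close> keeps it within \<open>{a..b}\<close>, the bound \<open>h\<close>
    within the domain of the solution.\<close>
  define J where "J = I \<inter> {t\<^sub>0 - min \<delta> h<..<t\<^sub>0 + min \<delta> h}"
  have J: "openin (top_of_set I) J" "is_interval J" "t\<^sub>0 \<in> J"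
    unfolding J_def using t0 ab(4) hy(1) I(1)
    by (auto simp: openin_open_Int intro: is_interval_Int is_interval_oo)
  have Jsub: "J \<subseteq> {a..b} \<inter> {t\<^sub>0 - h..t\<^sub>0 + h}"  proof
    fix t assume t: "t \<in> J"
    then have "t \<in> I \<inter> {t\<^sub>0 - \<delta><..<t\<^sub>0 + \<delta>}" by (auto simp: J_def)
    then have "t \<in> {a..b}" using ab(5) by blast
    then show "t \<in> {a..b} \<inter> {t\<^sub>0 - h..t\<^sub>0 + h}" using t by (auto simp: J_def)
  qed
  have JI: "J \<subseteq> ?I" using Jsub ab(3) by blast
  have tJ: "thick J" by (rule thick_openin[OF I(2) J(1)])
  have J_Ic: "openin (top_of_set ?I) J" by (rule openin_subset_trans[OF J(1) JI]) auto
  have atJ: "at t within J = at t within I" if "t \<in> J" for t by (rule at_within_openin[OF J(1) that])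
  have y': "(y has_vector_derivative H (k t, y t)) (at t within J)" if "t \<in> J" for t
    by (rule has_vector_derivative_within_subset[OF bspec[OF hy(4)] Jsub]) (use that Jsub in blast)
  have y_ne: "y t \<noteq> 0" if "t \<in> J" for t using hy(3) Jsub that ball by blast
  have xJ: "x t \<in> ?O" if "t \<in> J" for t by (rule xO) (use that JI in blast)
  have sy: "smooth_on J y"
    by (rule ode_solution_smooth[OF tJ sH \<Omega> smooth_on_openin[OF sk J_Ic] _ y'])
      (use xJ y_ne in \<open>simp_all add: k_def\<close>)
  have sxJ: "smooth_on J x" by (rule smooth_on_openin[OF Ic(2) J_Ic])
  have sxy: "smooth_on J (\<lambda>t. (x t, y t))" by (rule smooth_on_Pair[OF tJ sxJ sy])
  define \<mu> where "\<mu> t = slit_point c (x t) (y t)" for t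
  have fst_\<mu>: "fst (\<mu> t) = \<gamma> t" if "t \<in> J" for t
    using JI that cinv_chart[OF c(1)] by (auto simp: \<mu>_def slit_point_def x_def)
  have \<mu>C: "\<mu> t \<in> fst ?C" "snd ?C (\<mu> t) = (x t, y t)" if "t \<in> J" for t
    unfolding \<mu>_def by (rule slit_point[OF c(1) xJ[OF that] y_ne[OF that]])+
  have \<mu>p: "\<mu> t \<in> points (slit A)" if "t \<in> J" for t by (rule slit_chart_points[OF c(1) \<mu>C(1)[OF that]])
  have \<mu>0: "\<mu> t\<^sub>0 = w"
  proof (rule inj_onD[OF inj_on_slit_chart[OF c(1)] _ \<mu>C(1)[OF J(3)] mem(2)])
    show "snd ?C (\<mu> t\<^sub>0) = snd ?C w"
      unfolding \<mu>C(2)[OF J(3)] by (simp add: hy(2) y0_def snd_slit_chart x_def w(2))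
  qed
  have \<mu>: "smooth_curve (slit A) J \<mu>"
    unfolding smooth_curve_def
  proof (intro conjI ballI \<mu>p)
    fix d' assume "d' \<in> slit A"
    then obtain d where d: "d \<in> A" "d' = lift_chart d" unfolding slit_def by blast
    let ?K = "{t \<in> J. \<mu> t \<in> fst d'}"
    have K_eq: "?K = J \<inter> {t \<in> I. \<gamma> t \<in> fst d}"
      using in_slit_chart_iff[OF \<mu>p, of _ d] fst_\<mu> d(2) JI by auto
    have "openin (top_of_set I) (J \<inter> {t \<in> I. \<gamma> t \<in> fst d})"
      by (rule openin_Int[OF J(1) curve_in_chart(1)[OF \<gamma> d(1)]])
    then show K: "openin (top_of_set J) ?K"
      unfolding K_eq by (rule openin_subset_trans) (use openin_imp_subset[OF J(1)] in auto)
    have tK: "thick ?K" by (rule thick_openin[OF tJ K])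
    have d': "d' \<in> slit A" using d slit_chart_in_slit by simp
    have "smooth_on ?K (\<lambda>t. (snd d' \<circ> cinv ?C) (x t, y t))"
      by (rule smooth_on_compose[OF slit.smooth_transition[OF mem(1) d']
            slit.open_overlap[OF mem(1) d'] tK smooth_on_openin[OF sxy K]])
        (use \<mu>C in force)
    then show "smooth_on ?K (snd d' \<circ> \<mu>)"
    proof (rule smooth_on_cong[THEN iffD1, rotated])
      fix t assume "t \<in> ?K"
      then have "t \<in> J" by simp
      then show "(snd d' \<circ> cinv ?C) (x t, y t) = (snd d' \<circ> \<mu>) t"
        using slit.cinv_chart[OF mem(1) \<mu>C(1)] \<mu>C(2) by simp
    qed
  qed
  have "lift_through A I \<gamma> t\<^sub>0 w J \<mu>"
    unfolding lift_through_def using J \<mu> fst_\<mu> \<mu>0 by simp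
  moreover have "velocity (slit A) J \<mu> t \<in> horizontal A S (\<mu> t)" if t: "t \<in> J" for t
  proof -
    have ct: "fst (\<mu> t) \<in> fst c" using \<mu>C(1)[OF t] by (simp add: in_slit_chart)
    have "((\<lambda>t. (x t, y t)) has_vector_derivative (x' t, H (k t, y t))) (at t within J)"
    proof (rule has_vector_derivative_Pair[OF _ y'[OF t]])
      show "(x has_vector_derivative x' t) (at t within J)"
        using smooth_on_has_vector_derivative[OF sxJ t] by (simp add: x'_def atJ[OF t])
    qed
    then have "((snd ?C \<circ> \<mu>) has_vector_derivative (x' t, H (k t, y t))) (at t within J)"
      by (rule has_vector_derivative_transform[OF t, rotated]) (simp add: \<mu>C(2))
    then have v: "velocity (slit A) J \<mu> t ?C = (x' t, H (k t, y t))"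
      using slit.velocity_chart[of ?C \<mu> t J] mem(1) \<mu>C(1)[OF t] vector_derivative_thick[OF tJ t] by simp
    show ?thesis
      unfolding horizontal_iff[OF \<mu>p[OF t] c(1) ct] v
      using slit.velocity_tangent[OF \<mu> tJ t] by (simp add: \<mu>C(2)[OF t] H_def k_def spray_deriv_def)
  qed
  ultimately show thesis by (intro that[of J \<mu>]) (simp add: horizontal_lift_through_def)
qed

text \<open>Some horizontal lift exists, so the description in \<open>D_along_at\<close> is
  satisfied; and every horizontal lift gives the value obtained from \<open>\<mu>\<close>, so it is
  determined.\<close>

lemma D_along_at_lift_independent:
  assumes N: "linear_connection A N" and T: "\<forall>X\<in>slit.gfields. \<forall>Y\<in>slit.gfields. torsion A N X Y = 0"
    and I: "is_interval I" "thick I" and \<gamma>: "smooth_curve A I \<gamma>" and V: "V \<in> fields_along A I \<gamma>"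
    and t0: "t\<^sub>0 \<in> I" and l: "lift_through A I \<gamma> t\<^sub>0 w J \<mu>"
  shows "D_along_at A S N I \<gamma> w V t\<^sub>0 = vlift_inv A w (cov_deriv_along A N J \<mu> (vlift_along A \<mu> V) t\<^sub>0)"
proof -
  interpret connection A N by unfold_locales (rule N)
  have w: "w \<in> points (slit A)" "fst w = \<gamma> t\<^sub>0" using lift_through_facts[OF I(2) l] by auto
  obtain J' \<mu>' where h: "horizontal_lift_through A S I \<gamma> t\<^sub>0 w J' \<mu>'"
    by (rule horizontal_lift_exists[OF I \<gamma> t0 w])
  have eq: "cov_deriv_along A N J'' \<mu>'' (vlift_along A \<mu>'' V) t\<^sub>0 = cov_deriv_along A N J \<mu> (vlift_along A \<mu> V) t\<^sub>0"
    if "horizontal_lift_through A S I \<gamma> t\<^sub>0 w J'' \<mu>''" for J'' \<mu>''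
    by (rule cov_deriv_along_lift_independent[OF T I(2) V _ l]) (use that in \<open>simp add: horizontal_lift_through_def\<close>)
  show ?thesis
    unfolding D_along_at_def
  proof (rule the_equality)
    show "\<exists>J' \<mu>'. horizontal_lift_through A S I \<gamma> t\<^sub>0 w J' \<mu>' \<and>
        vlift_inv A w (cov_deriv_along A N J \<mu> (vlift_along A \<mu> V) t\<^sub>0) =
        vlift_inv A w (cov_deriv_along A N J' \<mu>' (vlift_along A \<mu>' V) t\<^sub>0)"
      using h eq[OF h] by (intro exI[of _ J'] exI[of _ \<mu>']) simp
  qed (elim exE conjE, simp add: eq)
qed

end

theorem proposition2p15:
  fixes A :: "('p, 'e::euclidean_space) chart set"
    and S :: "('p, 'e) tvec \<Rightarrow> ('p, 'e) ttvec"
    and \<O> :: "'p set"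
    and W :: "'p \<Rightarrow> ('p, 'e) chart \<Rightarrow> 'e"
    and I :: "real set"
    and \<gamma> :: "real \<Rightarrow> 'p"
  assumes "smooth_manifold A"
    and "spray A S"
    and "openin (manifold_topology A) \<O>"
    and "W \<in> fields A \<O>" and "\<forall>x\<in>\<O>. W x \<noteq> 0"
    and "regular_curve A I \<gamma>"
  shows
    "(\<forall>N N'. lift_of_canonical_connection A S N \<and> lift_of_canonical_connection A S N' \<and>
        (\<forall>Y\<in>slit_fields A. torsion A N S Y = 0) \<and> (\<forall>Y\<in>slit_fields A. torsion A N' S Y = 0) \<longrightarrow>
        (\<forall>V\<in>fields A \<O>. \<forall>x\<in>\<O>. D_field A S N W W V x = D_field A S N' W W V x) \<and>
        (\<forall>V\<in>fields_along A I \<gamma>. \<forall>t\<in>I.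
           D_along A S N I \<gamma> (velocity A I \<gamma>) V t = D_along A S N' I \<gamma> (velocity A I \<gamma>) V t)) \<and>
     (\<forall>N. lift_of_canonical_connection A S N \<and>
        (\<forall>X\<in>slit_fields A. \<forall>Y\<in>slit_fields A. torsion A N X Y = 0) \<longrightarrow>
        (\<forall>w\<in>points (slit A). \<forall>u\<in>tangent_space A (fst w). \<forall>U. \<forall>V\<in>fields A U.
           openin (manifold_topology A) U \<and> fst w \<in> U \<longrightarrow>
           (\<forall>\<xi>\<in>tangent_space (slit A) w. dproj A w \<xi> = u \<longrightarrow>
              D_at A S N w u V = vlift_inv A w (cov_deriv_at A N w \<xi> (vlift A V)))) \<and>
        (\<forall>V\<in>fields_along A I \<gamma>. \<forall>t\<^sub>0\<in>I. \<forall>w\<in>points (slit A). \<forall>J \<mu>.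
           fst w = \<gamma> t\<^sub>0 \<and> lift_through A I \<gamma> t\<^sub>0 w J \<mu> \<longrightarrow>
           D_along_at A S N I \<gamma> w V t\<^sub>0 =
             vlift_inv A w (cov_deriv_along A N J \<mu> (vlift_along A \<mu> V) t\<^sub>0)))"
proof -
  interpret spray_bundle A S
    using assms(1,2) by unfold_locales (auto simp: smooth_manifold_def)
  \<comment> \<open>A regular curve lives on an interval with interior points, which makes
    derivatives within \<open>I\<close> unique, at end points too.\<close>
  have \<gamma>: "is_interval I" "thick I" "smooth_curve A I \<gamma>"
    using assms(6) thick_interval by (auto simp: regular_curve_def)
  have W: "(x, W x) \<in> points (slit A)" if "x \<in> \<O>" for x
    using that assms(3,4,5) openin_iff field_tangent[OF assms(4)] by (auto simp: in_slit_points)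
  show ?thesis
  proof (intro conjI allI impI ballI)
    fix N N' V x
    assume "lift_of_canonical_connection A S N \<and> lift_of_canonical_connection A S N' \<and>
      (\<forall>Y\<in>slit_fields A. torsion A N S Y = 0) \<and> (\<forall>Y\<in>slit_fields A. torsion A N' S Y = 0)" "x \<in> \<O>"
    then show "D_field A S N W W V x = D_field A S N' W W V x" by (intro D_field_spray W) blast+
  next
    fix N N' V t
    assume "lift_of_canonical_connection A S N \<and> lift_of_canonical_connection A S N' \<and>
      (\<forall>Y\<in>slit_fields A. torsion A N S Y = 0) \<and> (\<forall>Y\<in>slit_fields A. torsion A N' S Y = 0)"
    then show "D_along A S N I \<gamma> (velocity A I \<gamma>) V t = D_along A S N' I \<gamma> (velocity A I \<gamma>) V t"
      by (intro D_along_spray \<gamma>(2)) blast+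
  next
    fix N w u U V \<xi>
    assume N: "lift_of_canonical_connection A S N \<and>
        (\<forall>X\<in>slit_fields A. \<forall>Y\<in>slit_fields A. torsion A N X Y = 0)"
      and *: "w \<in> points (slit A)" "V \<in> fields A U" "openin (manifold_topology A) U \<and> fst w \<in> U"
        "\<xi> \<in> tangent_space (slit A) w" "dproj A w \<xi> = u"
    show "D_at A S N w u V = vlift_inv A w (cov_deriv_at A N w \<xi> (vlift A V))"
      unfolding *(5)[symmetric]
      by (rule D_at_lift_independent[of N U])
        (use N * in \<open>auto simp: lift_of_canonical_connection_def\<close>)
  next
    fix N V t\<^sub>0 w J \<mu>
    assume N: "lift_of_canonical_connection A S N \<and>
        (\<forall>X\<in>slit_fields A. \<forall>Y\<in>slit_fields A. torsion A N X Y = 0)"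
      and *: "V \<in> fields_along A I \<gamma>" "t\<^sub>0 \<in> I" "fst w = \<gamma> t\<^sub>0 \<and> lift_through A I \<gamma> t\<^sub>0 w J \<mu>"
    show "D_along_at A S N I \<gamma> w V t\<^sub>0 = vlift_inv A w (cov_deriv_along A N J \<mu> (vlift_along A \<mu> V) t\<^sub>0)"
      by (rule D_along_at_lift_independent[OF _ _ \<gamma> *(1,2)])
        (use N * in \<open>simp_all add: lift_of_canonical_connection_def\<close>)
  qed
qed

end
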